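(* Let the operators $A$, $\Sigma_0$, the truth $u^\dagger$ and the initial element $v_0$ satisfy Assumption A (in the context). Let $(\alpha_n)_{n\ge1}$ be a sequence of positive numbers, put $\sigma_n:=\sum_{j=1}^n\frac1{\alpha_j}$, and assume that there is a constant $\tilde c$ with $\frac{1}{\alpha_n}\le\tilde c\,\sigma_{n-1}$ for all $n\ge2$. Let $v_n$ be the iterates of the variant 3DVAR method (defined in the context) with parameters $(\alpha_n)$ computed from Data Model 1. Then there is a constant $C$, independent of $n$ and $\gamma$, such that for all $n\ge1$ $$\mathbb{E}\|v_n-u^\dagger\|^2\le C\left(\sigma_n^{-\frac{s}{a+1}}+\gamma^2\,\mathrm{tr}(\Sigma_0)\,\sigma_n\right).$$ In particular, for the geometric sequence $\alpha_n:=\alpha q^{n-1}$ with $\alpha>0$ and $0<q<1$, there is a constant $C$, independent of $n$ and $\gamma$, such that for all $n\ge 1$ $$\mathbb{E}\|v_n-u^\dagger\|^2\le C\left(q^{\frac{s}{a+1}n}+\gamma^2\,\mathrm{tr}(\Sigma_0)\,q^{-n}\right).$$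
   Context: $X,Y$ are Hilbert spaces, $A$ is a compact linear operator from $X$ to $Y$, $u^\dagger\in X$ is a fixed (deterministic) element, $\gamma>0$. $\|\cdot\|$ denotes the norm of $X$ (also of $Y$ and operator norms), $\mathcal{R}$ and $\mathcal{D}$ denote range and domain. $\mathcal{N}(0,\gamma^2 I)$ is the centred Gaussian on $Y$ with covariance $\gamma^2 I$ (Gaussian white noise if $Y$ is infinite dimensional, so that $\mathbb{E}\|F\eta\|^2=\gamma^2\,\mathrm{tr}(FF^* )$ for $\eta\sim\mathcal{N}(0,\gamma^2I)$ and a bounded linear $F:Y\to X$). Data Model 1: $y_n=Au^\dagger+\eta_n$, $n\ge1$, with $\eta_n$ i.i.d. $\mathcal{N}(0,\gamma^2I)$. Variant 3DVAR method: given $v_0\in X$, for $n\ge1$ $$\mathcal{K}_n=\Sigma_0A^*(A\Sigma_0A^*+\alpha_nI)^{-1},\qquad v_n=v_{n-1}+\mathcal{K}_n(y_n-Av_{n-1}),$$ with associated covariance $\mathcal{C}_n=\frac{\gamma^2}{\alpha_n}(I-\mathcal{K}_nA)\Sigma_0$. Assumption A: (i) $\mathcal{R}(\Sigma_0^{1/2})\subset\mathcal{D}(A)$, where $\Sigma_0$ is positive self-adjoint on $X$ and $\Sigma_0^{-1}$ is a densely defined unbounded self-adjoint strictly positive operator; (ii) there are constants $a>0$ and $1\le c<\infty$ with $c^{-1}\|\Sigma_0^{a/2}x\|\le\|Ax\|\le c\|\Sigma_0^{a/2}x\|$ for all $x\in X$; (iii) $v_0-u^\dagger\in\mathcal{D}(\Sigma_0^{-s/2})$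 with $0\le s\le a+2$; (iv) $\Sigma_0$ is trace class on $X$. *)

theory Defs
  imports "HOL-Probability.Probability"
begin

section \<open>Operators on real Hilbert spaces\<close>

definition compact_operator :: "('a::real_inner \<Rightarrow> 'b::real_inner) \<Rightarrow> bool" where
  "compact_operator A \<longleftrightarrow> linear A \<and> (\<forall>S. bounded S \<longrightarrow> compact (closure (A ` S)))"

definition positive_selfadjoint :: "('a::real_inner \<Rightarrow> 'a) \<Rightarrow> bool" where
  "positive_selfadjoint T \<longleftrightarrow>
     bounded_linear T \<and> (\<forall>x y. T x \<bullet> y = x \<bullet> T y) \<and> (\<forall>x. 0 \<le> T x \<bullet> x)"

text \<open>
  An operator which need not be bounded is given by its domain \<open>D\<close> and a total function \<open>L\<close>
  of which only the values on \<open>D\<close> matter.  The last conjunct of self-adjointness says that the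
  domain of the Hilbert space adjoint is contained in \<open>D\<close>.
\<close>

definition densely_defined :: "'a::real_inner set \<Rightarrow> ('a \<Rightarrow> 'a) \<Rightarrow> bool" where
  "densely_defined D L \<longleftrightarrow> subspace D \<and> closure D = UNIV \<and>
     (\<forall>x\<in>D. \<forall>y\<in>D. \<forall>r. L (x + y) = L x + L y \<and> L (r *\<^sub>R x) = r *\<^sub>R L x)"

definition selfadjoint_on :: "'a::real_inner set \<Rightarrow> ('a \<Rightarrow> 'a) \<Rightarrow> bool" where
  "selfadjoint_on D L \<longleftrightarrow>
     (\<forall>x\<in>D. \<forall>y\<in>D. L x \<bullet> y = x \<bullet> L y) \<and>
     {y. \<exists>z. \<forall>x\<in>D. L x \<bullet> y = x \<bullet> z} \<subseteq> D"

definition strictly_positive_on :: "'a::real_inner set \<Rightarrow> ('a \<Rightarrow> 'a) \<Rightarrow> bool" where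
  "strictly_positive_on D L \<longleftrightarrow> (\<exists>m>0. \<forall>x\<in>D. m * (norm x)\<^sup>2 \<le> L x \<bullet> x)"

definition unbounded_on :: "'a::real_inner set \<Rightarrow> ('a \<Rightarrow> 'a) \<Rightarrow> bool" where
  "unbounded_on D L \<longleftrightarrow> \<not> (\<exists>K. \<forall>x\<in>D. norm (L x) \<le> K * norm x)"

definition orthonormal_basis :: "'a::real_inner set \<Rightarrow> bool" where
  "orthonormal_basis E \<longleftrightarrow>
     pairwise orthogonal E \<and> (\<forall>e\<in>E. norm e = 1) \<and> closure (span E) = UNIV"

text \<open>
  Trace class property and trace of a positive self-adjoint operator, for which neither depends
  on the orthonormal basis.
\<close>

definition trace_class :: "('a::real_inner \<Rightarrow> 'a) \<Rightarrow> bool" where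
  "trace_class T \<longleftrightarrow> (\<exists>E. orthonormal_basis E \<and> (\<lambda>e. T e \<bullet> e) summable_on E)"

definition op_trace :: "('a::real_inner \<Rightarrow> 'a) \<Rightarrow> real" where
  "op_trace T = (\<Sum>\<^sub>\<infinity>e\<in>(SOME E. orthonormal_basis E). T e \<bullet> e)"


section \<open>Real powers of a compact positive self-adjoint operator\<close>

text \<open>
  If \<open>T\<close> is compact, positive and self-adjoint, then \<open>T = (\<Sum>\<lambda>. \<lambda> P\<^sub>\<lambda>)\<close> over its positive
  eigenvalues, with \<open>P\<^sub>\<lambda>\<close> the orthogonal projection onto the eigenspace.  Its functional calculus
  gives \<open>T\<^sup>p = (\<Sum>\<lambda>. \<lambda>\<^sup>p P\<^sub>\<lambda>)\<close> for real \<open>p\<close> of either sign (if \<open>T\<close> is not injective, this is the power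
  on the orthogonal complement of the kernel, extended by \<open>0\<close>).  A trace class operator is compact.
\<close>

definition eigenspace :: "('a::real_inner \<Rightarrow> 'a) \<Rightarrow> real \<Rightarrow> 'a set" where
  "eigenspace T l = {x. T x = l *\<^sub>R x}"

definition positive_eigenvalues :: "('a::real_inner \<Rightarrow> 'a) \<Rightarrow> real set" where
  "positive_eigenvalues T = {l. 0 < l \<and> eigenspace T l \<noteq> {0}}"

definition orthogonal_projection :: "'a::real_inner set \<Rightarrow> 'a \<Rightarrow> 'a" where
  "orthogonal_projection S x = (THE y. y \<in> S \<and> (\<forall>z\<in>S. orthogonal (x - y) z))"

definition op_power :: "('a::real_inner \<Rightarrow> 'a) \<Rightarrow> real \<Rightarrow> 'a \<Rightarrow> 'a" where
  "op_power T p x =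
     (\<Sum>\<^sub>\<infinity>l\<in>positive_eigenvalues T. (l powr p) *\<^sub>R orthogonal_projection (eigenspace T l) x)"

definition op_power_domain :: "('a::real_inner \<Rightarrow> 'a) \<Rightarrow> real \<Rightarrow> 'a set" where
  "op_power_domain T p =
     {x. (\<lambda>l. (l powr p) *\<^sub>R orthogonal_projection (eigenspace T l) x)
           summable_on positive_eigenvalues T}"


section \<open>Standing assumption on the operators and the initial error\<close>

text \<open>
  The inclusion of the range of the square root of \<open>S0\<close> in the domain of \<open>A\<close> needs no conjunct:
  \<open>A\<close> is defined on the whole space.
\<close>

definition assumption_A ::
  "('x::real_inner \<Rightarrow> 'y::real_inner) \<Rightarrow> ('x \<Rightarrow> 'x) \<Rightarrow> 'x \<Rightarrow> 'x \<Rightarrow> real \<Rightarrow> real \<Rightarrow> real \<Rightarrow> bool" where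
  "assumption_A A S0 u v0 a c s \<longleftrightarrow>
     positive_selfadjoint S0 \<and> inj S0 \<and>
     densely_defined (range S0) (inv S0) \<and> unbounded_on (range S0) (inv S0) \<and>
     selfadjoint_on (range S0) (inv S0) \<and> strictly_positive_on (range S0) (inv S0) \<and>
     0 < a \<and> 1 \<le> c \<and>
     (\<forall>x. inverse c * norm (op_power S0 (a / 2) x) \<le> norm (A x) \<and>
          norm (A x) \<le> c * norm (op_power S0 (a / 2) x)) \<and>
     0 \<le> s \<and> s \<le> a + 2 \<and> v0 - u \<in> op_power_domain S0 (- s / 2) \<and>
     trace_class S0"


section \<open>White noise, data and the variant 3DVAR iteration\<close>

text \<open>
  On an infinite-dimensional space, Gaussian white noise is not a random vector.  As usual it is
  the isonormal process: \<open>\<eta> z\<close> plays the role of the inner product of the noise with \<open>z\<close>.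
  Linearity makes the process jointly Gaussian, and polarisation gives the covariance
  \<open>E[\<eta> z * \<eta> w] = \<gamma>\<^sup>2 * (z \<bullet> w)\<close>.  By linearity \<open>\<eta> 0 = 0\<close> almost surely.
\<close>

definition white_noise :: "'w measure \<Rightarrow> real \<Rightarrow> ('y::real_inner \<Rightarrow> 'w \<Rightarrow> real) \<Rightarrow> bool" where
  "white_noise M \<gamma> \<eta> \<longleftrightarrow>
     (\<forall>z. \<eta> z \<in> borel_measurable M) \<and>
     (\<forall>r z w. AE \<omega> in M. \<eta> (r *\<^sub>R z + w) \<omega> = r * \<eta> z \<omega> + \<eta> w \<omega>) \<and>
     (\<forall>z. z \<noteq> 0 \<longrightarrow>
        distributed M lborel (\<eta> z) (\<lambda>t. ennreal (normal_density 0 (\<gamma> * norm z) t)))"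

text \<open>
  The data \<open>y n\<close> are a generalised random element in the same sense.  Independence is that of the
  whole processes.
\<close>

definition data_model_1 ::
  "'w measure \<Rightarrow> real \<Rightarrow> ('x::real_inner \<Rightarrow> 'y::real_inner) \<Rightarrow> 'x \<Rightarrow> (nat \<Rightarrow> 'y \<Rightarrow> 'w \<Rightarrow> real) \<Rightarrow> bool" where
  "data_model_1 M \<gamma> A u y \<longleftrightarrow>
     (\<exists>\<eta>. (\<forall>n\<ge>1. white_noise M \<gamma> (\<eta> n)) \<and>
          prob_space.indep_vars M (\<lambda>_. \<Pi>\<^sub>M z\<in>UNIV. borel) (\<lambda>n \<omega> z. \<eta> n z \<omega>) {1..} \<and>
          (\<forall>n\<ge>1. \<forall>z \<omega>. y n z \<omega> = A u \<bullet> z + \<eta> n z \<omega>))"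

text \<open>
  The random vector \<open>\<zeta>\<close> equals \<open>F Z\<close>, tested against every fixed vector.  Such a \<open>\<zeta>\<close> exists
  for white noise \<open>Z\<close> if \<open>F\<close> is a Hilbert-Schmidt operator, and is then unique up to null sets on a
  separable space.
\<close>

definition image_of_generalised ::
  "'w measure \<Rightarrow> ('y::real_inner \<Rightarrow> 'x::real_inner) \<Rightarrow> ('y \<Rightarrow> 'w \<Rightarrow> real) \<Rightarrow> ('w \<Rightarrow> 'x) \<Rightarrow> bool" where
  "image_of_generalised M F Z \<zeta> \<longleftrightarrow> (\<forall>x. AE \<omega> in M. \<zeta> \<omega> \<bullet> x = Z (adjoint F x) \<omega>)"

definition kalman_gain ::
  "('x::real_inner \<Rightarrow> 'y::real_inner) \<Rightarrow> ('x \<Rightarrow> 'x) \<Rightarrow> real \<Rightarrow> 'y \<Rightarrow> 'x" where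
  "kalman_gain A S0 al = S0 \<circ> adjoint A \<circ> inv (\<lambda>z. A (S0 (adjoint A z)) + al *\<^sub>R z)"

text \<open>
  The second clause is \<open>v n - v (n-1) = K\<^sub>n (y n - A (v (n-1)))\<close>, where \<open>y n\<close>, and hence the
  innovation, is a generalised random element.
\<close>

definition variant_3DVAR ::
  "'w measure \<Rightarrow> ('x::real_inner \<Rightarrow> 'y::real_inner) \<Rightarrow> ('x \<Rightarrow> 'x) \<Rightarrow> (nat \<Rightarrow> real) \<Rightarrow> 'x \<Rightarrow>
     (nat \<Rightarrow> 'y \<Rightarrow> 'w \<Rightarrow> real) \<Rightarrow> (nat \<Rightarrow> 'w \<Rightarrow> 'x) \<Rightarrow> bool" where
  "variant_3DVAR M A S0 \<alpha> v0 y v \<longleftrightarrow>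
     (\<forall>n. v n \<in> borel_measurable M) \<and>
     (\<forall>\<omega>. v 0 \<omega> = v0) \<and>
     (\<forall>n\<ge>1. image_of_generalised M (kalman_gain A S0 (\<alpha> n))
        (\<lambda>z \<omega>. y n z \<omega> - A (v (n - 1) \<omega>) \<bullet> z)
        (\<lambda>\<omega>. v n \<omega> - v (n - 1) \<omega>))"

end

theory Submission
  imports Defs
begin

text \<open>
  Let \<open>Q = S0\<^sup>1\<^sup>/\<^sup>2\<close> and \<open>H = Q A* A Q\<close>.  The gain is \<open>K\<^sub>n = Q (H + \<alpha>\<^sub>n)\<^sup>-\<^sup>1 Q A*\<close>, so that
  \<open>(I - K\<^sub>n A) Q = Q \<alpha>\<^sub>n (H + \<alpha>\<^sub>n)\<^sup>-\<^sup>1\<close>, and \<open>Q\<close> intertwines the iteration with the filter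
  \<open>r\<^sub>n(H)\<close>, where \<open>r\<^sub>n(x) = (\<Prod>i\<le>n. \<alpha>\<^sub>i / (x + \<alpha>\<^sub>i)) \<le> 1 / (1 + \<sigma>\<^sub>n x)\<close>.

  Bias: put \<open>G\<^sub>n = ((I - K\<^sub>n A) \<dots> (I - K\<^sub>1 A))*\<close>, so that \<open>Q G\<^sub>n = r\<^sub>n(H) Q\<close>.  It has to be shown that
  \<open>S0\<^sup>s\<^sup>/\<^sup>2 G\<^sub>n\<close> is of order \<open>\<sigma>\<^sub>n\<close> to the power \<open>-s / (2 (a + 1))\<close>.  By the moment inequality for the
  powers of \<open>S0\<close> only the endpoints \<open>s = a + 2\<close> and \<open>s = 0\<close> matter.  The first one follows from
  \<open>x r\<^sub>n(x) \<le> 1 / \<sigma>\<^sub>n\<close>, since \<open>A Q\<close> and the power \<open>(a + 1) / 2\<close> of \<open>S0\<close> have equivalent norms.  The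
  second one says that \<open>r\<^sub>n(H)\<close> is uniformly bounded in the norm of \<open>Q x\<close>; as \<open>r\<^sub>n(H)\<close> is a contraction
  in the norms of \<open>x\<close> and of \<open>A Q x\<close>, this is real interpolation.

  Variance: by independence, the covariance of \<open>v\<^sub>n\<close> is the sum of those contributed by the single
  steps, and \<open>x / (x + \<alpha>)\<^sup>2 \<le> 1 / (4 \<alpha>)\<close> bounds the contribution of step \<open>j\<close> by
  \<open>\<gamma>\<^sup>2 / (4 \<alpha>\<^sub>j)\<close> times \<open>S0\<close> in the operator order.
\<close>

section \<open>Orthonormal systems\<close>

text \<open>The Kronecker delta form lets inner products of basis vectors simplify to a case
  distinction.\<close>

definition orthonormal :: "'a::real_inner set \<Rightarrow> bool" where
  "orthonormal E \<longleftrightarrow> (\<forall>e\<in>E. \<forall>f\<in>E. e \<bullet> f = (if e = f then 1 else 0))"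

lemma orthonormal_basis_iff:
  "orthonormal_basis E \<longleftrightarrow> orthonormal E \<and> closure (span E) = UNIV"
proof -
  have "(pairwise orthogonal E \<and> (\<forall>e\<in>E. norm e = 1)) = orthonormal E"
    unfolding orthonormal_def pairwise_def orthogonal_def norm_eq_1 by (metis zero_neq_one)
  then show ?thesis by (auto simp: orthonormal_basis_def)
qed

lemma orthonormal_inner: "orthonormal E \<Longrightarrow> e \<in> E \<Longrightarrow> f \<in> E \<Longrightarrow> e \<bullet> f = (if e = f then 1 else 0)"
  by (simp add: orthonormal_def)

lemma inner_sum_orthonormal:
  assumes "orthonormal E" "finite F" "F \<subseteq> E" "e \<in> E"
  shows "(\<Sum>f\<in>F. c f *\<^sub>R f) \<bullet> e = (if e \<in> F then c e else 0)"
proof -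
  have "(\<Sum>f\<in>F. c f *\<^sub>R f) \<bullet> e = (\<Sum>f\<in>F. if f = e then c f else 0)"
    unfolding inner_sum_left using assms by (intro sum.cong) (auto simp: orthonormal_inner)
  then show ?thesis using assms(2) by simp
qed

lemma norm_sum_orthonormal:
  assumes "orthonormal E" "finite F" "F \<subseteq> E"
  shows "(norm (\<Sum>f\<in>F. c f *\<^sub>R f))\<^sup>2 = (\<Sum>f\<in>F. (c f)\<^sup>2)"
proof -
  have "(norm (\<Sum>f\<in>F. c f *\<^sub>R f))\<^sup>2 = (\<Sum>f\<in>F. c f * ((\<Sum>f\<in>F. c f *\<^sub>R f) \<bullet> f))"
    unfolding power2_norm_eq_inner inner_sum_right[of "\<Sum>f\<in>F. c f *\<^sub>R f"] inner_scaleR_right ..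
  also have "\<dots> = (\<Sum>f\<in>F. (c f)\<^sup>2)"
    by (intro sum.cong refl, subst inner_sum_orthonormal[OF assms])
       (use assms(3) in \<open>auto simp: power2_eq_square\<close>)
  finally show ?thesis .
qed

section \<open>Bessel's inequality and convergence of orthogonal series\<close>

lemma bessel_sum:
  assumes "orthonormal E" "finite F" "F \<subseteq> E"
  shows "(norm (x - (\<Sum>f\<in>F. (x \<bullet> f) *\<^sub>R f)))\<^sup>2 = (norm x)\<^sup>2 - (\<Sum>f\<in>F. (x \<bullet> f)\<^sup>2)"
proof -
  define p where "p = (\<Sum>f\<in>F. (x \<bullet> f) *\<^sub>R f)"
  have "x \<bullet> p = (\<Sum>f\<in>F. (x \<bullet> f)\<^sup>2)" unfolding p_def inner_sum_right by (simp add: power2_eq_square)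
  moreover have "p \<bullet> p = (\<Sum>f\<in>F. (x \<bullet> f)\<^sup>2)"
    using norm_sum_orthonormal[OF assms, of "\<lambda>f. x \<bullet> f"] by (simp add: p_def power2_norm_eq_inner)
  moreover have "(norm (x - p))\<^sup>2 = x \<bullet> x - 2 * (x \<bullet> p) + p \<bullet> p"
    by (simp add: power2_norm_eq_inner inner_diff_left inner_diff_right inner_commute)
  ultimately show ?thesis by (simp add: p_def power2_norm_eq_inner)
qed

lemma bessel_finite:
  assumes "orthonormal E" "finite F" "F \<subseteq> E"
  shows "(\<Sum>f\<in>F. (x \<bullet> f)\<^sup>2) \<le> (norm x)\<^sup>2"
  using bessel_sum[OF assms, of x] by (smt (verit) zero_le_power2)

lemma nonneg_bounded_sums_summable:
  fixes f :: "'i \<Rightarrow> real"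
  assumes "\<And>i. i \<in> I \<Longrightarrow> 0 \<le> f i" "\<And>F. finite F \<Longrightarrow> F \<subseteq> I \<Longrightarrow> sum f F \<le> B"
  shows "f summable_on I" "infsum f I \<le> B"
proof -
  show *: "f summable_on I"
    using assms by (intro nonneg_bdd_above_summable_on bdd_aboveI) auto
  show "infsum f I \<le> B" using infsum_le_finite_sums[OF *] assms by blast
qed

lemma bessel:
  assumes "orthonormal E"
  shows "(\<lambda>e. (x \<bullet> e)\<^sup>2) summable_on E" "infsum (\<lambda>e. (x \<bullet> e)\<^sup>2) E \<le> (norm x)\<^sup>2"
  using nonneg_bounded_sums_summable[of E "\<lambda>e. (x \<bullet> e)\<^sup>2" "(norm x)\<^sup>2"] bessel_finite[OF assms] by auto

lemma has_sum_inner_left: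
  assumes "(f has_sum S) I"
  shows "((\<lambda>i. f i \<bullet> x) has_sum S \<bullet> x) I"
  by (rule has_sum_bounded_linear[OF bounded_linear_inner_left assms])

lemma complete_UNIV_class: "uniform_space_class.complete (UNIV :: 'a::complete_space set)"
  by (simp add: complete_eq_closed)

text \<open>By Pythagoras, the squared norm of a difference of nested partial sums is a block of the
  scalar series. So the partial sums form a Cauchy filter, which converges by completeness.\<close>

lemma summable_on_orthogonal:
  fixes f :: "'i \<Rightarrow> 'a::{real_inner,complete_space}"
  assumes orth: "pairwise (\<lambda>i j. orthogonal (f i) (f j)) I"
    and sm: "(\<lambda>i. (norm (f i))\<^sup>2) summable_on I"
  shows "f summable_on I"
proof -
  define g where "g = (\<lambda>i. (norm (f i))\<^sup>2)"
  obtain L where L: "(g has_sum L) I" using sm by (auto simp: summable_on_def g_def)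
  have "\<exists>P. eventually P (finite_subsets_at_top I) \<and>
            (\<forall>F F'. P F \<and> P F' \<longrightarrow> dist (sum f F) (sum f F') < e)" if e: "e > 0" for e
  proof -
    have "eventually (\<lambda>F. dist (sum g F) L < (e/2)\<^sup>2) (finite_subsets_at_top I)"
      using L e unfolding has_sum_def tendsto_iff by simp
    then obtain F0 where F0: "finite F0" "F0 \<subseteq> I"
      and F0': "\<forall>F. finite F \<and> F0 \<subseteq> F \<and> F \<subseteq> I \<longrightarrow> dist (sum g F) L < (e/2)\<^sup>2"
      unfolding eventually_finite_subsets_at_top by auto
    define P where "P F \<longleftrightarrow> finite F \<and> F0 \<subseteq> F \<and> F \<subseteq> I" for F
    have "eventually P (finite_subsets_at_top I)"
      unfolding eventually_finite_subsets_at_top P_def using F0 by blast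
    moreover have near: "norm (sum f F - sum f F0) < e / 2" if "P F" for F
    proof -
      have fin: "finite F" "F0 \<subseteq> F" "F \<subseteq> I" using that by (auto simp: P_def)
      have "sum f F - sum f F0 = sum f (F - F0)" using fin by (simp add: sum_diff)
      moreover have "(norm (sum f (F - F0)))\<^sup>2 = sum g (F - F0)"
        unfolding g_def using fin
        by (intro norm_sum_Pythagorean) (auto intro: pairwise_subset[OF orth])
      moreover have "sum g (F - F0) = sum g F - sum g F0" using fin by (simp add: sum_diff)
      \<comment> \<open>The terms are nonnegative, so no finite sum exceeds \<open>L\<close>, while
        the sum over \<open>F0\<close> is already within \<open>(e/2)^2\<close> of it. Hence the
        block over \<open>F - F0\<close> is small.\<close>
      moreover have "sum g F \<le> L"
        using has_sum_mono_neutral[OF has_sum_finite[OF fin(1), of g] L] fin(3) by (auto simp: g_def)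
      moreover have "L - sum g F0 < (e/2)\<^sup>2"
        using spec[OF F0', of F0] F0 by (simp add: dist_real_def)
      ultimately have "(norm (sum f F - sum f F0))\<^sup>2 < (e/2)\<^sup>2" by simp
      then show ?thesis using e power_less_imp_less_base[of _ 2 "e/2"] by auto
    qed
    have "dist (sum f F) (sum f F') < e" if "P F" "P F'" for F F'
      using norm_triangle_lt[of "sum f F - sum f F0" "sum f F0 - sum f F'" e]
        near[OF that(1)] near[OF that(2)]
      by (simp add: dist_norm norm_minus_commute)
    ultimately show ?thesis by blast
  qed
  then have "cauchy_filter (filtermap (sum f) (finite_subsets_at_top I))"
    by (simp add: cauchy_filter_metric_filtermap)
  then obtain S where "(sum f \<longlongrightarrow> S) (finite_subsets_at_top I)"
    using complete_uniform[where S="UNIV::'a set"] complete_UNIV_class by (force simp: filterlim_def)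
  then show ?thesis by (auto simp: summable_on_def has_sum_def)
qed

lemma summable_on_orthonormal:
  fixes E :: "'a::{real_inner,complete_space} set"
  assumes "orthonormal E" "(\<lambda>e. (c e)\<^sup>2) summable_on E"
  shows "(\<lambda>e. c e *\<^sub>R e) summable_on E"
proof (rule summable_on_orthogonal)
  show "pairwise (\<lambda>i j. orthogonal (c i *\<^sub>R i) (c j *\<^sub>R j)) E"
    using assms(1) by (auto simp: pairwise_def orthogonal_def orthonormal_def)
  have "(norm (c e *\<^sub>R e))\<^sup>2 = (c e)\<^sup>2" if "e \<in> E" for e
    using orthonormal_inner[OF assms(1) that that] by (simp add: norm_eq_sqrt_inner)
  then show "(\<lambda>e. (norm (c e *\<^sub>R e))\<^sup>2) summable_on E"
    using assms(2) summable_on_cong by (metis (no_types, lifting))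
qed

lemma inner_orthonormal_series:
  assumes "orthonormal E" "((\<lambda>f. c f *\<^sub>R f) has_sum S) E" "e \<in> E"
  shows "S \<bullet> e = c e"
proof -
  have "((\<lambda>f. (c f *\<^sub>R f) \<bullet> e) has_sum S \<bullet> e) E" by (rule has_sum_inner_left[OF assms(2)])
  moreover have "((\<lambda>f. (c f *\<^sub>R f) \<bullet> e) has_sum c e) E"
  proof (rule has_sum_finite_neutralI[of "{e}"])
  qed (use assms in \<open>auto simp: orthonormal_inner\<close>)
  ultimately show ?thesis by (rule has_sum_unique)
qed

section \<open>Coordinates in an orthonormal basis\<close>

locale onb =
  fixes E :: "'a::{real_inner,complete_space} set"
  assumes onb: "orthonormal_basis E"
begin

lemma orthonormal: "orthonormal E"
  using onb by (simp add: orthonormal_basis_iff)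

text \<open>The vectors orthogonal to \<open>x - y\<close> form a closed subspace. It contains
  \<open>E\<close>, hence the closure of its span, hence \<open>x - y\<close> itself.\<close>

lemma coords_eqI:
  assumes "\<And>e. e \<in> E \<Longrightarrow> x \<bullet> e = y \<bullet> e"
  shows "x = y"
proof -
  have "E \<subseteq> {z. (x - y) \<bullet> z = 0}" using assms by (auto simp: inner_diff_left)
  moreover have "subspace {z. (x - y) \<bullet> z = 0}" by (simp add: subspace_hyperplane)
  ultimately have "span E \<subseteq> {z. (x - y) \<bullet> z = 0}" by (rule span_minimal)
  then have "closure (span E) \<subseteq> {z. (x - y) \<bullet> z = 0}" by (simp add: closure_minimal closed_hyperplane)
  then have "x - y \<in> {z. (x - y) \<bullet> z = 0}" using onb unfolding orthonormal_basis_iff by blast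
  then show ?thesis by simp
qed

text \<open>Bessel makes the series converge to some \<open>S\<close>, which has the same
  coordinates as \<open>x\<close>.\<close>

lemma expansion: "((\<lambda>e. (x \<bullet> e) *\<^sub>R e) has_sum x) E"
proof -
  have "(\<lambda>e. (x \<bullet> e) *\<^sub>R e) summable_on E"
    by (rule summable_on_orthonormal[OF orthonormal bessel(1)[OF orthonormal]])
  then obtain S where S: "((\<lambda>e. (x \<bullet> e) *\<^sub>R e) has_sum S) E" by (auto simp: summable_on_def)
  have "S = x" using inner_orthonormal_series[OF orthonormal S] by (intro coords_eqI) auto
  then show ?thesis using S by simp
qed

lemma parseval: "((\<lambda>e. (x \<bullet> e) * (y \<bullet> e)) has_sum (x \<bullet> y)) E"
proof -
  have "((\<lambda>e. ((x \<bullet> e) *\<^sub>R e) \<bullet> y) has_sum x \<bullet> y) E" by (rule has_sum_inner_left[OF expansion])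
  then show ?thesis by (simp add: inner_commute)
qed

lemma parseval_norm: "((\<lambda>e. (x \<bullet> e)\<^sup>2) has_sum (norm x)\<^sup>2) E"
  using parseval[of x x] unfolding power2_norm_eq_inner by (simp add: power2_eq_square)

lemma norm_le_coords:
  assumes "0 \<le> K" "\<And>e. e \<in> E \<Longrightarrow> \<bar>x \<bullet> e\<bar> \<le> K * \<bar>y \<bullet> e\<bar>"
  shows "norm x \<le> K * norm y"
proof -
  have "(x \<bullet> e)\<^sup>2 \<le> K\<^sup>2 * (y \<bullet> e)\<^sup>2" if "e \<in> E" for e
    using power_mono[OF assms(2)[OF that], of 2] by (simp add: power_mult_distrib)
  then have "(norm x)\<^sup>2 \<le> K\<^sup>2 * (norm y)\<^sup>2"
    using has_sum_mono[OF parseval_norm has_sum_cmult_right[OF parseval_norm]] by blast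
  then show ?thesis using assms(1) by - (rule power2_le_imp_le, auto simp: power_mult_distrib)
qed

section \<open>Operators that are diagonal in the basis\<close>

definition diag :: "('a \<Rightarrow> real) \<Rightarrow> 'a \<Rightarrow> 'a" where
  "diag g x = (\<Sum>\<^sub>\<infinity>e\<in>E. (g e * (x \<bullet> e)) *\<^sub>R e)"

text \<open>Bounded multipliers preserve square summability of the coordinates, so the series that
  defines \<open>diag\<close> converges. Without convergence \<open>infsum\<close> takes its default
  value 0, which is why the facts about \<open>diag\<close> ask for a bounded
  \<open>g\<close>.\<close>

lemma inner_diag:
  assumes "bounded (g ` E)" "e \<in> E"
  shows "diag g x \<bullet> e = g e * (x \<bullet> e)"
proof -
  obtain K where K: "\<And>e. e \<in> E \<Longrightarrow> \<bar>g e\<bar> \<le> K"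
    using assms(1) by (auto simp: bounded_iff)
  have "(\<lambda>e. K\<^sup>2 * (x \<bullet> e)\<^sup>2) summable_on E"
    using bessel(1)[OF orthonormal] by (rule summable_on_cmult_right)
  then have "(\<lambda>e. (g e * (x \<bullet> e))\<^sup>2) summable_on E"
  proof (rule summable_on_comparison_test)
    fix e assume "e \<in> E"
    then have "(g e)\<^sup>2 \<le> K\<^sup>2" using K[of e] by (metis abs_le_square_iff abs_ge_self order_trans)
    then show "(g e * (x \<bullet> e))\<^sup>2 \<le> K\<^sup>2 * (x \<bullet> e)\<^sup>2"
      by (simp add: power_mult_distrib mult_right_mono)
  qed auto
  then have "(\<lambda>e. (g e * (x \<bullet> e)) *\<^sub>R e) summable_on E"
    by (rule summable_on_orthonormal[OF orthonormal])
  then show ?thesis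
    unfolding diag_def by (intro inner_orthonormal_series[OF orthonormal has_sum_infsum assms(2)])
qed

lemma diag_selfadjoint:
  assumes "bounded (g ` E)"
  shows "diag g x \<bullet> y = x \<bullet> diag g y"
proof -
  have "((\<lambda>e. (g e * (x \<bullet> e)) * (y \<bullet> e)) has_sum diag g x \<bullet> y) E"
    using parseval[of "diag g x" y] assms by (simp add: inner_diag cong: has_sum_cong)
  moreover have "((\<lambda>e. (g e * (x \<bullet> e)) * (y \<bullet> e)) has_sum x \<bullet> diag g y) E"
    using parseval[of x "diag g y"] assms by (simp add: inner_diag mult_ac cong: has_sum_cong)
  ultimately show ?thesis by (rule has_sum_unique)
qed

lemma bounded_mult_image:
  assumes "bounded (g ` E)" "bounded (h ` E)"
  shows "bounded ((\<lambda>e. g e * h e :: real) ` E)"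
proof -
  obtain K L where K: "\<And>e. e \<in> E \<Longrightarrow> \<bar>g e\<bar> \<le> K" and L: "\<And>e. e \<in> E \<Longrightarrow> \<bar>h e\<bar> \<le> L"
    using assms by (auto simp: bounded_iff)
  have "\<bar>g e * h e\<bar> \<le> K * L" if "e \<in> E" for e
    using mult_mono[OF K[OF that] L[OF that]] K[OF that] by (simp add: abs_mult)
  then show ?thesis by (auto simp: bounded_iff)
qed

lemma diag_diag:
  assumes "bounded (g ` E)" "bounded (h ` E)"
  shows "diag g (diag h x) = diag (\<lambda>e. g e * h e) x"
  by (rule coords_eqI) (simp add: assms inner_diag bounded_mult_image)

lemma diag_norm_le:
  assumes "0 \<le> K" "\<And>e. e \<in> E \<Longrightarrow> \<bar>g e\<bar> \<le> K"
  shows "norm (diag g x) \<le> K * norm x"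
proof (rule norm_le_coords)
  have b: "bounded (g ` E)" using assms by (auto simp: bounded_iff)
  show "\<bar>diag g x \<bullet> e\<bar> \<le> K * \<bar>x \<bullet> e\<bar>" if "e \<in> E" for e
    using assms(2)[OF that] by (simp add: inner_diag[OF b that] abs_mult mult_right_mono)
qed fact

lemma diag_add:
  assumes "bounded (g ` E)"
  shows "diag g (x + y) = diag g x + diag g y"
  by (rule coords_eqI) (simp add: assms inner_diag inner_add_left algebra_simps)

lemma diag_scaleR:
  assumes "bounded (g ` E)"
  shows "diag g (r *\<^sub>R x) = r *\<^sub>R diag g x"
  by (rule coords_eqI) (simp add: assms inner_diag)

lemma bounded_linear_diag:
  assumes "bounded (g ` E)"
  shows "bounded_linear (diag g)"
proof -
  obtain K where K: "K > 0" "\<And>e. e \<in> E \<Longrightarrow> \<bar>g e\<bar> \<le> K"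
    using assms by (auto simp: bounded_pos)
  show ?thesis
  proof (rule bounded_linear_intro)
    show "norm (diag g x) \<le> norm x * K" for x
      using diag_norm_le[of K g x] K by (simp add: mult.commute)
  qed (simp_all add: assms diag_add diag_scaleR)
qed

text \<open>Riesz representation in coordinates: the vector that represents
  \<open>\<lambda>x. A x \<bullet> y\<close> must have the coordinates
  \<open>A e \<bullet> y\<close>, so only their square summability is at stake.\<close>

lemma adjoint_exists:
  assumes "bounded_linear (A :: 'a \<Rightarrow> 'b::real_inner)"
  obtains A' where "\<And>x y. A x \<bullet> y = x \<bullet> A' y" "bounded_linear A'"
proof -
  obtain K where K: "K > 0" "\<And>x. norm (A x) \<le> norm x * K"
    using bounded_linear.pos_bounded[OF assms] by blast
  note lin = bounded_linear.linear[OF assms]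
  have "\<exists>z. \<forall>x. A x \<bullet> y = x \<bullet> z" for y
  proof -
    have "(\<lambda>e. (A e \<bullet> y)\<^sup>2) summable_on E"
    proof (rule nonneg_bounded_sums_summable)
      fix F assume F: "finite F" "F \<subseteq> E"
      \<comment> \<open>The functional is tested on its own truncated representative:
        \<open>A p \<bullet> y\<close> is the square of \<open>norm p\<close>, so boundedness of
        \<open>A\<close> bounds \<open>norm p\<close> uniformly in \<open>F\<close>.\<close>
      define p where "p = (\<Sum>e\<in>F. (A e \<bullet> y) *\<^sub>R e)"
      have p: "(norm p)\<^sup>2 = (\<Sum>e\<in>F. (A e \<bullet> y)\<^sup>2)"
        unfolding p_def by (rule norm_sum_orthonormal[OF orthonormal F])
      have "A p \<bullet> y = (\<Sum>e\<in>F. (A e \<bullet> y)\<^sup>2)"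
        unfolding p_def linear_sum[OF lin] linear_cmul[OF lin] inner_sum_left
        by (simp add: power2_eq_square)
      then have "norm p * norm p = A p \<bullet> y" using p by (simp add: power2_eq_square)
      also have "\<dots> \<le> norm (A p) * norm y" by (rule norm_cauchy_schwarz)
      also have "\<dots> \<le> norm p * (K * norm y)" using K(2)[of p] by (simp add: mult_right_mono flip: mult.assoc)
      finally have "norm p \<le> K * norm y"
        using K(1) by (cases "norm p = 0") auto
      then show "(\<Sum>e\<in>F. (A e \<bullet> y)\<^sup>2) \<le> (K * norm y)\<^sup>2" unfolding p[symmetric] by (simp add: power_mono)
    qed simp
    then obtain z where z: "((\<lambda>e. (A e \<bullet> y) *\<^sub>R e) has_sum z) E"
      using summable_on_orthonormal[OF orthonormal] unfolding summable_on_def by meson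
    have "A x \<bullet> y = x \<bullet> z" for x
    proof -
      have "((\<lambda>e. A ((x \<bullet> e) *\<^sub>R e) \<bullet> y) has_sum A x \<bullet> y) E"
        by (intro has_sum_inner_left has_sum_bounded_linear[OF assms] expansion)
      then have "((\<lambda>e. (x \<bullet> e) * (z \<bullet> e)) has_sum A x \<bullet> y) E"
        by (rule has_sum_cong[THEN iffD1, rotated])
           (simp add: linear_cmul[OF lin] inner_orthonormal_series[OF orthonormal z])
      then show ?thesis by (rule has_sum_unique) (rule parseval)
    qed
    then show ?thesis by blast
  qed
  then obtain A' where A': "\<And>x y. A x \<bullet> y = x \<bullet> A' y" by metis
  have eqI: "z = z'" if "\<And>x. x \<bullet> z = x \<bullet> z'" for z z' :: 'a
    by (rule coords_eqI) (metis that inner_commute)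
  have "bounded_linear A'"
  proof (rule bounded_linear_intro)
    show "A' (y + z) = A' y + A' z" for y z
      by (rule eqI) (simp add: inner_add_right flip: A')
    show "A' (r *\<^sub>R y) = r *\<^sub>R A' y" for r y
      by (rule eqI) (simp flip: A')
    show "norm (A' y) \<le> norm y * K" for y
    proof -
      have "norm (A' y) * norm (A' y) = A (A' y) \<bullet> y"
        by (simp add: A' flip: power2_norm_eq_inner power2_eq_square)
      also have "\<dots> \<le> norm (A (A' y)) * norm y" by (rule norm_cauchy_schwarz)
      also have "\<dots> \<le> norm (A' y) * (norm y * K)"
        using mult_right_mono[OF K(2)[of "A' y"], of "norm y"] by (simp add: mult_ac)
      finally show ?thesis using K(1) by (cases "norm (A' y) = 0") auto
    qed
  qed
  then show ?thesis using that A' by blast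
qed

end


section \<open>The spectral theorem for positive trace class operators\<close>

lemma psa_bounded_linear: "positive_selfadjoint T \<Longrightarrow> bounded_linear T"
  and psa_symmetric: "positive_selfadjoint T \<Longrightarrow> T x \<bullet> y = x \<bullet> T y"
  and psa_nonneg: "positive_selfadjoint T \<Longrightarrow> 0 \<le> T x \<bullet> x"
  by (auto simp: positive_selfadjoint_def)

text \<open>Along the line through \<open>x\<close> in direction \<open>y\<close> the form is a
  nonnegative quadratic polynomial in \<open>t\<close>, so its discriminant is not positive.\<close>

lemma psa_cauchy_schwarz:
  assumes T: "positive_selfadjoint T"
  shows "(T x \<bullet> y)\<^sup>2 \<le> (T x \<bullet> x) * (T y \<bullet> y)"
proof -
  interpret T: bounded_linear T by (rule psa_bounded_linear[OF T])
  define a b c where "a = T x \<bullet> x" and "b = T x \<bullet> y" and "c = T y \<bullet> y"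
  have q: "0 \<le> a + 2 * t * b + t\<^sup>2 * c" for t
  proof -
    have "T y \<bullet> x = b" using psa_symmetric[OF T, of y x] by (simp add: b_def inner_commute)
    then have "T (x + t *\<^sub>R y) \<bullet> (x + t *\<^sub>R y) = a + 2 * t * b + t\<^sup>2 * c"
      by (simp add: T.add T.scaleR inner_add_left inner_add_right a_def b_def c_def
          power2_eq_square algebra_simps)
    then show ?thesis using psa_nonneg[OF T, of "x + t *\<^sub>R y"] by simp
  qed
  have "0 \<le> c" using psa_nonneg[OF T] by (simp add: c_def)
  have "b\<^sup>2 \<le> a * c"
  proof (cases "c = 0")
    case True
    \<comment> \<open>With a vanishing leading coefficient the polynomial is affine; for nonzero
      \<open>b\<close> it would take the value -1 at the \<open>t\<close> chosen below.\<close>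
    have "b = 0"
    proof (rule ccontr)
      assume "b \<noteq> 0"
      then have "2 * (- (a + 1) / (2 * b)) * b = - (a + 1)" by simp
      moreover have "(- (a + 1) / (2 * b))\<^sup>2 * c = 0" using True by simp
      ultimately show False using q[of "- (a + 1) / (2 * b)"] by linarith
    qed
    then show ?thesis using True by simp
  next
    case False
    then have "c > 0" using \<open>0 \<le> c\<close> by simp
    \<comment> \<open>The minimiser of the polynomial.\<close>
    define t where "t = - b / c"
    have t: "t * c = - b" using False by (simp add: t_def)
    have "a + 2 * t * b + t\<^sup>2 * c = a + t * b"
      by (simp add: power2_eq_square mult.assoc t)
    then have "0 \<le> a + t * b" using q[of t] by linarith
    then have "0 \<le> (a + t * b) * c" using \<open>c > 0\<close> by (rule mult_nonneg_nonneg[OF _ less_imp_le])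
    also have "\<dots> = a * c - b\<^sup>2"
      using arg_cong[OF t, of "\<lambda>z. z * b"] by (simp add: algebra_simps power2_eq_square)
    finally show ?thesis by simp
  qed
  then show ?thesis by (simp add: a_def b_def c_def)
qed

text \<open>Cauchy-Schwarz with \<open>y = T x\<close>, divided by the square of
  \<open>norm (T x)\<close>. The form is bounded only at \<open>T x\<close>, so \<open>K\<close> may
  be a bound on an invariant subspace instead of an operator norm.\<close>

lemma psa_norm_sq_le:
  assumes T: "positive_selfadjoint T" and K: "T (T x) \<bullet> T x \<le> K * (norm (T x))\<^sup>2"
  shows "(norm (T x))\<^sup>2 \<le> K * (T x \<bullet> x)"
proof (cases "T x = 0")
  case False
  have "(norm (T x))\<^sup>2 * (norm (T x))\<^sup>2 \<le> (T x \<bullet> x) * (T (T x) \<bullet> T x)"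
    using psa_cauchy_schwarz[OF T, of x "T x"]
    by (metis power2_eq_square power2_norm_eq_inner)
  also have "\<dots> \<le> (T x \<bullet> x) * (K * (norm (T x))\<^sup>2)"
    by (rule mult_left_mono[OF K psa_nonneg[OF T]])
  finally have "(norm (T x))\<^sup>2 * (norm (T x))\<^sup>2 \<le> (K * (T x \<bullet> x)) * (norm (T x))\<^sup>2"
    by (simp add: mult_ac)
  then show ?thesis using False by (metis mult_le_cancel_right_pos zero_less_norm_iff zero_less_power)
qed (use psa_nonneg[OF T, of x] in simp)

section \<open>Trace class operators are compact\<close>

lemma compact_closure_totally_bounded:
  fixes S :: "'a::{metric_space,complete_space} set"
  assumes "\<And>\<epsilon>. 0 < \<epsilon> \<Longrightarrow> \<exists>C. compact C \<and> (\<forall>x\<in>S. \<exists>y\<in>C. dist x y < \<epsilon>)"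
  shows "compact (closure S)"
  unfolding compact_eq_totally_bounded
proof (intro conjI allI impI)
  show "uniform_space_class.complete (closure S)" by (simp add: complete_eq_closed)
  fix \<epsilon> :: real assume "0 < \<epsilon>"
  then obtain C where C: "compact C" "\<forall>x\<in>S. \<exists>y\<in>C. dist x y < \<epsilon> / 4" using assms[of "\<epsilon>/4"] by auto
  obtain k where k: "finite k" "C \<subseteq> (\<Union>x\<in>k. ball x (\<epsilon>/4))"
    using C(1) \<open>0 < \<epsilon>\<close> unfolding compact_eq_totally_bounded by (meson divide_pos_pos zero_less_numeral)
  \<comment> \<open>Two distances below \<open>\<epsilon>/4\<close> give closed balls of radius
    \<open>\<epsilon>/2\<close>, whose finite union survives the closure; open balls of radius
    \<open>\<epsilon>\<close> then contain them.\<close>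
  have "S \<subseteq> (\<Union>x\<in>k. cball x (\<epsilon>/2))"
  proof
    fix x assume "x \<in> S"
    then obtain y where y: "y \<in> C" "dist x y < \<epsilon>/4" using C(2) by blast
    then obtain z where "z \<in> k" "dist z y < \<epsilon>/4" using k(2) by auto
    moreover have "dist z x \<le> dist z y + dist x y" by (metis dist_commute dist_triangle)
    ultimately show "x \<in> (\<Union>x\<in>k. cball x (\<epsilon>/2))" using y by (intro UN_I[of z]) auto
  qed
  moreover have "closed (\<Union>x\<in>k. cball x (\<epsilon>/2))" using k(1) by auto
  ultimately have "closure S \<subseteq> (\<Union>x\<in>k. cball x (\<epsilon>/2))" by (rule closure_minimal)
  also have "\<dots> \<subseteq> (\<Union>x\<in>k. ball x \<epsilon>)" using \<open>0 < \<epsilon>\<close> by (intro UN_mono) auto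
  finally show "\<exists>k. finite k \<and> closure S \<subseteq> (\<Union>x\<in>k. ball x \<epsilon>)" using k(1) by blast
qed

text \<open>By induction the set is the Minkowski sum of a segment and a compact set of the same
  kind.\<close>

lemma compact_bounded_combinations:
  fixes f :: "'i \<Rightarrow> 'a::real_normed_vector"
  assumes "finite F"
  shows "compact {\<Sum>e\<in>F. c e *\<^sub>R f e |c. \<forall>e\<in>F. \<bar>c e :: real\<bar> \<le> 1}"
  using assms
proof (induction F)
  case (insert i F)
  let ?S = "\<lambda>F. {\<Sum>e\<in>F. c e *\<^sub>R f e |c. \<forall>e\<in>F. \<bar>c e :: real\<bar> \<le> 1}"
  let ?I = "(\<lambda>t. t *\<^sub>R f i) ` {-1..1}"
  have "?S (insert i F) = {x + y |x y. x \<in> ?I \<and> y \<in> ?S F}" (is "?L = ?R")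
  proof
    show "?L \<subseteq> ?R"
    proof
      fix z assume "z \<in> ?L"
      then obtain c where c: "z = (\<Sum>e\<in>insert i F. c e *\<^sub>R f e)" "\<forall>e\<in>insert i F. \<bar>c e\<bar> \<le> 1" by blast
      then have "z = c i *\<^sub>R f i + (\<Sum>e\<in>F. c e *\<^sub>R f e)" using insert by simp
      moreover have "c i *\<^sub>R f i \<in> ?I" using c(2) by (intro imageI) auto
      moreover have "(\<Sum>e\<in>F. c e *\<^sub>R f e) \<in> ?S F" using c(2) by blast
      ultimately show "z \<in> ?R" by blast
    qed
    show "?R \<subseteq> ?L"
    proof
      fix z assume "z \<in> ?R"
      then obtain t c where tc: "t \<in> {-1..1}" "\<forall>e\<in>F. \<bar>c e\<bar> \<le> 1" "z = t *\<^sub>R f i + (\<Sum>e\<in>F. c e *\<^sub>R f e)" by blast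
      define d where "d = c(i := t)"
      have "z = (\<Sum>e\<in>insert i F. d e *\<^sub>R f e)"
        using insert(1,2) tc(3) by (simp add: d_def) (intro sum.cong, auto)
      moreover have "\<forall>e\<in>insert i F. \<bar>d e\<bar> \<le> 1" using tc insert(2) by (auto simp: d_def)
      ultimately show "z \<in> ?L" by blast
    qed
  qed
  moreover have "compact ?I" by (intro compact_continuous_image continuous_intros) simp
  ultimately show ?case using compact_sums[OF _ insert.IH] by simp
qed simp

text \<open>Summability of \<open>T e \<bullet> e\<close> makes \<open>T\<close> a Hilbert-Schmidt
  operator. Truncating \<open>x\<close> to finitely many coordinates therefore changes
  \<open>T x\<close> little, uniformly on the unit ball, and the images of the truncations lie in a
  compact set.\<close>

lemma (in onb) trace_class_compact:
  assumes T: "positive_selfadjoint T" and sm: "(\<lambda>e. T e \<bullet> e) summable_on E"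
  shows "compact (closure (T ` cball 0 1))"
proof (rule compact_closure_totally_bounded)
  fix \<epsilon> :: real assume \<epsilon>: "0 < \<epsilon>"
  interpret T: bounded_linear T by (rule psa_bounded_linear[OF T])
  obtain K where K: "0 < K" "\<And>x. norm (T x) \<le> norm x * K" using T.pos_bounded by blast
  define g where "g e = (norm (T e))\<^sup>2" for e
  have "g summable_on E"
  proof (rule summable_on_comparison_test[OF summable_on_cmult_right[OF sm, of K]])
    fix e assume "e \<in> E"
    have "T (T e) \<bullet> T e \<le> norm (T (T e)) * norm (T e)" by (rule norm_cauchy_schwarz)
    also have "\<dots> \<le> K * (norm (T e))\<^sup>2"
      using mult_right_mono[OF K(2)[of "T e"], of "norm (T e)"] by (simp add: power2_eq_square mult_ac)
    finally show "g e \<le> K * (T e \<bullet> e)" unfolding g_def by (rule psa_norm_sq_le[OF T])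
  qed (simp add: g_def)
  then obtain L where L: "(g has_sum L) E" by (auto simp: summable_on_def)
  then have "eventually (\<lambda>F. dist (sum g F) L < (\<epsilon>/2)\<^sup>2) (finite_subsets_at_top E)"
    using \<epsilon> unfolding has_sum_def tendsto_iff by simp
  then obtain F where F: "finite F" "F \<subseteq> E" "dist (sum g F) L < (\<epsilon>/2)\<^sup>2"
    unfolding eventually_finite_subsets_at_top by blast
  have tail: "sum g G \<le> (\<epsilon>/2)\<^sup>2" if G: "finite G" "G \<subseteq> E - F" for G
  proof -
    have "finite (F \<union> G)" using F G by simp
    then have "sum g (F \<union> G) \<le> L"
      using has_sum_mono_neutral[OF has_sum_finite[of "F \<union> G" g] L] F G by (auto simp: g_def)
    moreover have "sum g (F \<union> G) = sum g F + sum g G" using F G by (intro sum.union_disjoint) auto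
    ultimately show ?thesis using F(3) by (simp add: dist_real_def)
  qed
  let ?C = "{\<Sum>e\<in>F. c e *\<^sub>R T e |c. \<forall>e\<in>F. \<bar>c e\<bar> \<le> 1}"
  have "\<exists>z\<in>?C. dist y z < \<epsilon>" if y: "y \<in> T ` cball 0 1" for y
  proof -
    obtain x where x: "y = T x" "norm x \<le> 1" using y by auto
    define P where "P x = (\<Sum>e\<in>F. (x \<bullet> e) *\<^sub>R e)" for x
    define w where "w = T (x - P x)"
    \<comment> \<open>By symmetry the coordinates of \<open>T w\<close> are at most
      \<open>norm w * norm (T e)\<close>, so outside \<open>F\<close> the Hilbert-Schmidt tail
      controls them.\<close>
    have "(norm (T w - P (T w)))\<^sup>2 \<le> (norm w * (\<epsilon>/2))\<^sup>2"
    proof -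
      have "infsum (\<lambda>e. (T w \<bullet> e)\<^sup>2) E \<le> (\<Sum>e\<in>F. (T w \<bullet> e)\<^sup>2) + (norm w * (\<epsilon>/2))\<^sup>2"
      proof (rule nonneg_bounded_sums_summable)
        fix G assume G: "finite G" "G \<subseteq> E"
        have "(\<Sum>e\<in>G-F. (T w \<bullet> e)\<^sup>2) \<le> (\<Sum>e\<in>G-F. (norm w)\<^sup>2 * g e)"
        proof (rule sum_mono)
          fix e
          have "\<bar>T w \<bullet> e\<bar> \<le> norm w * norm (T e)"
            unfolding psa_symmetric[OF T] by (rule Cauchy_Schwarz_ineq2)
          then have "\<bar>T w \<bullet> e\<bar>\<^sup>2 \<le> (norm w * norm (T e))\<^sup>2" by (rule power_mono) simp
          then show "(T w \<bullet> e)\<^sup>2 \<le> (norm w)\<^sup>2 * g e" by (simp add: g_def power_mult_distrib)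
        qed
        also have "\<dots> \<le> (norm w)\<^sup>2 * (\<epsilon>/2)\<^sup>2"
          unfolding sum_distrib_left[symmetric] using tail[of "G-F"] G by (intro mult_left_mono) auto
        finally have "(\<Sum>e\<in>G-F. (T w \<bullet> e)\<^sup>2) \<le> (norm w * (\<epsilon>/2))\<^sup>2" by (simp only: power_mult_distrib)
        moreover have "(\<Sum>e\<in>G. (T w \<bullet> e)\<^sup>2) \<le> (\<Sum>e\<in>F \<union> (G-F). (T w \<bullet> e)\<^sup>2)"
          using F G by (intro sum_mono2) auto
        moreover have "(\<Sum>e\<in>F \<union> (G-F). (T w \<bullet> e)\<^sup>2) = (\<Sum>e\<in>F. (T w \<bullet> e)\<^sup>2) + (\<Sum>e\<in>G-F. (T w \<bullet> e)\<^sup>2)"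
          using F G by (intro sum.union_disjoint) auto
        ultimately show "(\<Sum>e\<in>G. (T w \<bullet> e)\<^sup>2) \<le> (\<Sum>e\<in>F. (T w \<bullet> e)\<^sup>2) + (norm w * (\<epsilon>/2))\<^sup>2" by linarith
      qed simp
      then show ?thesis
        using bessel_sum[OF orthonormal F(1,2), of "T w"] infsumI[OF parseval_norm, of "T w"] by (simp add: P_def)
    qed
    then have tw: "norm (T w - P (T w)) \<le> norm w * (\<epsilon>/2)"
      by (rule power2_le_imp_le) (use \<epsilon> in auto)
    \<comment> \<open>\<open>x - P x\<close> has no coordinates in \<open>F\<close>. So in
      \<open>norm w * norm w = (x - P x) \<bullet> T w\<close> only the small tail of
      \<open>T w\<close> counts.\<close>
    have "(x - P x) \<bullet> P (T w) = 0"
    proof -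
      have "(x - P x) \<bullet> e = 0" if "e \<in> F" for e
        using that F inner_sum_orthonormal[OF orthonormal F(1,2), of e "\<lambda>e. x \<bullet> e"]
        by (auto simp: P_def inner_diff_left)
      then show ?thesis by (simp add: P_def[of "T w"] inner_sum_right)
    qed
    then have "norm w * norm w = (x - P x) \<bullet> (T w - P (T w))"
      using psa_symmetric[OF T, of "x - P x" w]
      unfolding w_def[symmetric] power2_eq_square[symmetric] power2_norm_eq_inner
      by (simp add: inner_diff_right)
    also have "\<dots> \<le> norm (x - P x) * norm (T w - P (T w))" by (rule norm_cauchy_schwarz)
    also have "\<dots> \<le> 1 * (norm w * (\<epsilon>/2))"
    proof (rule mult_mono[OF _ tw])
      have "(norm (x - P x))\<^sup>2 \<le> (norm x)\<^sup>2"
        using bessel_sum[OF orthonormal F(1,2), of x] by (simp add: P_def sum_nonneg)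
      then have "norm (x - P x) \<le> norm x" by (rule power2_le_imp_le) simp
      then show "norm (x - P x) \<le> 1" using x(2) by simp
    qed auto
    finally have "norm w \<le> \<epsilon>/2" using \<epsilon> by (cases "norm w = 0") auto
    moreover have "y - T (P x) = w" by (simp add: w_def x T.diff)
    ultimately have "dist y (T (P x)) < \<epsilon>" using \<epsilon> by (simp add: dist_norm)
    moreover have "T (P x) \<in> ?C"
    proof -
      have "\<bar>x \<bullet> e\<bar> \<le> 1" if "e \<in> F" for e
        using Cauchy_Schwarz_ineq2[of x e] x(2) orthonormal_inner[OF orthonormal, of e e] that F(2)
        by (auto simp flip: norm_eq_1)
      then show ?thesis by (auto simp: P_def T.sum T.scaleR)
    qed
    ultimately show ?thesis by blast
  qed
  then show "\<exists>C. compact C \<and> (\<forall>y\<in>T ` cball 0 1. \<exists>z\<in>C. dist y z < \<epsilon>)"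
    using compact_bounded_combinations[OF F(1), of T] by blast
qed

text \<open>Variational principle: \<open>M\<close> is the supremum of the form on the unit sphere
  of \<open>W\<close>. A maximising sequence consists of approximate eigenvectors, and compactness
  provides a limit. If \<open>M = 0\<close>, the operator vanishes on \<open>W\<close>.\<close>

lemma eigenvector_exists:
  fixes T :: "'a::real_inner \<Rightarrow> 'a"
  assumes T: "positive_selfadjoint T" and cpt: "compact (closure (T ` cball 0 1))"
    and W: "subspace W" "closed W" "W \<noteq> {0}" "\<And>x. x \<in> W \<Longrightarrow> T x \<in> W"
  shows "\<exists>e\<in>W. norm e = 1 \<and> (\<exists>l. T e = l *\<^sub>R e)"
proof -
  interpret T: bounded_linear T by (rule psa_bounded_linear[OF T])
  obtain K where K: "0 < K" "\<And>x. norm (T x) \<le> norm x * K" using T.pos_bounded by blast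
  define S where "S = {x \<in> W. norm x = 1}"
  define M where "M = (SUP x\<in>S. T x \<bullet> x)"
  obtain x0 where x0: "x0 \<in> W" "x0 \<noteq> 0" using W(1,3) subspace_0 by blast
  have normalise: "(1 / norm x) *\<^sub>R x \<in> S" if "x \<in> W" "x \<noteq> 0" for x
    using that W(1) by (simp add: S_def subspace_scale)
  have Sne: "S \<noteq> {}" using normalise[OF x0] by blast
  have bdd: "bdd_above ((\<lambda>x. T x \<bullet> x) ` S)"
  proof (rule bdd_aboveI2)
    show "T x \<bullet> x \<le> K" if "x \<in> S" for x
      using norm_cauchy_schwarz[of "T x" x] K(2)[of x] that by (simp add: S_def)
  qed
  have form: "T x \<bullet> x \<le> M * (norm x)\<^sup>2" if "x \<in> W" for x
  proof (cases "x = 0")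
    case False
    have "T ((1 / norm x) *\<^sub>R x) \<bullet> ((1 / norm x) *\<^sub>R x) \<le> M"
      unfolding M_def by (rule cSUP_upper[OF normalise[OF that False] bdd])
    then show ?thesis using False by (simp add: T.scaleR field_simps power2_eq_square)
  qed (simp add: T.zero)
  have M0: "0 \<le> M"
  proof -
    obtain x where "x \<in> S" using Sne by blast
    then show ?thesis using form[of x] psa_nonneg[OF T, of x] by (simp add: S_def)
  qed
  have TM: "(norm (T x))\<^sup>2 \<le> M * (T x \<bullet> x)" if "x \<in> W" for x
    using psa_norm_sq_le[OF T form] W(4) that by blast
  show ?thesis
  proof (cases "M = 0")
    case True
    obtain x where "x \<in> S" using Sne by blast
    then show ?thesis using TM[of x] True by (intro bexI[of _ x]) (auto simp: S_def intro!: exI[of _ 0])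
  next
    case False
    then have Mpos: "0 < M" using M0 by simp
    have "\<exists>x\<in>S. M - 1 / real (Suc n) < T x \<bullet> x" for n
      unfolding M_def using less_cSUP_iff[OF Sne bdd, of "M - 1 / real (Suc n)"] by (simp add: M_def)
    then obtain x where x: "\<And>n. x n \<in> S" "\<And>n. M - 1 / real (Suc n) < T (x n) \<bullet> x n" by metis
    have xn: "x n \<in> W" "norm (x n) = 1" for n using x(1)[of n] by (auto simp: S_def)
    \<comment> \<open>Since \<open>norm (T (x n)) \<le> M\<close>, the squared norm of the defect is
      at most \<open>2 * M * (M - T (x n) \<bullet> x n)\<close>, which tends to 0 along the
      maximising sequence.\<close>
    have "(\<lambda>n. T (x n) - M *\<^sub>R x n) \<longlonglongrightarrow> 0"
    proof -
      have bound: "norm (T (x n) - M *\<^sub>R x n) \<le> sqrt (2 * M / real (Suc n))" for n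
      proof (rule real_le_rsqrt)
        have "T (x n) \<bullet> x n \<le> M" using form[OF xn(1)[of n]] xn(2)[of n] by simp
        then have "(norm (T (x n)))\<^sup>2 \<le> M * M"
          using TM[OF xn(1)[of n]] mult_left_mono[of "T (x n) \<bullet> x n" M M] M0 by linarith
        moreover have "(norm (T (x n) - M *\<^sub>R x n))\<^sup>2 = (norm (T (x n)))\<^sup>2 - 2 * M * (T (x n) \<bullet> x n) + M * M"
          using xn(2)[of n]
          unfolding power2_norm_eq_inner norm_eq_1
          by (simp add: inner_diff_left inner_diff_right inner_commute algebra_simps)
        moreover have "M * (M - 1 / real (Suc n)) \<le> M * (T (x n) \<bullet> x n)"
          using x(2)[of n] M0 by (intro mult_left_mono) auto
        ultimately show "(norm (T (x n) - M *\<^sub>R x n))\<^sup>2 \<le> 2 * M / real (Suc n)"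
          unfolding right_diff_distrib times_divide_eq_right[symmetric] by (simp add: mult.assoc)
      qed
      have "(\<lambda>n. 2 * M * inverse (real (Suc n))) \<longlonglongrightarrow> 2 * M * 0"
        by (intro tendsto_mult tendsto_const LIMSEQ_inverse_real_of_nat)
      then have "(\<lambda>n. sqrt (2 * M / real (Suc n))) \<longlonglongrightarrow> sqrt 0"
        by (intro tendsto_real_sqrt) (simp add: divide_inverse)
      then have "(\<lambda>n. sqrt (2 * M / real (Suc n))) \<longlonglongrightarrow> 0" by simp
      then show ?thesis by (rule Lim_null_comparison[OF always_eventually[OF allI[OF bound]]])
    qed
    moreover have "\<forall>n. T (x n) \<in> closure (T ` cball 0 1)"
      using xn(2) by (intro allI subsetD[OF closure_subset] imageI) simp
    then obtain y r where r: "strict_mono r" "((\<lambda>n. T (x n)) \<circ> r) \<longlonglongrightarrow> y"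
      using cpt unfolding compact_def by meson
    \<comment> \<open>Up to the vanishing defect, \<open>x\<close> is \<open>T x\<close> divided by
      \<open>M\<close>, so convergence of the images along \<open>r\<close> carries over to the
      vectors.\<close>
    ultimately have "(\<lambda>n. (1 / M) *\<^sub>R (T (x (r n)) - (T (x (r n)) - M *\<^sub>R x (r n)))) \<longlonglongrightarrow> (1 / M) *\<^sub>R (y - 0)"
      using LIMSEQ_subseq_LIMSEQ[of "\<lambda>n. T (x n) - M *\<^sub>R x n" 0 r]
      by (intro tendsto_intros) (auto simp: o_def)
    moreover define e where "e = (1 / M) *\<^sub>R y"
    ultimately have lim: "(\<lambda>n. x (r n)) \<longlonglongrightarrow> e" using Mpos by simp
    have "(\<lambda>n. T (x (r n))) \<longlonglongrightarrow> T e" by (rule T.tendsto[OF lim])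
    then have "T e = y" using r(2) LIMSEQ_unique by (fastforce simp: o_def)
    then have "T e = M *\<^sub>R e" using Mpos by (simp add: e_def)
    moreover have "e \<in> W" using W(2) lim xn(1) by (metis closed_sequentially)
    moreover have "norm e = 1" using tendsto_norm[OF lim] xn(2) LIMSEQ_unique tendsto_const by (simp add: LIMSEQ_const_iff)
    ultimately show ?thesis by blast
  qed
qed

text \<open>Zorn's lemma gives a maximal orthonormal set of eigenvectors. Its orthogonal complement
  is closed and, by symmetry, invariant, so an eigenvector in it would contradict
  maximality.\<close>

theorem eigenbasis_exists:
  fixes T :: "'a::{real_inner,complete_space} \<Rightarrow> 'a"
  assumes T: "positive_selfadjoint T" and cpt: "compact (closure (T ` cball 0 1))"
  shows "\<exists>E. orthonormal_basis E \<and> (\<forall>e\<in>E. \<exists>l. T e = l *\<^sub>R e)"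
proof -
  interpret T: bounded_linear T by (rule psa_bounded_linear[OF T])
  let ?A = "{E. orthonormal E \<and> (\<forall>e\<in>E. \<exists>l. T e = l *\<^sub>R e)}"
  have "\<Union>C \<in> ?A" if C: "subset.chain ?A C" for C
  proof -
    have "orthonormal (\<Union>C)"
      unfolding orthonormal_def
    proof (intro ballI)
      fix e f assume "e \<in> \<Union>C" "f \<in> \<Union>C"
      then obtain X where "X \<in> C" "e \<in> X" "f \<in> X"
        using C unfolding subset.chain_def by blast
      moreover have "orthonormal X" using C \<open>X \<in> C\<close> unfolding subset.chain_def by auto
      ultimately show "e \<bullet> f = (if e = f then 1 else 0)" by (simp add: orthonormal_inner)
    qed
    then show ?thesis using C unfolding subset.chain_def by blast
  qed
  from subset_Zorn'[of ?A, OF this] obtain E where "E \<in> ?A" "\<forall>X\<in>?A. E \<subseteq> X \<longrightarrow> X = E" by blast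
  then have E: "orthonormal E" "\<forall>e\<in>E. \<exists>l. T e = l *\<^sub>R e"
    and max: "\<And>X. X \<in> ?A \<Longrightarrow> E \<subseteq> X \<Longrightarrow> X = E" by auto
  define W where "W = {x. \<forall>e\<in>E. x \<bullet> e = 0}"
  have "W = {0}"
  proof (rule ccontr)
    assume "W \<noteq> {0}"
    moreover have "subspace W" by (auto simp: W_def subspace_def inner_add_left)
    moreover have "closed W"
    proof -
      have "W = (\<Inter>e\<in>E. {x. e \<bullet> x = 0})" by (auto simp: W_def inner_commute)
      then show ?thesis by (simp add: closed_INT closed_hyperplane)
    qed
    moreover have "T x \<in> W" if "x \<in> W" for x
      unfolding W_def
    proof (intro CollectI ballI)
      fix e assume "e \<in> E"
      then obtain l where "T e = l *\<^sub>R e" using E(2) by blast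
      then show "T x \<bullet> e = 0" using \<open>e \<in> E\<close> that by (simp add: psa_symmetric[OF T] W_def)
    qed
    ultimately obtain e where e: "e \<in> W" "norm e = 1" "\<exists>l. T e = l *\<^sub>R e"
      using eigenvector_exists[OF T cpt, of W] by blast
    have "orthonormal (insert e E)"
      using E(1) e(1,2) unfolding orthonormal_def W_def
      by (auto simp: inner_commute norm_eq_1)
    then have "insert e E = E" using max[of "insert e E"] E(2) e(3) by blast
    then have "e \<in> E" by blast
    then have "e \<bullet> e = 0" using e(1) by (auto simp: W_def)
    then show False using e(2) by simp
  qed
  \<comment> \<open>The Fourier series of \<open>x\<close> converges by Bessel; the remainder is
    orthogonal to \<open>E\<close> and so lies in \<open>W = {0}\<close>.\<close>
  have "x \<in> closure (span E)" for x
  proof -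
    obtain S where S: "((\<lambda>e. (x \<bullet> e) *\<^sub>R e) has_sum S) E"
      using summable_on_orthonormal[OF E(1) bessel(1)[OF E(1)]] unfolding summable_on_def by blast
    have "x - S \<in> W"
      using inner_orthonormal_series[OF E(1) S] by (simp add: W_def inner_diff_left)
    then have "x = S" using \<open>W = {0}\<close> by simp
    moreover have "S \<in> closure (span E)"
    proof (rule Lim_in_closed_set)
      show "(sum (\<lambda>e. (x \<bullet> e) *\<^sub>R e) \<longlongrightarrow> S) (finite_subsets_at_top E)" using S by (simp add: has_sum_def)
      show "\<forall>\<^sub>F F in finite_subsets_at_top E. (\<Sum>e\<in>F. (x \<bullet> e) *\<^sub>R e) \<in> closure (span E)"
        by (intro eventually_finite_subsets_at_top_weakI subsetD[OF closure_subset] span_sum span_scale)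
           (auto intro: span_base)
    qed auto
    ultimately show ?thesis by simp
  qed
  then show ?thesis using E by (auto simp: orthonormal_basis_iff)
qed


section \<open>Functional calculus of a positive operator with an eigenbasis\<close>

text \<open>Splitting at \<open>t = r\<close> gives two power integrals; \<open>0 < \<theta>\<close>
  makes the first converge and \<open>\<theta> < 1\<close> the second. The weight turns
  \<open>min r t\<close> into a power of \<open>r\<close>, which is the mechanism of real
  interpolation.\<close>

lemma has_integral_powr_min:
  fixes \<theta> r :: real
  assumes "0 < \<theta>" "\<theta> < 1" "0 < r"
  shows "((\<lambda>t. t powr (\<theta> - 2) * min r t) has_integral (r powr \<theta> / (\<theta> * (1 - \<theta>)))) {0..}"
proof -
  have "((\<lambda>t. t powr (\<theta> - 1)) has_integral (r powr \<theta> / \<theta>)) {0..r}"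
    using has_integral_powr_from_0[of "\<theta> - 1" r] assms by simp
  then have 1: "((\<lambda>t. t powr (\<theta> - 2) * min r t) has_integral (r powr \<theta> / \<theta>)) {0..r}"
  proof (rule has_integral_eq[rotated])
    fix t assume t: "t \<in> {0..r}"
    have "t powr (\<theta> - 2) * t = t powr (\<theta> - 1)"
      using t powr_add[of t "\<theta> - 2" 1] by (cases "t = 0") auto
    then show "t powr (\<theta> - 1) = t powr (\<theta> - 2) * min r t" using t by simp
  qed
  have "((\<lambda>t. t powr (\<theta> - 2) * r) has_integral (- (r powr (\<theta> - 2 + 1)) / (\<theta> - 2 + 1) * r)) {r..}"
    using has_integral_powr_to_inf[of "\<theta> - 2" r] assms by (intro has_integral_mult_left) auto
  moreover have "- (r powr (\<theta> - 2 + 1)) / (\<theta> - 2 + 1) * r = r powr \<theta> / (1 - \<theta>)"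
  proof -
    have "r powr (\<theta> - 2 + 1) * r = r powr \<theta>" using assms powr_add[of r "\<theta> - 1" 1] by simp
    moreover have "- x / (\<theta> - 2 + 1) * r = x * r / (1 - \<theta>)" for x
      using assms by (simp add: field_simps)
    ultimately show ?thesis by (simp only:)
  qed
  ultimately have "((\<lambda>t. t powr (\<theta> - 2) * r) has_integral (r powr \<theta> / (1 - \<theta>))) {r..}" by simp
  then have 2: "((\<lambda>t. t powr (\<theta> - 2) * min r t) has_integral (r powr \<theta> / (1 - \<theta>))) {r..}"
    by (rule has_integral_eq[rotated]) (simp add: min_def)
  have "negligible ({0..r} \<inter> {r..})" using assms by (simp add: Int_atLeastAtMostL1)
  moreover have "{0..r} \<union> {r..} = {0..}" using assms by auto
  ultimately
  have "((\<lambda>t. t powr (\<theta> - 2) * min r t) has_integral (r powr \<theta> / \<theta> + r powr \<theta> / (1 - \<theta>))) {0..}"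
    using has_integral_Un[OF 1 2] by simp
  moreover have "r powr \<theta> / \<theta> + r powr \<theta> / (1 - \<theta>) = r powr \<theta> / (\<theta> * (1 - \<theta>))"
    using assms by (simp add: field_simps)
  ultimately show ?thesis by simp
qed

section \<open>Eigenvalues and real powers in an eigenbasis\<close>

locale spectral = onb E for E :: "'a::{real_inner,complete_space} set" +
  fixes T :: "'a \<Rightarrow> 'a"
  assumes psa: "positive_selfadjoint T"
    and eigen: "\<And>e. e \<in> E \<Longrightarrow> \<exists>l. T e = l *\<^sub>R e"
begin

definition ev :: "'a \<Rightarrow> real" where "ev e = T e \<bullet> e"

sublocale T: bounded_linear T by (rule psa_bounded_linear[OF psa])

lemma ev_nonneg: "0 \<le> ev e"
  using psa_nonneg[OF psa] by (simp add: ev_def)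

lemma T_eigen: "e \<in> E \<Longrightarrow> T e = ev e *\<^sub>R e"
  using eigen[of e] orthonormal_inner[OF orthonormal, of e e] by (auto simp: ev_def)

lemma inner_T: "e \<in> E \<Longrightarrow> T x \<bullet> e = ev e * (x \<bullet> e)"
  by (simp add: psa_symmetric[OF psa] T_eigen)

lemma eigenvalue_bound:
  obtains K where "0 < K" "\<And>z l. z \<noteq> 0 \<Longrightarrow> T z = l *\<^sub>R z \<Longrightarrow> \<bar>l\<bar> \<le> K"
proof -
  obtain K where K: "0 < K" "\<And>x. norm (T x) \<le> norm x * K" using T.pos_bounded by blast
  have "\<bar>l\<bar> \<le> K" if "z \<noteq> 0" "T z = l *\<^sub>R z" for z l
  proof -
    have "\<bar>l\<bar> * norm z \<le> K * norm z" using K(2)[of z] that(2) by (simp add: mult.commute)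
    then show ?thesis using that(1) by simp
  qed
  then show ?thesis using that K(1) by blast
qed

lemma ev_bound:
  obtains K where "0 < K" "\<And>e. e \<in> E \<Longrightarrow> ev e \<le> K"
proof -
  obtain K where K: "0 < K" "\<And>z l. z \<noteq> 0 \<Longrightarrow> T z = l *\<^sub>R z \<Longrightarrow> \<bar>l\<bar> \<le> K"
    using eigenvalue_bound by blast
  have "ev e \<le> K" if "e \<in> E" for e
    using K(2)[of e "ev e"] T_eigen[OF that] orthonormal_inner[OF orthonormal that that] by fastforce
  then show ?thesis using that K(1) by blast
qed

lemma bounded_ev_powr:
  assumes "0 \<le> p"
  shows "bounded ((\<lambda>e. ev e powr p) ` E)"
proof -
  obtain K where "\<And>e. e \<in> E \<Longrightarrow> ev e \<le> K" using ev_bound by blast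
  then have "ev e powr p \<le> K powr p" if "e \<in> E" for e
    using that assms ev_nonneg[of e] by (intro powr_mono2) auto
  then show ?thesis by (auto simp: bounded_iff)
qed

text \<open>Diagonal counterpart of \<open>op_power\<close> for \<open>0 \<le> p\<close>, where the
  multipliers are bounded. As \<open>0 powr p = 0\<close>, kernel directions are annihilated even
  for \<open>p = 0\<close>.\<close>

definition pw :: "real \<Rightarrow> 'a \<Rightarrow> 'a" where "pw p = diag (\<lambda>e. ev e powr p)"

lemma inner_pw: "0 \<le> p \<Longrightarrow> e \<in> E \<Longrightarrow> pw p x \<bullet> e = ev e powr p * (x \<bullet> e)"
  by (simp add: pw_def inner_diag bounded_ev_powr)

lemma pw_selfadjoint: "0 \<le> p \<Longrightarrow> pw p x \<bullet> y = x \<bullet> pw p y"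
  by (simp add: pw_def diag_selfadjoint bounded_ev_powr)

lemma bounded_linear_pw: "0 \<le> p \<Longrightarrow> bounded_linear (pw p)"
  by (simp add: pw_def bounded_linear_diag bounded_ev_powr)

lemma pw_pw: "0 \<le> p \<Longrightarrow> 0 \<le> q \<Longrightarrow> pw p (pw q x) = pw (p + q) x"
  by (rule coords_eqI) (simp add: inner_pw powr_add)

lemma pw_1: "pw 1 x = T x"
  by (rule coords_eqI) (simp add: inner_pw inner_T ev_nonneg)

lemma pw_half: "pw (1/2) (pw (1/2) x) = T x"
  by (simp add: pw_pw pw_1)

text \<open>The indicator multiplier maps into the eigenspace and fixes it, because an element of
  the eigenspace has nonzero coordinates only at basis vectors with eigenvalue
  \<open>l\<close>.\<close>

lemma orthogonal_projection_eigenspace: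
  "orthogonal_projection (eigenspace T l) x = diag (\<lambda>e. if ev e = l then 1 else 0) x"
proof -
  let ?g = "\<lambda>e. if ev e = l then 1 else 0 :: real"
  have b: "bounded (?g ` E)" by (rule finite_imp_bounded[OF finite_subset[of _ "{0,1}"]]) auto
  have mem: "diag ?g z \<in> eigenspace T l" for z
    unfolding eigenspace_def mem_Collect_eq
    by (rule coords_eqI) (simp add: inner_T inner_diag[OF b])
  have fix_eig: "diag ?g z = z" if "z \<in> eigenspace T l" for z
  proof (rule coords_eqI)
    fix e assume e: "e \<in> E"
    have "ev e * (z \<bullet> e) = l * (z \<bullet> e)" using that inner_T[OF e, of z] by (auto simp: eigenspace_def)
    then show "diag ?g z \<bullet> e = z \<bullet> e" by (auto simp: inner_diag[OF b e])
  qed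
  have orth: "orthogonal (x - diag ?g x) z" if "z \<in> eigenspace T l" for z
  proof -
    have "diag ?g x \<bullet> z = x \<bullet> z" using diag_selfadjoint[OF b, of x z] fix_eig[OF that] by simp
    then show ?thesis by (simp add: orthogonal_def inner_diff_left)
  qed
  show ?thesis
    unfolding orthogonal_projection_def
  proof (rule the_equality)
    show "diag ?g x \<in> eigenspace T l \<and> (\<forall>z\<in>eigenspace T l. orthogonal (x - diag ?g x) z)"
      using mem orth by blast
    fix y assume y: "y \<in> eigenspace T l \<and> (\<forall>z\<in>eigenspace T l. orthogonal (x - y) z)"
    \<comment> \<open>Two candidates for the projection differ by an element of the eigenspace that
      is orthogonal to the eigenspace, hence to itself.\<close>
    define d where "d = y - diag ?g x"
    have "d \<in> eigenspace T l"
      using y mem[of x] by (simp add: eigenspace_def d_def T.diff scaleR_diff_right)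
    then have "(x - y) \<bullet> d = 0" "(x - diag ?g x) \<bullet> d = 0"
      using y orth by (auto simp: orthogonal_def)
    then have "d \<bullet> d = 0" by (simp add: d_def inner_diff_left)
    then show "y = diag ?g x" by (simp add: d_def)
  qed
qed

text \<open>Projections for different eigenvalues are orthogonal, so convergence reduces to square
  summability. The powers are at most \<open>K powr p\<close>, and a Bessel inequality for the
  projections bounds the rest.\<close>

lemma op_power_domain_nonneg:
  assumes "0 \<le> p"
  shows "x \<in> op_power_domain T p"
proof -
  let ?P = "\<lambda>l. orthogonal_projection (eigenspace T l) x"
  have b: "bounded ((\<lambda>e. if ev e = l then 1 else 0 :: real) ` E)" for l
    by (rule finite_imp_bounded[OF finite_subset[of _ "{0,1}"]]) auto
  have PP: "?P l \<bullet> ?P m = (if l = m then ?P l \<bullet> x else 0)" for l m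
  proof -
    have "?P l \<bullet> ?P m = diag (\<lambda>e. (if ev e = m then 1 else 0) * (if ev e = l then 1 else 0)) x \<bullet> x"
      by (simp add: orthogonal_projection_eigenspace diag_diag[OF b b, symmetric]
          flip: diag_selfadjoint[OF b])
    moreover have "diag (\<lambda>e. (if ev e = m then 1 else 0) * (if ev e = l then 1 else 0)) x
        = (if l = m then ?P l else 0)"
      by (rule coords_eqI)
         (auto simp: orthogonal_projection_eigenspace inner_diag[OF bounded_mult_image[OF b b]] inner_diag[OF b])
    ultimately show ?thesis by simp
  qed
  obtain K where K: "0 < K" "\<And>z l. z \<noteq> 0 \<Longrightarrow> T z = l *\<^sub>R z \<Longrightarrow> \<bar>l\<bar> \<le> K"
    using eigenvalue_bound by blast
  have "(\<lambda>l. (l powr p) *\<^sub>R ?P l) summable_on positive_eigenvalues T"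
  proof (rule summable_on_orthogonal)
    show "pairwise (\<lambda>l m. orthogonal ((l powr p) *\<^sub>R ?P l) ((m powr p) *\<^sub>R ?P m)) (positive_eigenvalues T)"
      by (auto simp: pairwise_def orthogonal_def PP)
    show "(\<lambda>l. (norm ((l powr p) *\<^sub>R ?P l))\<^sup>2) summable_on positive_eigenvalues T"
    proof (rule nonneg_bounded_sums_summable)
      fix L assume L: "finite L" "L \<subseteq> positive_eigenvalues T"
      have 1: "(norm ((l powr p) *\<^sub>R ?P l))\<^sup>2 \<le> (K powr p)\<^sup>2 * (norm (?P l))\<^sup>2" if "l \<in> L" for l
      proof -
        have "0 < l" "eigenspace T l \<noteq> {0}"
          using that L(2) by (auto simp: positive_eigenvalues_def)
        moreover have "0 \<in> eigenspace T l" by (simp add: eigenspace_def T.zero)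
        ultimately obtain z where "z \<in> eigenspace T l" "z \<noteq> 0" by blast
        then have "l \<le> K" using K(2)[of z l] by (simp add: eigenspace_def)
        then have "l powr p \<le> K powr p" using \<open>0 < l\<close> assms by (intro powr_mono2) auto
        then have "(l powr p)\<^sup>2 \<le> (K powr p)\<^sup>2" by (intro power_mono) auto
        then show ?thesis by (simp add: power_mult_distrib mult_right_mono)
      qed
      \<comment> \<open>\<open>S\<close> is the projection of \<open>x\<close> onto a finite sum of
        eigenspaces: \<open>S \<bullet> x\<close> is the square of \<open>norm S\<close>, whence
        \<open>norm S \<le> norm x\<close>.\<close>
      define S where "S = (\<Sum>l\<in>L. ?P l)"
      have nS: "(norm S)\<^sup>2 = (\<Sum>l\<in>L. (norm (?P l))\<^sup>2)"
        unfolding S_def using L(1)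
        by (rule norm_sum_Pythagorean) (auto simp: pairwise_def orthogonal_def PP)
      moreover have "S \<bullet> x = (\<Sum>l\<in>L. (norm (?P l))\<^sup>2)"
        unfolding S_def inner_sum_left by (simp add: power2_norm_eq_inner PP)
      ultimately have "norm S * norm S \<le> norm S * norm x"
        using norm_cauchy_schwarz[of S x] by (simp add: power2_eq_square)
      then have "norm S \<le> norm x" by (cases "norm S = 0") auto
      then have "(\<Sum>l\<in>L. (norm (?P l))\<^sup>2) \<le> (norm x)\<^sup>2" using nS by (metis power_mono norm_ge_zero)
      then have "(\<Sum>l\<in>L. (K powr p)\<^sup>2 * (norm (?P l))\<^sup>2) \<le> (K powr p)\<^sup>2 * (norm x)\<^sup>2"
        by (simp add: mult_left_mono flip: sum_distrib_left)
      then show "(\<Sum>l\<in>L. (norm ((l powr p) *\<^sub>R ?P l))\<^sup>2) \<le> (K powr p)\<^sup>2 * (norm x)\<^sup>2"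
        using sum_mono[OF 1] by (rule order_trans[rotated])
    qed simp
  qed
  then show ?thesis by (simp add: op_power_domain_def)
qed

end

section \<open>Injective operators: negative powers and interpolation\<close>

locale injective_spectral = spectral +
  assumes ev_pos: "\<And>e. e \<in> E \<Longrightarrow> 0 < ev e"
begin

text \<open>Pairing the spectral series with \<open>e\<close> leaves only the term
  \<open>l = ev e\<close>. On the domain this covers negative \<open>p\<close> as well.\<close>

lemma inner_op_power:
  assumes x: "x \<in> op_power_domain T p" and e: "e \<in> E"
  shows "op_power T p x \<bullet> e = ev e powr p * (x \<bullet> e)"
proof -
  let ?f = "\<lambda>l. (l powr p) *\<^sub>R orthogonal_projection (eigenspace T l) x"
  have b: "bounded ((\<lambda>e. if ev e = l then 1 else 0 :: real) ` E)" for l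
    by (rule finite_imp_bounded[OF finite_subset[of _ "{0,1}"]]) auto
  have "(?f has_sum op_power T p x) (positive_eigenvalues T)"
    unfolding op_power_def using x by (intro has_sum_infsum) (simp add: op_power_domain_def)
  then have "((\<lambda>l. ?f l \<bullet> e) has_sum op_power T p x \<bullet> e) (positive_eigenvalues T)"
    by (rule has_sum_inner_left)
  moreover have "((\<lambda>l. ?f l \<bullet> e) has_sum ev e powr p * (x \<bullet> e)) (positive_eigenvalues T)"
  proof (rule has_sum_finite_neutralI[of "{ev e}"])
    have "e \<noteq> 0" using orthonormal_inner[OF orthonormal e e] by auto
    then show "{ev e} \<subseteq> positive_eigenvalues T"
      using ev_pos[OF e] T_eigen[OF e] by (auto simp: positive_eigenvalues_def eigenspace_def)
  qed (auto simp: orthogonal_projection_eigenspace inner_diag[OF b e])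
  ultimately show ?thesis by (rule has_sum_unique)
qed

lemma op_power_eq_pw: "0 \<le> p \<Longrightarrow> op_power T p x = pw p x"
  by (rule coords_eqI) (simp add: inner_op_power op_power_domain_nonneg inner_pw)

text \<open>Trades the domain of an unbounded negative power for the range of a bounded positive
  one; positivity of the eigenvalues makes the two powers cancel.\<close>

lemma source_representation:
  assumes "x \<in> op_power_domain T (- p)" "0 \<le> p"
  obtains w where "x = pw p w"
proof
  show "x = pw p (op_power T (- p) x)"
  proof (rule coords_eqI)
    fix e assume e: "e \<in> E"
    then show "x \<bullet> e = pw p (op_power T (- p) x) \<bullet> e"
      using ev_pos[OF e] assms by (simp add: inner_pw inner_op_power powr_minus)
  qed
qed

text \<open>Hoelder's inequality for the coordinates, obtained from the weighted Young inequality
  after dividing by the squared norms \<open>a\<close> and \<open>b\<close>.\<close>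

lemma interpolation_inequality:
  assumes "0 \<le> p" "p \<le> q" "0 < q"
  shows "norm (pw p x) \<le> norm (pw q x) powr (p / q) * norm x powr (1 - p / q)"
proof (cases "x = 0")
  case True
  have "pw p x = 0" using linear_0[OF bounded_linear.linear[OF bounded_linear_pw]] assms True by simp
  then show ?thesis by simp
next
  case False
  define t where "t = p / q"
  have t: "0 \<le> t" "t \<le> 1" using assms by (auto simp: t_def)
  define a b where "a = (norm (pw q x))\<^sup>2" and "b = (norm x)\<^sup>2"
  have "pw q x \<noteq> 0"
  proof
    assume 0: "pw q x = 0"
    have "x = 0"
    proof (rule coords_eqI)
      fix e assume e: "e \<in> E"
      show "x \<bullet> e = 0 \<bullet> e" using inner_pw[of q e x] 0 e ev_pos[OF e] assms by simp
    qed
    then show False using False by simp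
  qed
  then have ab: "0 < a" "0 < b" using False by (auto simp: a_def b_def)
  have pointwise: "(pw p x \<bullet> e)\<^sup>2 \<le> a powr t * b powr (1 - t) *
      (t * ((pw q x \<bullet> e)\<^sup>2 / a) + (1 - t) * ((x \<bullet> e)\<^sup>2 / b))" if e: "e \<in> E" for e
  proof (cases "x \<bullet> e = 0")
    case True
    then show ?thesis using e assms by (simp add: inner_pw)
  next
    case False
    define \<xi> where "\<xi> = (x \<bullet> e)\<^sup>2"
    have \<xi>: "0 < \<xi>" using False by (simp add: \<xi>_def)
    define u where "u = ev e powr (2 * q)"
    have u: "0 < u" using ev_pos[OF e] by (simp add: u_def)
    have sq: "(ev e powr r)\<^sup>2 = ev e powr (2 * r)" for r
      using ev_pos[OF e] by (simp add: power2_eq_square flip: powr_add)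
    have "(u * \<xi> / a) powr t * (\<xi> / b) powr (1 - t) \<le> t * (u * \<xi> / a) + (1 - t) * (\<xi> / b)"
      using Youngs_inequality_0[of t "1 - t" "u * \<xi> / a" "\<xi> / b"] t u \<xi> ab by simp
    then have "a powr t * b powr (1 - t) * ((u * \<xi> / a) powr t * (\<xi> / b) powr (1 - t))
        \<le> a powr t * b powr (1 - t) * (t * (u * \<xi> / a) + (1 - t) * (\<xi> / b))"
      by (intro mult_left_mono) auto
    moreover have "a powr t * b powr (1 - t) * ((u * \<xi> / a) powr t * (\<xi> / b) powr (1 - t)) = u powr t * \<xi>"
    proof -
      have "\<xi> powr t * \<xi> powr (1 - t) = \<xi>" using \<xi> by (simp flip: powr_add)
      then show ?thesis using ab u \<xi> by (simp add: powr_divide powr_mult)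
    qed
    moreover have "u powr t = ev e powr (2 * p)"
      using assms by (simp add: u_def powr_powr t_def)
    ultimately show ?thesis
      using e assms by (simp add: inner_pw power_mult_distrib sq u_def \<xi>_def)
  qed
  \<comment> \<open>Summed over the basis by Parseval, the bracket becomes
    \<open>t + (1 - t) = 1\<close>.\<close>
  have "((\<lambda>e. a powr t * b powr (1 - t) * (t * ((pw q x \<bullet> e)\<^sup>2 / a) + (1 - t) * ((x \<bullet> e)\<^sup>2 / b)))
      has_sum a powr t * b powr (1 - t) * (t * (a / a) + (1 - t) * (b / b))) E"
    unfolding a_def b_def divide_inverse
    by (intro has_sum_cmult_right has_sum_add has_sum_cmult_left parseval_norm)
  then have "(norm (pw p x))\<^sup>2 \<le> a powr t * b powr (1 - t) * (t * (a / a) + (1 - t) * (b / b))"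
    by (rule has_sum_mono[OF parseval_norm _ pointwise])
  also have "\<dots> = (norm (pw q x) powr t * norm x powr (1 - t))\<^sup>2"
    using ab \<open>pw q x \<noteq> 0\<close> False
    by (simp add: a_def b_def power_mult_distrib power2_eq_square powr_mult)
  finally show ?thesis unfolding t_def[symmetric] by (rule power2_le_imp_le) simp
qed

text \<open>
  Real interpolation: the squared norm of \<open>pw (\<theta> * m) x\<close> is \<open>\<theta> * (1 - \<theta>)\<close> times the integral of
  \<open>t powr (\<theta> - 2)\<close> against the quadratic K-functional of the pair of norms \<open>pw m x\<close> and \<open>x\<close>, which
  is up to a factor 2 the sum of \<open>min (ev e powr (2 * m)) t * (x \<bullet> e)\<^sup>2\<close>.
\<close>

lemma interpolation_bounded:
  assumes D: "linear D" "\<And>x. norm (D x) \<le> norm x" "\<And>x. norm (pw m (D x)) \<le> L * norm (pw m x)"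
    and L: "1 \<le> L" and m: "0 < m" and \<theta>: "0 < \<theta>" "\<theta> < 1"
    and F: "finite F" "F \<subseteq> E" and f: "f = (\<Sum>e\<in>F. (f \<bullet> e) *\<^sub>R e)"
  shows "norm (pw (\<theta> * m) (D f)) \<le> sqrt 2 * L * norm (pw (\<theta> * m) f)"
proof -
  define \<mu> where "\<mu> e = ev e powr (2 * m)" for e
  have \<mu>: "0 < \<mu> e" if "e \<in> E" for e using ev_pos[OF that] by (simp add: \<mu>_def)
  have sq: "(ev e powr r)\<^sup>2 = ev e powr (2 * r)" if "e \<in> E" for e r
    using ev_pos[OF that] by (simp add: power2_eq_square flip: powr_add)
  have pwm: "(pw m x \<bullet> e)\<^sup>2 = \<mu> e * (x \<bullet> e)\<^sup>2" if "e \<in> E" for x e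
    using m that by (simp add: inner_pw power_mult_distrib sq \<mu>_def)
  have pw\<theta>: "(pw (\<theta> * m) x \<bullet> e)\<^sup>2 = \<mu> e powr \<theta> * (x \<bullet> e)\<^sup>2" if "e \<in> E" for x e
    using m \<theta> that by (simp add: inner_pw power_mult_distrib sq \<mu>_def powr_powr mult_ac)
  \<comment> \<open>Comparison of the K-functionals at \<open>t\<close>. Cutting \<open>f\<close> at
    the level \<open>\<mu> e = t\<close> gives a near-optimal splitting \<open>z + y\<close>;
    \<open>D\<close> is bounded on \<open>z\<close> in the norm of \<open>pw m\<close> and on
    \<open>y\<close> in the plain norm.\<close>
  have K: "(\<Sum>e\<in>G. min (\<mu> e) t * (D f \<bullet> e)\<^sup>2) \<le> 2 * L\<^sup>2 * (\<Sum>e\<in>F. min (\<mu> e) t * (f \<bullet> e)\<^sup>2)"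
    if G: "finite G" "G \<subseteq> E" and t: "0 < t" for G t
  proof -
    define y where "y = (\<Sum>e\<in>{e\<in>F. t < \<mu> e}. (f \<bullet> e) *\<^sub>R e)"
    define z where "z = (\<Sum>e\<in>{e\<in>F. \<not> t < \<mu> e}. (f \<bullet> e) *\<^sub>R e)"
    have fzy: "f = z + y"
      unfolding y_def z_def using F(1)
      by (subst f, subst sum.union_disjoint[symmetric]) (auto intro!: sum.cong)
    have ny: "(norm y)\<^sup>2 = (\<Sum>e\<in>{e\<in>F. t < \<mu> e}. (f \<bullet> e)\<^sup>2)"
      unfolding y_def using F by (intro norm_sum_orthonormal[OF orthonormal]) auto
    have pwz: "pw m z = (\<Sum>e\<in>{e\<in>F. \<not> t < \<mu> e}. (pw m f \<bullet> e) *\<^sub>R e)"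
    proof (rule coords_eqI)
      fix e assume e: "e \<in> E"
      show "pw m z \<bullet> e = (\<Sum>e\<in>{e\<in>F. \<not> t < \<mu> e}. (pw m f \<bullet> e) *\<^sub>R e) \<bullet> e"
        unfolding inner_pw[OF less_imp_le[OF m] e] z_def
        using F e m by (subst (1 2) inner_sum_orthonormal[OF orthonormal]) (auto simp: inner_pw)
    qed
    have nz: "(norm (pw m z))\<^sup>2 = (\<Sum>e\<in>{e\<in>F. \<not> t < \<mu> e}. \<mu> e * (f \<bullet> e)\<^sup>2)"
      unfolding pwz using F
      by (subst norm_sum_orthonormal[OF orthonormal]) (auto intro!: sum.cong simp: pwm)
    have Kf: "(\<Sum>e\<in>F. min (\<mu> e) t * (f \<bullet> e)\<^sup>2) = (norm (pw m z))\<^sup>2 + t * (norm y)\<^sup>2"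
    proof -
      have "(\<Sum>e\<in>F. min (\<mu> e) t * (f \<bullet> e)\<^sup>2) = (\<Sum>e\<in>{e\<in>F. \<not> t < \<mu> e} \<union> {e\<in>F. t < \<mu> e}. min (\<mu> e) t * (f \<bullet> e)\<^sup>2)"
        by (intro sum.cong) auto
      also have "\<dots> = (\<Sum>e\<in>{e\<in>F. \<not> t < \<mu> e}. min (\<mu> e) t * (f \<bullet> e)\<^sup>2) + (\<Sum>e\<in>{e\<in>F. t < \<mu> e}. min (\<mu> e) t * (f \<bullet> e)\<^sup>2)"
        using F(1) by (intro sum.union_disjoint) auto
      also have "\<dots> = (norm (pw m z))\<^sup>2 + t * (norm y)\<^sup>2"
        unfolding nz ny sum_distrib_left by (intro arg_cong2[where f="(+)"] sum.cong) auto
      finally show ?thesis .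
    qed
    \<comment> \<open>The minimum is estimated by \<open>\<mu> e\<close> on the part from
      \<open>z\<close> and by \<open>t\<close> on the part from \<open>y\<close>; the factor 2 comes
      from squaring a sum.\<close>
    have "min (\<mu> e) t * (D f \<bullet> e)\<^sup>2 \<le> 2 * (pw m (D z) \<bullet> e)\<^sup>2 + 2 * t * (D y \<bullet> e)\<^sup>2" if "e \<in> G" for e
    proof -
      have e: "e \<in> E" using that G by blast
      have "(D f \<bullet> e)\<^sup>2 \<le> 2 * (D z \<bullet> e)\<^sup>2 + 2 * (D y \<bullet> e)\<^sup>2"
        using sum_squares_bound[of "D z \<bullet> e" "D y \<bullet> e"]
        by (simp add: fzy linear_add[OF D(1)] inner_add_left power2_sum)
      then have "min (\<mu> e) t * (D f \<bullet> e)\<^sup>2 \<le> min (\<mu> e) t * (2 * (D z \<bullet> e)\<^sup>2 + 2 * (D y \<bullet> e)\<^sup>2)"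
        using \<mu>[OF e] t by (intro mult_left_mono) auto
      also have "\<dots> = min (\<mu> e) t * (2 * (D z \<bullet> e)\<^sup>2) + min (\<mu> e) t * (2 * (D y \<bullet> e)\<^sup>2)"
        by (rule distrib_left)
      also have "\<dots> \<le> \<mu> e * (2 * (D z \<bullet> e)\<^sup>2) + t * (2 * (D y \<bullet> e)\<^sup>2)"
        by (intro add_mono mult_right_mono) auto
      finally show ?thesis by (simp add: pwm[OF e])
    qed
    then have "(\<Sum>e\<in>G. min (\<mu> e) t * (D f \<bullet> e)\<^sup>2) \<le> (\<Sum>e\<in>G. 2 * (pw m (D z) \<bullet> e)\<^sup>2 + 2 * t * (D y \<bullet> e)\<^sup>2)"
      by (rule sum_mono)
    also have "\<dots> = 2 * (\<Sum>e\<in>G. (pw m (D z) \<bullet> e)\<^sup>2) + 2 * t * (\<Sum>e\<in>G. (D y \<bullet> e)\<^sup>2)"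
      by (simp add: sum.distrib sum_distrib_left)
    also have "\<dots> \<le> 2 * (norm (pw m (D z)))\<^sup>2 + 2 * t * (norm (D y))\<^sup>2"
      using t by (intro add_mono mult_left_mono bessel_finite[OF orthonormal G]) auto
    also have "\<dots> \<le> 2 * (L * norm (pw m z))\<^sup>2 + 2 * t * (L * norm y)\<^sup>2"
    proof -
      have "norm (D y) \<le> L * norm y" using D(2)[of y] mult_right_mono[OF L, of "norm y"] by simp
      then show ?thesis using t D(3)[of z] by (intro add_mono mult_left_mono power_mono) auto
    qed
    also have "\<dots> = 2 * L\<^sup>2 * (\<Sum>e\<in>F. min (\<mu> e) t * (f \<bullet> e)\<^sup>2)"
      unfolding Kf by (simp add: power_mult_distrib algebra_simps)
    finally show ?thesis .
  qed
  define k where "k = \<theta> * (1 - \<theta>)"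
  have k: "0 < k" using \<theta> by (simp add: k_def)
  have int: "((\<lambda>t. t powr (\<theta> - 2) * (\<Sum>e\<in>G. min (\<mu> e) t * (x \<bullet> e)\<^sup>2)) has_integral
      (\<Sum>e\<in>G. (pw (\<theta> * m) x \<bullet> e)\<^sup>2) / k) {0..}" if G: "finite G" "G \<subseteq> E" for x G
  proof -
    have "((\<lambda>t. \<Sum>e\<in>G. (t powr (\<theta> - 2) * min (\<mu> e) t) * (x \<bullet> e)\<^sup>2) has_integral
        (\<Sum>e\<in>G. (\<mu> e powr \<theta> / k) * (x \<bullet> e)\<^sup>2)) {0..}"
      unfolding k_def using G \<theta> \<mu>
      by (intro has_integral_sum has_integral_mult_left has_integral_powr_min) auto
    moreover have "(\<Sum>e\<in>G. (\<mu> e powr \<theta> / k) * (x \<bullet> e)\<^sup>2) = (\<Sum>e\<in>G. (pw (\<theta> * m) x \<bullet> e)\<^sup>2) / k"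
      unfolding sum_divide_distrib using G by (intro sum.cong) (auto simp: pw\<theta>)
    ultimately show ?thesis by (simp add: sum_distrib_left mult.assoc)
  qed
  \<comment> \<open>The K-functional bound is integrated against the weight. All sums are finite, so
    they commute with the integral, and the constant \<open>k\<close> cancels.\<close>
  have fin: "(\<Sum>e\<in>G. (pw (\<theta> * m) (D f) \<bullet> e)\<^sup>2) \<le> (sqrt 2 * L * norm (pw (\<theta> * m) f))\<^sup>2"
    if G: "finite G" "G \<subseteq> E" for G
  proof -
    have "(\<Sum>e\<in>G. (pw (\<theta> * m) (D f) \<bullet> e)\<^sup>2) / k \<le> 2 * L\<^sup>2 * ((\<Sum>e\<in>F. (pw (\<theta> * m) f \<bullet> e)\<^sup>2) / k)"
    proof (rule has_integral_le[OF int[OF G] has_integral_mult_right[OF int[OF F]]])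
      fix t :: real assume "t \<in> {0..}"
      then show "t powr (\<theta> - 2) * (\<Sum>e\<in>G. min (\<mu> e) t * (D f \<bullet> e)\<^sup>2)
          \<le> 2 * L\<^sup>2 * (t powr (\<theta> - 2) * (\<Sum>e\<in>F. min (\<mu> e) t * (f \<bullet> e)\<^sup>2))"
        using mult_left_mono[OF K[OF G, of t], of "t powr (\<theta> - 2)"] by (cases "t = 0") (auto simp: mult_ac)
    qed
    then have "(\<Sum>e\<in>G. (pw (\<theta> * m) (D f) \<bullet> e)\<^sup>2) \<le> 2 * L\<^sup>2 * (\<Sum>e\<in>F. (pw (\<theta> * m) f \<bullet> e)\<^sup>2)"
      using k by (simp add: divide_le_cancel)
    also have "\<dots> \<le> 2 * L\<^sup>2 * (norm (pw (\<theta> * m) f))\<^sup>2"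
      by (intro mult_left_mono bessel_finite[OF orthonormal F]) auto
    finally show ?thesis by (simp add: power_mult_distrib)
  qed
  have "(norm (pw (\<theta> * m) (D f)))\<^sup>2 \<le> (sqrt 2 * L * norm (pw (\<theta> * m) f))\<^sup>2"
    using nonneg_bounded_sums_summable(2)[of E "\<lambda>e. (pw (\<theta> * m) (D f) \<bullet> e)\<^sup>2", OF _ fin]
      infsumI[OF parseval_norm, of "pw (\<theta> * m) (D f)"] by simp
  then show ?thesis by (rule power2_le_imp_le) (use L in auto)
qed

end


section \<open>The filter in the eigenbasis of the preconditioned normal operator\<close>

lemma bounded_unit_image:
  fixes g :: "'i \<Rightarrow> real"
  assumes "\<And>f. f \<in> F \<Longrightarrow> 0 \<le> g f" "\<And>f. f \<in> F \<Longrightarrow> g f \<le> 1"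
  shows "bounded (g ` F)"
proof (rule boundedI)
  show "norm x \<le> 1" if "x \<in> g ` F" for x using that assms by auto
qed

text \<open>Each factor is the reciprocal of \<open>1 + x / \<alpha> i\<close>, and the product of
  these terms is at least one plus the sum of the \<open>x / \<alpha> i\<close>.\<close>

lemma prod_resolvent_bound:
  fixes \<alpha> :: "nat \<Rightarrow> real"
  assumes "\<And>i. 1 \<le> i \<Longrightarrow> 0 < \<alpha> i" "0 \<le> x"
  shows "(1 + (\<Sum>j=1..n. 1 / \<alpha> j) * x) * (\<Prod>i=1..n. \<alpha> i / (x + \<alpha> i)) \<le> 1"
proof (induction n)
  case (Suc n)
  define s where "s = (\<Sum>j=1..n. 1 / \<alpha> j)"
  define b where "b = \<alpha> (Suc n)"
  have b: "0 < b" using assms(1) by (simp add: b_def)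
  have s: "0 \<le> s" unfolding s_def by (intro sum_nonneg) (simp add: assms(1) less_imp_le)
  have P: "0 \<le> (\<Prod>i=1..n. \<alpha> i / (x + \<alpha> i))"
  proof (intro prod_nonneg ballI)
    fix i assume "i \<in> {1..n}"
    then have "0 < \<alpha> i" using assms(1) by simp
    then show "0 \<le> \<alpha> i / (x + \<alpha> i)" using assms(2) by simp
  qed
  \<comment> \<open>After clearing the denominator the two sides differ by \<open>s * x * x\<close>,
    which is nonnegative.\<close>
  have "(1 + (s + 1 / b) * x) * (b / (x + b)) \<le> 1 + s * x"
  proof -
    have "(1 + (s + 1 / b) * x) * b = b + s * x * b + x" using b by (simp add: field_simps)
    also have "\<dots> \<le> (1 + s * x) * (x + b)"
      using s assms(2) by (simp add: algebra_simps)
    finally show ?thesis using b assms(2) by (simp add: pos_divide_le_eq)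
  qed
  then have "(1 + (s + 1 / b) * x) * (b / (x + b)) * (\<Prod>i=1..n. \<alpha> i / (x + \<alpha> i))
      \<le> (1 + s * x) * (\<Prod>i=1..n. \<alpha> i / (x + \<alpha> i))"
    using P by (rule mult_right_mono)
  also have "\<dots> \<le> 1" using Suc by (simp add: s_def)
  finally show ?case by (simp add: s_def b_def mult_ac)
qed simp

section \<open>The preconditioned operator and the norm equivalence\<close>

locale hilbert_scale = injective_spectral E T
  for E :: "'a::{real_inner,complete_space} set" and T :: "'a \<Rightarrow> 'a" +
  fixes A :: "'a \<Rightarrow> 'b::real_inner" and A' :: "'b \<Rightarrow> 'a" and a c :: real
  assumes A_bl: "bounded_linear A" and A'_bl: "bounded_linear A'"
    and A_adjoint: "\<And>x y. A x \<bullet> y = x \<bullet> A' y"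
    and a_pos: "0 < a" and c_ge_1: "1 \<le> c"
    and A_lower: "\<And>x. norm (pw (a / 2) x) \<le> c * norm (A x)"
    and A_upper: "\<And>x. norm (A x) \<le> c * norm (pw (a / 2) x)"
begin

sublocale A: bounded_linear A by (rule A_bl)
sublocale A': bounded_linear A' by (rule A'_bl)

abbreviation Q :: "'a \<Rightarrow> 'a" where "Q \<equiv> pw (1/2)"
text \<open>The power of \<open>T\<close> whose norm is equivalent to that of
  \<open>A (Q x)\<close>: it is \<open>pw (a / 2)\<close> applied after \<open>Q\<close>.\<close>

abbreviation J :: "'a \<Rightarrow> 'a" where "J \<equiv> pw ((a + 1) / 2)"

definition H :: "'a \<Rightarrow> 'a" where "H x = Q (A' (A (Q x)))"

sublocale Q: bounded_linear Q by (rule bounded_linear_pw) simp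

lemma Q_selfadjoint: "Q x \<bullet> y = x \<bullet> Q y"
  by (rule pw_selfadjoint) simp

lemma Q_Q: "Q (Q x) = T x"
  by (rule pw_half)

lemma norm_Q: "(norm (Q x))\<^sup>2 = T x \<bullet> x"
  by (simp add: power2_norm_eq_inner Q_selfadjoint Q_Q inner_commute)

lemma H_inner: "H x \<bullet> y = A (Q x) \<bullet> A (Q y)"
  unfolding H_def Q_selfadjoint[of "A' (A (Q x))"] inner_commute[of "A' (A (Q x))"] A_adjoint[symmetric]
  by (rule inner_commute)

lemma H_psa: "positive_selfadjoint H"
proof -
  have "bounded_linear (\<lambda>x. Q (A' (A (Q x))))"
    by (intro bounded_linear_compose[OF Q.bounded_linear] bounded_linear_compose[OF A'_bl]
        bounded_linear_compose[OF A_bl] Q.bounded_linear)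
  then have "bounded_linear H" by (simp only: H_def[abs_def, symmetric])
  moreover have "H x \<bullet> y = x \<bullet> H y" for x y
    using H_inner[of x y] H_inner[of y x] by (simp add: inner_commute)
  moreover have "0 \<le> H x \<bullet> x" for x by (simp add: H_inner)
  ultimately show ?thesis unfolding positive_selfadjoint_def by blast
qed

text \<open>\<open>H e \<bullet> e\<close> is the squared norm of \<open>A (Q e)\<close> and so at
  most a multiple of \<open>T e \<bullet> e\<close>; thus \<open>H\<close> inherits the trace class
  property of \<open>T\<close>.\<close>

lemma H_compact:
  assumes "orthonormal_basis F" "(\<lambda>e. T e \<bullet> e) summable_on F"
  shows "compact (closure (H ` cball 0 1))"
proof -
  interpret F: onb F by (simp add: onb.intro assms)
  obtain K where K: "\<And>x. norm (A x) \<le> norm x * K" using A.bounded by blast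
  have "(\<lambda>e. H e \<bullet> e) summable_on F"
  proof (rule summable_on_comparison_test[OF summable_on_cmult_right[OF assms(2), of "K\<^sup>2"]])
    fix e
    have "(norm (A (Q e)))\<^sup>2 \<le> (norm (Q e) * K)\<^sup>2" by (rule power_mono[OF K]) simp
    then show "H e \<bullet> e \<le> K\<^sup>2 * (T e \<bullet> e)"
      by (simp add: H_inner power_mult_distrib norm_Q mult.commute flip: power2_norm_eq_inner)
  qed (simp add: H_inner)
  then show ?thesis by (rule F.trace_class_compact[OF H_psa])
qed

lemma J_eq: "J x = pw (a / 2) (Q x)"
  using a_pos by (simp add: pw_pw add_divide_distrib)

lemma J_selfadjoint: "J x \<bullet> y = x \<bullet> J y"
  using a_pos by (intro pw_selfadjoint) simp

lemma J_lower: "norm (J x) \<le> c * norm (A (Q x))"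
  unfolding J_eq by (rule A_lower)

lemma J_upper: "norm (A (Q x)) \<le> c * norm (J x)"
  unfolding J_eq by (rule A_upper)

lemma adjoint_A: "adjoint A = A'"
  by (rule adjoint_unique) (simp add: A_adjoint)

end

text \<open>\<open>E\<close> diagonalises \<open>T\<close> and \<open>F\<close> diagonalises
  \<open>H\<close>. These operators need not commute, so estimates pass between \<open>pw\<close>
  and \<open>H.diag\<close> through the equivalent norms of \<open>J x\<close> and
  \<open>A (Q x)\<close>.\<close>

locale diagonalised_scale = hilbert_scale E T A A' a c
  for E :: "'a::{real_inner,complete_space} set" and T :: "'a \<Rightarrow> 'a"
    and A :: "'a \<Rightarrow> 'b::real_inner" and A' a c +
  fixes F :: "'a set"
  assumes F_basis: "orthonormal_basis F"
    and F_eigen: "\<And>f. f \<in> F \<Longrightarrow> \<exists>l. H f = l *\<^sub>R f"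
begin

sublocale H: spectral F H
  using F_basis F_eigen H_psa by (intro spectral.intro onb.intro spectral_axioms.intro)

section \<open>Spectral filters of \<open>H\<close> measured in powers of \<open>T\<close>\<close>

lemma norm_AQ: "((\<lambda>f. H.ev f * (x \<bullet> f)\<^sup>2) has_sum (norm (A (Q x)))\<^sup>2) F"
proof -
  have "((\<lambda>f. (H x \<bullet> f) * (x \<bullet> f)) has_sum H x \<bullet> x) F" by (rule H.parseval)
  moreover have "H x \<bullet> x = (norm (A (Q x)))\<^sup>2" by (simp add: H_inner power2_norm_eq_inner)
  ultimately have "((\<lambda>f. (H x \<bullet> f) * (x \<bullet> f)) has_sum (norm (A (Q x)))\<^sup>2) F" by (simp only:)
  then show ?thesis
    by (rule has_sum_cong[THEN iffD1, rotated]) (simp add: H.inner_T power2_eq_square)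
qed

lemma norm_AQ_diag:
  assumes "bounded (g ` F)" "\<And>f. f \<in> F \<Longrightarrow> H.ev f * (g f)\<^sup>2 \<le> K\<^sup>2" "0 \<le> K"
  shows "norm (A (Q (H.diag g x))) \<le> K * norm x"
proof -
  have "H.ev f * (H.diag g x \<bullet> f)\<^sup>2 \<le> K\<^sup>2 * (x \<bullet> f)\<^sup>2" if "f \<in> F" for f
    using mult_right_mono[OF assms(2)[OF that], of "(x \<bullet> f)\<^sup>2"]
    by (simp add: H.inner_diag[OF assms(1) that] power_mult_distrib mult.assoc)
  then have "(norm (A (Q (H.diag g x))))\<^sup>2 \<le> K\<^sup>2 * (norm x)\<^sup>2"
    by (rule has_sum_mono[OF norm_AQ has_sum_cmult_right[OF H.parseval_norm]])
  then show ?thesis using assms(3) by - (rule power2_le_imp_le, auto simp: power_mult_distrib)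
qed

lemma norm_AQ_contract:
  assumes "\<And>f. f \<in> F \<Longrightarrow> 0 \<le> g f" "\<And>f. f \<in> F \<Longrightarrow> g f \<le> 1"
  shows "norm (A (Q (H.diag g x))) \<le> norm (A (Q x))"
proof -
  have b: "bounded (g ` F)" using assms by (rule bounded_unit_image)
  have "H.ev f * (H.diag g x \<bullet> f)\<^sup>2 \<le> H.ev f * (x \<bullet> f)\<^sup>2" if "f \<in> F" for f
  proof (intro mult_left_mono H.ev_nonneg)
    have "(g f)\<^sup>2 \<le> 1" using assms[OF that] by (simp add: power_le_one)
    then show "(H.diag g x \<bullet> f)\<^sup>2 \<le> (x \<bullet> f)\<^sup>2"
      using mult_right_mono[of "(g f)\<^sup>2" 1 "(x \<bullet> f)\<^sup>2"] by (simp add: H.inner_diag[OF b that] power_mult_distrib)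
  qed
  then have "(norm (A (Q (H.diag g x))))\<^sup>2 \<le> (norm (A (Q x)))\<^sup>2"
    by (rule has_sum_mono[OF norm_AQ norm_AQ])
  then show ?thesis by (rule power2_le_imp_le) simp
qed

text \<open>Duality: pairing the vector with itself moves both operators to the other factor, where
  \<open>J\<close> is controlled by \<open>A\<close> after \<open>Q\<close> and the multiplier acts
  first.\<close>

lemma diag_J_bound:
  assumes "bounded (g ` F)" "\<And>f. f \<in> F \<Longrightarrow> H.ev f * (g f)\<^sup>2 \<le> K\<^sup>2" "0 \<le> K"
  shows "norm (H.diag g (J w)) \<le> c * K * norm w"
proof -
  define y where "y = H.diag g (J w)"
  have "norm y * norm y = H.diag g (J w) \<bullet> y"
    unfolding y_def[symmetric] by (simp flip: power2_eq_square power2_norm_eq_inner)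
  also have "\<dots> = w \<bullet> J (H.diag g y)" by (simp only: H.diag_selfadjoint[OF assms(1)] J_selfadjoint)
  also have "\<dots> \<le> norm w * norm (J (H.diag g y))" by (rule norm_cauchy_schwarz)
  also have "\<dots> \<le> norm w * (c * (K * norm y))"
    using order_trans[OF J_lower[of "H.diag g y"] mult_left_mono[OF norm_AQ_diag[OF assms, of y], of c]] c_ge_1
    by (intro mult_left_mono) auto
  finally have "norm y * norm y \<le> (c * K * norm w) * norm y" by (simp add: mult_ac)
  then show ?thesis using assms(3) c_ge_1 unfolding y_def[symmetric] by (cases "norm y = 0") auto
qed

text \<open>The endpoint without smoothing. \<open>H.diag g\<close> is a contraction in the norms of
  \<open>x\<close> and of \<open>A (Q x)\<close>, hence bounded by \<open>c^2\<close> in the norm of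
  \<open>J x\<close>. Interpolation gives the norm of \<open>Q x\<close>, and duality returns to
  \<open>y\<close>.\<close>

lemma adjoint_stable:
  assumes g: "\<And>f. f \<in> F \<Longrightarrow> 0 \<le> g f" "\<And>f. f \<in> F \<Longrightarrow> g f \<le> 1" and y: "Q y = H.diag g (Q x)"
  shows "norm y \<le> sqrt 2 * c\<^sup>2 * norm x"
proof -
  define C where "C = sqrt 2 * c\<^sup>2"
  have C: "0 \<le> C" by (simp add: C_def)
  have b: "bounded (g ` F)" using g by (rule bounded_unit_image)
  have stable: "norm (Q (H.diag g h)) \<le> C * norm (Q h)"
    if "finite G" "G \<subseteq> E" "h = (\<Sum>e\<in>G. (h \<bullet> e) *\<^sub>R e)" for G h
  proof -
    \<comment> \<open>The choice \<open>\<theta> = 1 / (a + 1)\<close> turns the exponent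
      \<open>(a + 1) / 2\<close> of \<open>J\<close> into the exponent 1/2 of
      \<open>Q\<close>.\<close>
    have "norm (pw (1 / (a + 1) * ((a + 1) / 2)) (H.diag g h))
        \<le> sqrt 2 * c\<^sup>2 * norm (pw (1 / (a + 1) * ((a + 1) / 2)) h)"
    proof (rule interpolation_bounded[OF _ _ _ _ _ _ _ that])
      show "linear (H.diag g)" by (rule bounded_linear.linear[OF H.bounded_linear_diag[OF b]])
      show "norm (H.diag g x) \<le> norm x" for x using H.diag_norm_le[of 1 g x] g by force
      show "norm (J (H.diag g x)) \<le> c\<^sup>2 * norm (J x)" for x
      proof -
        have "norm (J (H.diag g x)) \<le> c * norm (A (Q (H.diag g x)))" by (rule J_lower)
        also have "\<dots> \<le> c * (c * norm (J x))"
          using order_trans[OF norm_AQ_contract J_upper, of g x] g c_ge_1 by (intro mult_left_mono) auto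
        finally show ?thesis by (simp add: power2_eq_square)
      qed
      show "1 \<le> c\<^sup>2" using c_ge_1 by (rule one_le_power)
    qed (use a_pos in auto)
    moreover have "1 / (a + 1) * ((a + 1) / 2) = 1 / 2" using a_pos by simp
    ultimately show ?thesis by (simp only: C_def)
  qed
  have fin: "(\<Sum>e\<in>G. (y \<bullet> e)\<^sup>2) \<le> (C * norm x)\<^sup>2" if G: "finite G" "G \<subseteq> E" for G
  proof -
    define p where "p = (\<Sum>e\<in>G. (y \<bullet> e) *\<^sub>R e)"
    \<comment> \<open>\<open>h\<close> is the preimage under \<open>Q\<close> of the truncation
      \<open>p\<close> of \<open>y\<close>; it exists because only finitely many coordinates are
      inverted. Then \<open>y \<bullet> p = Q y \<bullet> h\<close>, and the hypothesis on
      \<open>Q y\<close> applies.\<close>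
    define h where "h = (\<Sum>e\<in>G. (ev e powr (- 1/2) * (y \<bullet> e)) *\<^sub>R e)"
    have hE: "h \<bullet> e = (if e \<in> G then ev e powr (- 1/2) * (y \<bullet> e) else 0)" if "e \<in> E" for e
      unfolding h_def using inner_sum_orthonormal[OF orthonormal G that] by simp
    have h: "h = (\<Sum>e\<in>G. (h \<bullet> e) *\<^sub>R e)"
      by (subst h_def) (use hE G in \<open>auto intro!: sum.cong\<close>)
    have Qh: "Q h = p"
    proof (rule coords_eqI)
      fix e assume e: "e \<in> E"
      have "ev e powr (1/2) * ev e powr (- 1/2) = 1" using ev_pos[OF e] by (simp flip: powr_add)
      then show "Q h \<bullet> e = p \<bullet> e"
        unfolding p_def using inner_sum_orthonormal[OF orthonormal G e, of "\<lambda>e. y \<bullet> e"]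
        by (simp add: inner_pw e hE flip: mult.assoc)
    qed
    have np: "(norm p)\<^sup>2 = (\<Sum>e\<in>G. (y \<bullet> e)\<^sup>2)"
      unfolding p_def by (rule norm_sum_orthonormal[OF orthonormal G])
    also have "\<dots> = y \<bullet> p" by (simp add: p_def inner_sum_right power2_eq_square)
    also have "\<dots> = x \<bullet> Q (H.diag g h)"
      by (simp add: y H.diag_selfadjoint[OF b] Q_selfadjoint flip: Qh) (simp add: y H.diag_selfadjoint[OF b] flip: Q_selfadjoint)
    also have "\<dots> \<le> norm x * norm (Q (H.diag g h))" by (rule norm_cauchy_schwarz)
    also have "\<dots> \<le> norm x * (C * norm p)" using stable[OF G h] by (intro mult_left_mono) (auto simp: Qh)
    finally have "norm p * norm p \<le> (C * norm x) * norm p" by (simp add: power2_eq_square mult_ac)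
    then have "norm p \<le> C * norm x" using C by (cases "norm p = 0") auto
    then show ?thesis unfolding np[symmetric] by (simp add: power_mono)
  qed
  have "(norm y)\<^sup>2 \<le> (C * norm x)\<^sup>2"
    using nonneg_bounded_sums_summable(2)[of E "\<lambda>e. (y \<bullet> e)\<^sup>2", OF _ fin] infsumI[OF parseval_norm, of y] by simp
  then show ?thesis unfolding C_def[symmetric] by (rule power2_le_imp_le) (use C in simp)
qed

text \<open>The endpoint of maximal smoothing. The vector to bound is
  \<open>J (H.diag g (Q x))\<close>. Its transpose \<open>Q (H.diag g (J w))\<close> is interpolated
  between \<open>H.diag g (J w)\<close>, of order \<open>K\<close>, and
  \<open>J (H.diag g (J w))\<close>, of order \<open>K^2\<close>.\<close>

lemma adjoint_smoothing:
  assumes g: "\<And>f. f \<in> F \<Longrightarrow> 0 \<le> g f" "\<And>f. f \<in> F \<Longrightarrow> g f \<le> 1"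
    and \<sigma>: "0 < \<sigma>" "\<And>f. f \<in> F \<Longrightarrow> H.ev f * g f \<le> 1 / \<sigma>" and y: "Q y = H.diag g (Q x)"
  shows "norm (pw ((a + 2) / 2) y) \<le> c\<^sup>2 * \<sigma> powr (- (a + 2) / (2 * (a + 1))) * norm x"
proof -
  have b: "bounded (g ` F)" using g by (rule bounded_unit_image)
  have bs: "bounded ((\<lambda>f. sqrt (g f)) ` F)" using g by (intro bounded_unit_image) auto
  define K where "K = 1 / sqrt \<sigma>"
  have K: "0 < K" "K\<^sup>2 = 1 / \<sigma>" using \<sigma>(1) by (simp_all add: K_def power_divide)
  have hg: "H.ev f * (g f)\<^sup>2 \<le> K\<^sup>2" if "f \<in> F" for f
  proof -
    have "H.ev f * g f * g f \<le> H.ev f * g f * 1"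
      using g[OF that] H.ev_nonneg[of f] by (intro mult_left_mono) auto
    also have "\<dots> \<le> K\<^sup>2" using \<sigma>(2)[OF that] by (simp add: K)
    finally show ?thesis by (simp add: power2_eq_square mult.assoc)
  qed
  have hs: "H.ev f * (sqrt (g f))\<^sup>2 \<le> K\<^sup>2" if "f \<in> F" for f
    using \<sigma>(2)[OF that] g[OF that] by (simp add: K)
  \<comment> \<open>\<open>Q\<close> is the power \<open>p\<close> of \<open>J\<close>, so
    interpolation between the orders \<open>K\<close> and \<open>K^2\<close> yields
    \<open>K powr (1 + p)\<close>.\<close>
  define p where "p = 1 / (a + 1)"
  have p: "0 < p" "p < 1" using a_pos by (auto simp: p_def)
  have bound: "norm (Q (H.diag g (J w))) \<le> c\<^sup>2 * (K powr (1 + p)) * norm w" for w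
  proof -
    define h where "h = H.diag g (J w)"
    have h1: "norm h \<le> c * K * norm w"
      unfolding h_def using K by (intro diag_J_bound[OF b hg]) auto
    have h2: "norm (J h) \<le> (c * K)\<^sup>2 * norm w"
    proof -
      \<comment> \<open>Writing the filter as a product of two square roots lets each of them absorb
        one \<open>J\<close>, at the cost \<open>c * K\<close>.\<close>
      let ?D = "H.diag (\<lambda>f. sqrt (g f))"
      have "norm (J h) * norm (J h) = J h \<bullet> J h" by (simp flip: power2_eq_square power2_norm_eq_inner)
      also have "\<dots> = H.diag g (J w) \<bullet> J (J h)" by (simp add: h_def J_selfadjoint)
      also have "H.diag g (J w) = ?D (?D (J w))"
        unfolding H.diag_diag[OF bs bs] by (rule H.coords_eqI) (simp add: H.inner_diag b H.bounded_mult_image[OF bs bs] g)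
      also have "?D (?D (J w)) \<bullet> J (J h) = ?D (J w) \<bullet> ?D (J (J h))" by (rule H.diag_selfadjoint[OF bs])
      also have "\<dots> \<le> norm (?D (J w)) * norm (?D (J (J h)))" by (rule norm_cauchy_schwarz)
      also have "\<dots> \<le> (c * K * norm w) * (c * K * norm (J h))"
        using K c_ge_1 by (intro mult_mono diag_J_bound[OF bs hs]) auto
      finally have "norm (J h) * norm (J h) \<le> ((c * K)\<^sup>2 * norm w) * norm (J h)"
        by (simp add: power2_eq_square mult_ac)
      then show ?thesis by (cases "norm (J h) = 0") auto
    qed
    have "norm (Q h) \<le> norm (J h) powr ((1/2) / ((a + 1) / 2)) * norm h powr (1 - (1/2) / ((a + 1) / 2))"
      using a_pos by (intro interpolation_inequality) auto
    also have "(1/2) / ((a + 1) / 2) = p" by (simp add: p_def)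
    also have "norm (J h) powr p * norm h powr (1 - p)
        \<le> ((c * K)\<^sup>2 * norm w) powr p * (c * K * norm w) powr (1 - p)"
      using h1 h2 p K c_ge_1 by (intro mult_mono powr_mono2) auto
    also have "\<dots> = (c * K) powr (1 + p) * norm w"
    proof (cases "w = 0")
      case False
      have cK: "0 < c * K" using K c_ge_1 by simp
      have "((c * K)\<^sup>2 * norm w) powr p * (c * K * norm w) powr (1 - p)
          = ((c * K) powr (2 * p) * (c * K) powr (1 - p)) * (norm w powr p * norm w powr (1 - p))"
        using cK by (simp add: powr_mult powr_powr mult_ac flip: powr_numeral)
      also have "\<dots> = (c * K) powr (1 + p) * norm w"
        using False by (simp add: add.commute flip: powr_add)
      finally show ?thesis .
    qed simp
    also have "\<dots> \<le> c\<^sup>2 * K powr (1 + p) * norm w"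
    proof -
      have "c powr (1 + p) \<le> c powr 2" using c_ge_1 p by (intro powr_mono) auto
      then have "c powr (1 + p) \<le> c\<^sup>2" using c_ge_1 by simp
      then show ?thesis using c_ge_1 K by (simp add: powr_mult mult_right_mono)
    qed
    finally show ?thesis by (simp add: h_def)
  qed
  define u where "u = pw ((a + 2) / 2) y"
  have "u = J (Q y)" using a_pos by (simp add: u_def pw_pw add_divide_distrib add.commute)
  then have u: "u = J (H.diag g (Q x))" by (simp add: y)
  have "norm u * norm u = u \<bullet> u" by (simp flip: power2_eq_square power2_norm_eq_inner)
  also have "\<dots> = x \<bullet> Q (H.diag g (J u))"
    by (subst (1) u) (simp add: J_selfadjoint H.diag_selfadjoint[OF b] Q_selfadjoint)
  also have "\<dots> \<le> norm x * norm (Q (H.diag g (J u)))" by (rule norm_cauchy_schwarz)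
  also have "\<dots> \<le> norm x * (c\<^sup>2 * K powr (1 + p) * norm u)" by (intro mult_left_mono bound) simp
  finally have "norm u * norm u \<le> (c\<^sup>2 * K powr (1 + p) * norm x) * norm u" by (simp add: mult_ac)
  then have "norm u \<le> c\<^sup>2 * K powr (1 + p) * norm x" by (cases "norm u = 0") auto
  moreover have "K powr (1 + p) = \<sigma> powr (- (a + 2) / (2 * (a + 1)))"
  proof -
    have "K = \<sigma> powr (- (1/2))"
      using \<sigma>(1) unfolding K_def powr_minus by (simp add: powr_half_sqrt inverse_eq_divide)
    moreover have "- (1/2) * (1 + p) = - (a + 2) / (2 * (a + 1))"
    proof -
      have "1 + p = (a + 2) / (a + 1)" using a_pos by (simp add: p_def field_simps)
      then have "- (1/2) * (1 + p) = - ((a + 2) / (2 * (a + 1)))" by simp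
      then show ?thesis by (simp only: minus_divide_left)
    qed
    ultimately show ?thesis by (simp only: powr_powr)
  qed
  ultimately show ?thesis by (simp add: u_def)
qed

text \<open>Moment inequality between the two endpoints with weight \<open>t = s / (a + 2)\<close>,
  which multiplies the exponent of \<open>\<sigma>\<close> at the smoothing endpoint.\<close>

lemma adjoint_interpolated:
  assumes g: "\<And>f. f \<in> F \<Longrightarrow> 0 \<le> g f" "\<And>f. f \<in> F \<Longrightarrow> g f \<le> 1"
    and \<sigma>: "0 < \<sigma>" "\<And>f. f \<in> F \<Longrightarrow> H.ev f * g f \<le> 1 / \<sigma>" and y: "Q y = H.diag g (Q x)"
    and s: "0 \<le> s" "s \<le> a + 2"
  shows "norm (pw (s / 2) y) \<le> 2 * c\<^sup>2 * \<sigma> powr (- s / (2 * (a + 1))) * norm x"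
proof -
  define t where "t = s / (a + 2)"
  have t: "0 \<le> t" "t \<le> 1" using s a_pos by (auto simp: t_def)
  \<comment> \<open>The factor 2 dominates both endpoint constants, \<open>sqrt 2\<close> and 1, so
    that a common \<open>M\<close> factors out of the product of powers.\<close>
  define M where "M = 2 * c\<^sup>2 * norm x"
  have "norm y \<le> M"
  proof -
    have "sqrt 2 \<le> 2" by (rule real_le_lsqrt) auto
    then have "sqrt 2 * (c\<^sup>2 * norm x) \<le> 2 * (c\<^sup>2 * norm x)" by (intro mult_right_mono) auto
    then show ?thesis using adjoint_stable[OF g y] by (simp add: M_def mult.assoc)
  qed
  moreover define \<delta> where "\<delta> = \<sigma> powr (- (a + 2) / (2 * (a + 1)))"
  have "norm (pw ((a + 2) / 2) y) \<le> \<delta> * M"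
  proof -
    have "norm (pw ((a + 2) / 2) y) \<le> c\<^sup>2 * \<delta> * norm x"
      unfolding \<delta>_def by (rule adjoint_smoothing[OF g \<sigma> y])
    also have "\<dots> \<le> 2 * (c\<^sup>2 * \<delta> * norm x)" by (simp add: \<delta>_def)
    finally show ?thesis by (simp add: M_def mult_ac)
  qed
  moreover have "norm (pw (s / 2) y) \<le> norm (pw ((a + 2) / 2) y) powr t * norm y powr (1 - t)"
  proof -
    have "(s / 2) / ((a + 2) / 2) = t" using a_pos by (simp add: t_def)
    then show ?thesis using interpolation_inequality[of "s/2" "(a + 2) / 2" y] s a_pos by simp
  qed
  ultimately have "norm (pw (s / 2) y) \<le> (\<delta> * M) powr t * M powr (1 - t)"
    using t by (smt (verit) mult_mono powr_mono2 norm_ge_zero powr_ge_zero)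
  also have "\<dots> = \<delta> powr t * M"
  proof (cases "M = 0")
    case False
    then have "0 < M" by (simp add: M_def less_le)
    then have "M powr t * M powr (1 - t) = M" by (simp flip: powr_add)
    then show ?thesis using \<open>0 < M\<close> by (simp add: powr_mult \<delta>_def)
  qed simp
  also have "\<delta> powr t = \<sigma> powr (- s / (2 * (a + 1)))"
  proof -
    have "- (a + 2) / (2 * (a + 1)) * t = - s / (2 * (a + 1)) * ((a + 2) / (a + 2))"
      unfolding t_def by (simp only: times_divide_times_eq minus_mult_minus mult_minus_left mult.commute)
    also have "(a + 2) / (a + 2) = 1" using a_pos by simp
    finally show ?thesis unfolding \<delta>_def powr_powr by simp
  qed
  finally show ?thesis by (simp add: M_def mult_ac)
qed

section \<open>The gain and the iteration in terms of the resolvent of \<open>H\<close>\<close>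

definition resolvent :: "real \<Rightarrow> 'a \<Rightarrow> 'a" where "resolvent al = H.diag (\<lambda>f. 1 / (H.ev f + al))"

lemma bounded_resolvent:
  assumes "0 < al"
  shows "bounded ((\<lambda>f. 1 / (H.ev f + al)) ` F)"
proof -
  have "1 / (H.ev f + al) \<le> 1 / al" for f using assms H.ev_nonneg[of f] by (simp add: frac_le)
  then show ?thesis
    using assms H.ev_nonneg by (auto simp: bounded_iff add_nonneg_pos abs_of_pos intro!: exI[of _ "1/al"])
qed

lemma inner_resolvent: "0 < al \<Longrightarrow> f \<in> F \<Longrightarrow> resolvent al x \<bullet> f = (x \<bullet> f) / (H.ev f + al)"
  by (simp add: resolvent_def H.inner_diag[OF bounded_resolvent])

lemma resolvent_selfadjoint: "0 < al \<Longrightarrow> resolvent al x \<bullet> y = x \<bullet> resolvent al y"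
  by (simp add: resolvent_def H.diag_selfadjoint[OF bounded_resolvent])

lemma H_resolvent:
  assumes "0 < al"
  shows "H (resolvent al x) + al *\<^sub>R resolvent al x = x"
proof (rule H.coords_eqI)
  fix f assume f: "f \<in> F"
  have "0 < H.ev f + al" using H.ev_nonneg[of f] assms by simp
  then show "(H (resolvent al x) + al *\<^sub>R resolvent al x) \<bullet> f = x \<bullet> f"
    using f assms by (simp add: inner_add_left H.inner_T inner_resolvent flip: add_divide_distrib distrib_right)
qed

text \<open>Push-through identity: the inverse moves from the data space to \<open>H + al\<close>,
  which is diagonal in \<open>F\<close>.\<close>

lemma kalman_gain_eq:
  assumes al: "0 < al"
  shows "kalman_gain A T al y = Q (resolvent al (Q (A' y)))"
proof -
  define G where "G z = A (T (A' z)) + al *\<^sub>R z" for z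
  have G_eq: "G z = A (Q (Q (A' z))) + al *\<^sub>R z" for z by (simp add: G_def Q_Q)
  define w where "w = resolvent al (Q (A' y))"
  \<comment> \<open>The equation \<open>G z = y\<close> solved for \<open>z\<close>, anticipating
    \<open>Q (A' z) = w\<close>.\<close>
  define z where "z = (1 / al) *\<^sub>R (y - A (Q w))"
  have Hw: "H w + al *\<^sub>R w = Q (A' y)" unfolding w_def by (rule H_resolvent[OF al])
  have Qz: "Q (A' z) = w"
  proof -
    have "Q (A' z) = (1 / al) *\<^sub>R (Q (A' y) - H w)"
      by (simp add: z_def H_def A'.scaleR A'.diff Q.scaleR Q.diff)
    also have "Q (A' y) - H w = al *\<^sub>R w" by (simp flip: Hw)
    finally show ?thesis using al by simp
  qed
  have Gz: "G z = y"
    using al unfolding G_eq Qz by (simp add: z_def)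
  \<comment> \<open>The gain is built with \<open>inv\<close>, which recovers \<open>z\<close> once
    \<open>G\<close> is injective. Pairing with \<open>d\<close> shows coercivity with constant
    \<open>al\<close>.\<close>
  have inj: "inj G"
  proof (rule injI)
    fix z z' assume "G z = G z'"
    define d where "d = z - z'"
    have "G z - G z' = A (Q (Q (A' d))) + al *\<^sub>R d"
      unfolding G_eq d_def A.diff A'.diff Q.diff scaleR_diff_right by simp
    then have "0 = (A (Q (Q (A' d))) + al *\<^sub>R d) \<bullet> d" using \<open>G z = G z'\<close> by simp
    also have "\<dots> = (norm (Q (A' d)))\<^sup>2 + al * (norm d)\<^sup>2"
      by (simp add: inner_add_left A_adjoint Q_selfadjoint power2_norm_eq_inner)
    finally have "al * (norm d)\<^sup>2 \<le> 0" by (smt (verit) zero_le_power2)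
    then show "z = z'" using al by (simp add: d_def mult_le_0_iff)
  qed
  have "kalman_gain A T al y = T (A' (inv G y))"
    by (simp add: kalman_gain_def adjoint_A G_def[abs_def])
  also have "inv G y = z" using inv_f_f[OF inj, of z] Gz by simp
  also have "T (A' z) = Q w" by (simp only: Qz flip: Q_Q)
  finally show ?thesis by (simp only: w_def)
qed

lemma kalman_gain_inner:
  assumes "0 < al"
  shows "kalman_gain A T al y \<bullet> x = y \<bullet> A (Q (resolvent al (Q x)))"
proof -
  have "Q (resolvent al (Q (A' y))) \<bullet> x = A' y \<bullet> Q (resolvent al (Q x))"
    unfolding Q_selfadjoint[of "resolvent al (Q (A' y))"] resolvent_selfadjoint[OF assms] Q_selfadjoint[of "A' y"] ..
  then show ?thesis by (metis kalman_gain_eq[OF assms] A_adjoint inner_commute)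
qed

lemma adjoint_kalman_gain:
  assumes "0 < al"
  shows "adjoint (kalman_gain A T al) = (\<lambda>x. A (Q (resolvent al (Q x))))"
  by (rule adjoint_unique) (simp add: kalman_gain_inner[OF assms])

text \<open>
  \<open>adj_step al\<close> is the adjoint of \<open>I - K A\<close>, and \<open>adj_iter \<alpha> n\<close> that of the product of the first
  \<open>n\<close> of these.  Tested against \<open>x\<close>, the noise of step \<open>j\<close> enters the \<open>n\<close>-th iterate through
  \<open>test_vector \<alpha> n x j\<close>.
\<close>

definition adj_step :: "real \<Rightarrow> 'a \<Rightarrow> 'a" where
  "adj_step al x = x - A' (A (Q (resolvent al (Q x))))"

primrec adj_iter :: "(nat \<Rightarrow> real) \<Rightarrow> nat \<Rightarrow> 'a \<Rightarrow> 'a" where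
  "adj_iter \<alpha> 0 x = x"
| "adj_iter \<alpha> (Suc n) x = adj_iter \<alpha> n (adj_step (\<alpha> (Suc n)) x)"

primrec test_vector :: "(nat \<Rightarrow> real) \<Rightarrow> nat \<Rightarrow> 'a \<Rightarrow> nat \<Rightarrow> 'b" where
  "test_vector \<alpha> 0 x = (\<lambda>_. 0)"
| "test_vector \<alpha> (Suc n) x =
     (test_vector \<alpha> n (adj_step (\<alpha> (Suc n)) x))(Suc n := A (Q (resolvent (\<alpha> (Suc n)) (Q x))))"

lemma Q_adj_step:
  assumes "0 < al"
  shows "Q (adj_step al x) = H.diag (\<lambda>f. al / (H.ev f + al)) (Q x)"
proof -
  have "Q (adj_step al x) = Q x - H (resolvent al (Q x))" by (simp add: adj_step_def Q.diff H_def)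
  also have "\<dots> = al *\<^sub>R resolvent al (Q x)" using H_resolvent[OF assms, of "Q x"] by (metis add_diff_cancel_left')
  also have "\<dots> = H.diag (\<lambda>f. al / (H.ev f + al)) (Q x)"
  proof (rule H.coords_eqI)
    have b: "bounded ((\<lambda>f. al / (H.ev f + al)) ` F)"
      using H.bounded_mult_image[OF _ bounded_resolvent[OF assms], of "\<lambda>_. al"]
        finite_imp_bounded[OF finite_subset[of "(\<lambda>_. al) ` F" "{al}"]] by auto
    show "(al *\<^sub>R resolvent al (Q x)) \<bullet> f = H.diag (\<lambda>f. al / (H.ev f + al)) (Q x) \<bullet> f" if "f \<in> F" for f
      using that assms by (simp add: inner_resolvent H.inner_diag[OF b])
  qed
  finally show ?thesis .
qed

lemma filter_factor:
  assumes "0 < al"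
  shows "0 \<le> al / (H.ev f + al)" "al / (H.ev f + al) \<le> 1"
  using assms H.ev_nonneg[of f] by (auto simp: divide_le_eq)

section \<open>Variance and bias bounds for a sequence of parameters\<close>

context
  fixes \<alpha> :: "nat \<Rightarrow> real"
  assumes \<alpha>: "\<And>i. 1 \<le> i \<Longrightarrow> 0 < \<alpha> i"
begin

lemma filter_prod:
  "0 \<le> (\<Prod>i=1..n. \<alpha> i / (H.ev f + \<alpha> i))" "(\<Prod>i=1..n. \<alpha> i / (H.ev f + \<alpha> i)) \<le> 1"
  using \<alpha> filter_factor by (auto intro!: prod_nonneg prod_le_1)

lemma Q_adj_iter: "Q (adj_iter \<alpha> n x) = H.diag (\<lambda>f. \<Prod>i=1..n. \<alpha> i / (H.ev f + \<alpha> i)) (Q x)"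
proof (induction n arbitrary: x)
  case 0
  have "bounded ((\<lambda>_. 1 :: real) ` F)" by (rule bounded_unit_image) auto
  then show ?case by (intro H.coords_eqI) (simp add: H.inner_diag)
next
  case (Suc n)
  have b: "bounded ((\<lambda>f. \<alpha> (Suc n) / (H.ev f + \<alpha> (Suc n))) ` F)"
    "bounded ((\<lambda>f. \<Prod>i=1..n. \<alpha> i / (H.ev f + \<alpha> i)) ` F)"
    by (intro bounded_unit_image filter_factor filter_prod \<alpha>; simp)+
  have "Q (adj_iter \<alpha> (Suc n) x)
      = H.diag (\<lambda>f. (\<Prod>i=1..n. \<alpha> i / (H.ev f + \<alpha> i)) * (\<alpha> (Suc n) / (H.ev f + \<alpha> (Suc n)))) (Q x)"
    using \<alpha>[of "Suc n"] by (simp only: adj_iter.simps Suc Q_adj_step H.diag_diag[OF b(2,1)])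
  then show ?case by simp
qed

text \<open>The newest noise contributes at most \<open>1 / (4 * al)\<close> times the squared norm
  of \<open>Q x\<close>. The older terms are bounded by induction at \<open>adj_step al x\<close>,
  whose image under \<open>Q\<close> is no longer than \<open>Q x\<close>.\<close>

lemma test_vector_bound:
  "(\<Sum>j=1..n. (norm (test_vector \<alpha> n x j))\<^sup>2) \<le> (\<Sum>j=1..n. 1 / \<alpha> j) / 4 * (T x \<bullet> x)"
proof (induction n arbitrary: x)
  case (Suc n)
  define al where "al = \<alpha> (Suc n)"
  have al: "0 < al" using \<alpha> by (simp add: al_def)
  have "norm (Q (adj_step al x)) \<le> norm (Q x)"
    unfolding Q_adj_step[OF al]
    using H.diag_norm_le[of 1 "\<lambda>f. al / (H.ev f + al)" "Q x"] filter_factor[OF al]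
    by (simp only: abs_of_nonneg mult_1_left zero_le_one simp_thms)
  then have "T (adj_step al x) \<bullet> adj_step al x \<le> T x \<bullet> x"
    unfolding norm_Q[symmetric] by (simp add: power_mono)
  moreover have "0 \<le> (\<Sum>j=1..n. 1 / \<alpha> j) / 4" by (intro divide_nonneg_nonneg sum_nonneg less_imp_le[OF \<alpha>]) auto
  ultimately have 1: "(\<Sum>j=1..n. (norm (test_vector \<alpha> n (adj_step al x) j))\<^sup>2) \<le> (\<Sum>j=1..n. 1 / \<alpha> j) / 4 * (T x \<bullet> x)"
    by (intro order_trans[OF Suc mult_left_mono])
  have "norm (A (Q (resolvent al (Q x)))) \<le> 1 / (2 * sqrt al) * norm (Q x)"
    unfolding resolvent_def
  proof (rule norm_AQ_diag[OF bounded_resolvent[OF al]])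
    fix f
    have "0 < H.ev f + al" using al H.ev_nonneg[of f] by simp
    \<comment> \<open>Arithmetic-geometric mean inequality; it is an equality where the eigenvalue
      is \<open>al\<close>.\<close>
    moreover have "4 * al * H.ev f \<le> (H.ev f + al)\<^sup>2"
      using sum_squares_bound[of al "H.ev f"] unfolding add.commute[of "H.ev f"] power2_sum by linarith
    ultimately show "H.ev f * (1 / (H.ev f + al))\<^sup>2 \<le> (1 / (2 * sqrt al))\<^sup>2"
      using al by (simp add: power_divide power_mult_distrib divide_le_eq pos_le_divide_eq field_simps)
  qed (use al in simp)
  then have "(norm (A (Q (resolvent al (Q x)))))\<^sup>2 \<le> (1 / (2 * sqrt al) * norm (Q x))\<^sup>2" by (rule power_mono) simp
  then have 2: "(norm (A (Q (resolvent al (Q x)))))\<^sup>2 \<le> (1 / al) / 4 * (T x \<bullet> x)"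
    using al by (simp add: power_mult_distrib power_divide norm_Q)
  have "(\<Sum>j=1..n. (norm (test_vector \<alpha> (Suc n) x j))\<^sup>2) = (\<Sum>j=1..n. (norm (test_vector \<alpha> n (adj_step al x) j))\<^sup>2)"
    by (intro sum.cong) (auto simp: al_def)
  then show ?case using 1 2 by (simp add: al_def add_divide_distrib distrib_right)
qed simp

text \<open>The source condition shifts \<open>pw (s / 2)\<close> onto the adjoint iterate, to which
  the interpolated filter estimate applies.\<close>

lemma bias_bound:
  assumes n: "1 \<le> n" and s: "0 \<le> s" "s \<le> a + 2" and w: "x0 = pw (s / 2) w"
  shows "x0 \<bullet> adj_iter \<alpha> n x
    \<le> 2 * c\<^sup>2 * norm w * (\<Sum>j=1..n. 1 / \<alpha> j) powr (- s / (2 * (a + 1))) * norm x"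
proof -
  let ?\<sigma> = "\<Sum>j=1..n. 1 / \<alpha> j"
  have \<sigma>: "0 < ?\<sigma>" using n \<alpha> by (intro sum_pos) auto
  have "norm (pw (s / 2) (adj_iter \<alpha> n x)) \<le> 2 * c\<^sup>2 * ?\<sigma> powr (- s / (2 * (a + 1))) * norm x"
  proof (rule adjoint_interpolated[OF filter_prod \<sigma> _ Q_adj_iter s])
    fix f
    let ?p = "\<Prod>i=1..n. \<alpha> i / (H.ev f + \<alpha> i)"
    have "(1 + ?\<sigma> * H.ev f) * ?p \<le> 1" using \<alpha> H.ev_nonneg by (rule prod_resolvent_bound)
    \<comment> \<open>The nonnegative summand \<open>?p\<close> of the expanded product is
      dropped.\<close>
    then have "?\<sigma> * (H.ev f * ?p) \<le> 1" using filter_prod(1)[of f n] by (simp add: algebra_simps)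
    then show "H.ev f * ?p \<le> 1 / ?\<sigma>" using \<sigma> by (simp add: pos_le_divide_eq mult.commute)
  qed
  then have "norm w * norm (pw (s / 2) (adj_iter \<alpha> n x))
      \<le> norm w * (2 * c\<^sup>2 * ?\<sigma> powr (- s / (2 * (a + 1))) * norm x)" by (rule mult_left_mono) simp
  moreover have "x0 \<bullet> adj_iter \<alpha> n x = w \<bullet> pw (s / 2) (adj_iter \<alpha> n x)"
    unfolding w using s by (intro pw_selfadjoint) simp
  ultimately show ?thesis using norm_cauchy_schwarz[of w "pw (s / 2) (adj_iter \<alpha> n x)"] by (simp add: mult_ac)
qed

end

end


section \<open>White noise\<close>

lemma white_noise_zero:
  assumes "white_noise M \<gamma> \<eta>"
  shows "AE \<omega> in M. \<eta> 0 \<omega> = 0"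
proof -
  \<comment> \<open>Linearity at the zero vectors reads
    \<open>\<eta> 0 = 2 * \<eta> 0\<close>.\<close>
  have "AE \<omega> in M. \<eta> (1 *\<^sub>R 0 + 0) \<omega> = 1 * \<eta> 0 \<omega> + \<eta> 0 \<omega>"
    using assms unfolding white_noise_def by blast
  then show ?thesis by eventually_elim simp
qed

lemma white_noise_moments:
  assumes wn: "white_noise M \<gamma> \<eta>" and \<gamma>: "0 < \<gamma>"
  shows "integrable M (\<eta> z)" "(\<integral>\<omega>. \<eta> z \<omega> \<partial>M) = 0"
    "integrable M (\<lambda>\<omega>. (\<eta> z \<omega>)\<^sup>2)" "(\<integral>\<omega>. (\<eta> z \<omega>)\<^sup>2 \<partial>M) = \<gamma>\<^sup>2 * (norm z)\<^sup>2"
proof -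
  have meas[measurable]: "\<eta> z \<in> borel_measurable M" using wn by (simp add: white_noise_def)
  have "integrable M (\<eta> z) \<and> (\<integral>\<omega>. \<eta> z \<omega> \<partial>M) = 0 \<and>
    integrable M (\<lambda>\<omega>. (\<eta> z \<omega>)\<^sup>2) \<and> (\<integral>\<omega>. (\<eta> z \<omega>)\<^sup>2 \<partial>M) = \<gamma>\<^sup>2 * (norm z)\<^sup>2"
  proof (cases "z = 0")
    case True
    \<comment> \<open>At \<open>z = 0\<close> the law is a point mass without a density, so the
      moments come from almost sure vanishing.\<close>
    have ae: "AE \<omega> in M. \<eta> z \<omega> = 0" "AE \<omega> in M. (\<eta> z \<omega>)\<^sup>2 = 0"
      using white_noise_zero[OF wn] True by auto
    have "integrable M (\<eta> z) \<longleftrightarrow> integrable M (\<lambda>_. 0 :: real)" using ae by (intro integrable_cong_AE) auto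
    moreover have "integral\<^sup>L M (\<eta> z) = integral\<^sup>L M (\<lambda>_. 0)" using ae by (intro integral_cong_AE) auto
    moreover have "integrable M (\<lambda>\<omega>. (\<eta> z \<omega>)\<^sup>2) \<longleftrightarrow> integrable M (\<lambda>_. 0 :: real)"
      using ae by (intro integrable_cong_AE) auto
    moreover have "(\<integral>\<omega>. (\<eta> z \<omega>)\<^sup>2 \<partial>M) = integral\<^sup>L M (\<lambda>_. 0)" using ae by (intro integral_cong_AE) auto
    ultimately show ?thesis using True by simp
  next
    case False
    define s where "s = \<gamma> * norm z"
    have s: "0 < s" using \<gamma> False by (simp add: s_def)
    have D: "distributed M lborel (\<eta> z) (\<lambda>t. ennreal (normal_density 0 s t))"
      using wn False by (simp add: white_noise_def s_def)
    have "integrable lborel (\<lambda>x. normal_density 0 s x * x)"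
      using integrable_normal_moment[OF s, of 0 1] by simp
    then have 1: "integrable M (\<eta> z)"
      using distributed_integrable[OF D, of "\<lambda>x. x"] by simp
    have 2: "(\<integral>\<omega>. \<eta> z \<omega> \<partial>M) = 0"
      using distributed_integral[OF D, of "\<lambda>x. x"] integral_normal_moment_odd[OF s, of 0 0] by simp
    have "integrable lborel (\<lambda>x. normal_density 0 s x * x\<^sup>2)"
      using integrable_normal_moment[OF s, of 0 2] by simp
    then have 3: "integrable M (\<lambda>\<omega>. (\<eta> z \<omega>)\<^sup>2)"
      using distributed_integrable[OF D, of "\<lambda>x. x\<^sup>2"] by simp
    have 4: "(\<integral>\<omega>. (\<eta> z \<omega>)\<^sup>2 \<partial>M) = s\<^sup>2"
      using distributed_integral[OF D, of "\<lambda>x. x\<^sup>2"] integral_normal_moment_even[OF s, of 0 1] by simp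
    show ?thesis using 1 2 3 4 by (simp add: s_def power_mult_distrib)
  qed
  then show "integrable M (\<eta> z)" "(\<integral>\<omega>. \<eta> z \<omega> \<partial>M) = 0"
    "integrable M (\<lambda>\<omega>. (\<eta> z \<omega>)\<^sup>2)" "(\<integral>\<omega>. (\<eta> z \<omega>)\<^sup>2 \<partial>M) = \<gamma>\<^sup>2 * (norm z)\<^sup>2" by auto
qed

text \<open>In the expanded square, independence and zero means remove the mixed terms.\<close>

lemma (in prob_space) second_moment_indep_sum:
  fixes X :: "'i \<Rightarrow> 'a \<Rightarrow> real"
  assumes I: "finite I" and ind: "indep_vars (\<lambda>_. borel) X I"
    and int: "\<And>i. i \<in> I \<Longrightarrow> integrable M (X i)" "\<And>i. i \<in> I \<Longrightarrow> integrable M (\<lambda>\<omega>. (X i \<omega>)\<^sup>2)"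
    and mean: "\<And>i. i \<in> I \<Longrightarrow> expectation (X i) = 0"
  shows "integrable M (\<lambda>\<omega>. (\<Sum>i\<in>I. X i \<omega>)\<^sup>2)"
    "expectation (\<lambda>\<omega>. (\<Sum>i\<in>I. X i \<omega>)\<^sup>2) = (\<Sum>i\<in>I. expectation (\<lambda>\<omega>. (X i \<omega>)\<^sup>2))"
proof -
  have sq: "(\<Sum>i\<in>I. X i \<omega>)\<^sup>2 = (\<Sum>i\<in>I. \<Sum>j\<in>I. X i \<omega> * X j \<omega>)" for \<omega>
    by (simp add: power2_eq_square sum_product)
  have prod: "integrable M (\<lambda>\<omega>. X i \<omega> * X j \<omega>) \<and>
      expectation (\<lambda>\<omega>. X i \<omega> * X j \<omega>) = (if i = j then expectation (\<lambda>\<omega>. (X i \<omega>)\<^sup>2) else 0)"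
    if ij: "i \<in> I" "j \<in> I" for i j
  proof (cases "i = j")
    case True
    then show ?thesis using int(2)[OF ij(1)] by (simp add: power2_eq_square)
  next
    case False
    have "indep_vars (\<lambda>_. borel) X {i, j}" using ind ij by (auto intro: indep_vars_subset)
    from indep_vars_integrable[OF _ this] indep_vars_lebesgue_integral[OF _ this]
    show ?thesis using int(1) ij mean False by auto
  qed
  show "integrable M (\<lambda>\<omega>. (\<Sum>i\<in>I. X i \<omega>)\<^sup>2)"
    unfolding sq by (intro Bochner_Integration.integrable_sum) (use prod in blast)
  have "expectation (\<lambda>\<omega>. (\<Sum>i\<in>I. X i \<omega>)\<^sup>2) = (\<Sum>i\<in>I. \<Sum>j\<in>I. expectation (\<lambda>\<omega>. X i \<omega> * X j \<omega>))"
    unfolding sq using prod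
    by (subst Bochner_Integration.integral_sum)
       (auto intro!: Bochner_Integration.integrable_sum sum.cong Bochner_Integration.integral_sum)
  also have "\<dots> = (\<Sum>i\<in>I. \<Sum>j\<in>I. if i = j then expectation (\<lambda>\<omega>. (X i \<omega>)\<^sup>2) else 0)"
    using prod by (intro sum.cong) auto
  finally show "expectation (\<lambda>\<omega>. (\<Sum>i\<in>I. X i \<omega>)\<^sup>2) = (\<Sum>i\<in>I. expectation (\<lambda>\<omega>. (X i \<omega>)\<^sup>2))"
    using I by simp
qed

text \<open>Turns a sum over a basis into an integral over the counting measure, so that Tonelli's
  theorem can exchange it with the expectation.\<close>

lemma nn_integral_count_space_infsum:
  fixes f :: "'i \<Rightarrow> real"
  assumes "f summable_on G" "\<And>i. i \<in> G \<Longrightarrow> 0 \<le> f i"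
  shows "(\<integral>\<^sup>+i. ennreal (f i) \<partial>count_space G) = ennreal (infsum f G)"
proof -
  have "Infinite_Set_Sum.abs_summable_on f G"
    using assms(1) summable_on_iff_abs_summable_on_real abs_summable_equivalent by blast
  then show ?thesis using assms(2) by (simp add: nn_integral_conv_infsetsum infsetsum_infsum)
qed


section \<open>The mean square error\<close>

context hilbert_scale
begin

text \<open>The double series of the squares of \<open>Q g \<bullet> f\<close> is symmetric in the
  two systems, and Bessel for \<open>G\<close> bounds it by the sum over \<open>F\<close>. This
  makes the basis picked inside \<open>op_trace\<close> admissible.\<close>

lemma trace_summable:
  assumes "orthonormal_basis F" "(\<lambda>e. T e \<bullet> e) summable_on F" "orthonormal G"
  shows "(\<lambda>e. T e \<bullet> e) summable_on G"
proof (rule nonneg_bounded_sums_summable)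
  interpret F: onb F by (simp add: onb.intro assms)
  fix G' assume G': "finite G'" "G' \<subseteq> G"
  have "((\<lambda>f. \<Sum>g\<in>G'. (Q g \<bullet> f)\<^sup>2) has_sum (\<Sum>g\<in>G'. T g \<bullet> g)) F"
    unfolding norm_Q[symmetric] using G'(1)
    by (induction G') (auto intro!: has_sum_add F.parseval_norm)
  moreover have "((\<lambda>f. T f \<bullet> f) has_sum infsum (\<lambda>f. T f \<bullet> f) F) F"
    by (rule has_sum_infsum[OF assms(2)])
  moreover have "(\<Sum>g\<in>G'. (Q g \<bullet> f)\<^sup>2) \<le> T f \<bullet> f" for f
  proof -
    have "Q g \<bullet> f = Q f \<bullet> g" for g by (metis Q_selfadjoint inner_commute)
    then show ?thesis using bessel_finite[OF assms(3) G', of "Q f"] by (simp add: norm_Q)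
  qed
  ultimately show "(\<Sum>g\<in>G'. T g \<bullet> g) \<le> infsum (\<lambda>f. T f \<bullet> f) F" by (rule has_sum_mono)
qed (rule psa_nonneg[OF psa])

text \<open>Strict positivity later makes every orthonormal basis countable.\<close>

lemma T_positive:
  assumes "x \<noteq> 0"
  shows "0 < T x \<bullet> x"
proof -
  have "T x \<bullet> x \<noteq> 0"
  proof
    assume "T x \<bullet> x = 0"
    then have 0: "Q x = 0" by (simp flip: norm_Q)
    have "x = 0"
    proof (rule coords_eqI)
      fix e assume e: "e \<in> E"
      show "x \<bullet> e = 0 \<bullet> e" using inner_pw[of "1/2" e x] 0 e ev_pos[OF e] by simp
    qed
    then show False using assms by simp
  qed
  then show ?thesis using psa_nonneg[OF psa, of x] by simp
qed

end

section \<open>Bias and noise of the iterates\<close>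

context diagonalised_scale
begin

text \<open>The error of the iteration with exact data, that is, the bias.\<close>

primrec mean_error :: "(nat \<Rightarrow> real) \<Rightarrow> 'a \<Rightarrow> nat \<Rightarrow> 'a" where
  "mean_error \<alpha> x0 0 = x0"
| "mean_error \<alpha> x0 (Suc n) = mean_error \<alpha> x0 n - kalman_gain A T (\<alpha> (Suc n)) (A (mean_error \<alpha> x0 n))"

context
  fixes \<alpha> :: "nat \<Rightarrow> real"
  assumes \<alpha>: "\<And>i. 1 \<le> i \<Longrightarrow> 0 < \<alpha> i"
begin

lemma mean_error_inner: "mean_error \<alpha> x0 n \<bullet> x = x0 \<bullet> adj_iter \<alpha> n x"
proof (induction n arbitrary: x)
  case (Suc n)
  have "mean_error \<alpha> x0 (Suc n) \<bullet> x = mean_error \<alpha> x0 n \<bullet> adj_step (\<alpha> (Suc n)) x"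
    by (simp add: inner_diff_left kalman_gain_inner \<alpha> A_adjoint adj_step_def inner_diff_right)
  then show ?case using Suc by simp
qed simp

lemma mean_error_bound:
  assumes n: "1 \<le> n" and s: "0 \<le> s" "s \<le> a + 2" and w: "x0 = pw (s / 2) w"
  shows "(norm (mean_error \<alpha> x0 n))\<^sup>2 \<le> 4 * c ^ 4 * (norm w)\<^sup>2 * (\<Sum>j=1..n. 1 / \<alpha> j) powr (- s / (a + 1))"
proof -
  let ?\<sigma> = "\<Sum>j=1..n. 1 / \<alpha> j"
  define m where "m = mean_error \<alpha> x0 n"
  define B where "B = 2 * c\<^sup>2 * norm w * ?\<sigma> powr (- s / (2 * (a + 1)))"
  \<comment> \<open>The bound on inner products becomes a norm bound when \<open>m\<close> is tested
    against itself.\<close>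
  have "norm m * norm m = x0 \<bullet> adj_iter \<alpha> n m"
    unfolding mean_error_inner[symmetric] m_def[symmetric]
    by (simp flip: power2_eq_square power2_norm_eq_inner)
  also have "\<dots> \<le> B * norm m" unfolding B_def by (rule bias_bound[OF \<alpha> n s w])
  finally have "norm m \<le> B" by (cases "norm m = 0") (auto simp: B_def)
  then have "(norm m)\<^sup>2 \<le> B\<^sup>2" by (rule power_mono) simp
  also have "\<dots> = 4 * c ^ 4 * (norm w)\<^sup>2 * (?\<sigma> powr (- s / (2 * (a + 1))))\<^sup>2"
    unfolding B_def by (simp add: power_mult_distrib flip: power_mult)
  also have "(?\<sigma> powr (- s / (2 * (a + 1))))\<^sup>2 = ?\<sigma> powr (- s / (a + 1))"
  proof -
    have "r / (2 * k) + r / (2 * k) = r / k" for r k :: real by (cases "k = 0") (auto simp: field_simps)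
    then have "- s / (2 * (a + 1)) + - s / (2 * (a + 1)) = - s / (a + 1)" .
    then show ?thesis unfolding power2_eq_square powr_add[symmetric] by (simp only:)
  qed
  finally show ?thesis by (simp add: m_def)
qed

context
  fixes M :: "'w measure" and \<gamma> :: real and u v0 :: 'a and y \<eta> :: "nat \<Rightarrow> 'b \<Rightarrow> 'w \<Rightarrow> real"
    and v :: "nat \<Rightarrow> 'w \<Rightarrow> 'a"
  assumes M: "prob_space M" and \<gamma>: "0 < \<gamma>"
    and noise: "\<And>n. 1 \<le> n \<Longrightarrow> white_noise M \<gamma> (\<eta> n)"
    and indep: "prob_space.indep_vars M (\<lambda>_. \<Pi>\<^sub>M z\<in>UNIV. borel) (\<lambda>n \<omega> z. \<eta> n z \<omega>) {1..}"
    and y: "\<And>n z \<omega>. 1 \<le> n \<Longrightarrow> y n z \<omega> = A u \<bullet> z + \<eta> n z \<omega>"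
    and v: "variant_3DVAR M A T \<alpha> v0 y v"
begin

interpretation prob_space M by (rule M)

text \<open>The newest noise meets the test vector \<open>k\<close>, and the previous error meets
  \<open>adj_step al x\<close>, hence the induction for all \<open>x\<close>. The null set may
  depend on \<open>x\<close>, so the formula is later used for one basis vector at a time.\<close>

lemma error_inner:
  "AE \<omega> in M. (v n \<omega> - u - mean_error \<alpha> (v0 - u) n) \<bullet> x = (\<Sum>j=1..n. \<eta> j (test_vector \<alpha> n x j) \<omega>)"
proof (induction n arbitrary: x)
  case 0
  then show ?case using v by (simp add: variant_3DVAR_def)
next
  case (Suc n)
  define al where "al = \<alpha> (Suc n)"
  have al: "0 < al" using \<alpha> by (simp add: al_def)
  define k where "k = A (Q (resolvent al (Q x)))"
  have "\<forall>n\<ge>1. image_of_generalised M (kalman_gain A T (\<alpha> n))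
      (\<lambda>z \<omega>. y n z \<omega> - A (v (n - 1) \<omega>) \<bullet> z) (\<lambda>\<omega>. v n \<omega> - v (n - 1) \<omega>)"
    using v unfolding variant_3DVAR_def by blast
  then have "image_of_generalised M (kalman_gain A T (\<alpha> (Suc n)))
      (\<lambda>z \<omega>. y (Suc n) z \<omega> - A (v (Suc n - 1) \<omega>) \<bullet> z) (\<lambda>\<omega>. v (Suc n) \<omega> - v (Suc n - 1) \<omega>)"
    by (elim allE[where x="Suc n"]) simp
  then have "AE \<omega> in M. (v (Suc n) \<omega> - v n \<omega>) \<bullet> x = y (Suc n) k \<omega> - A (v n \<omega>) \<bullet> k"
    unfolding image_of_generalised_def adjoint_kalman_gain[OF al[unfolded al_def]]
    by (simp add: k_def al_def)
  moreover note Suc[of "adj_step al x"]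
  ultimately show ?case
  proof eventually_elim
    case (elim \<omega>)
    define m where "m = mean_error \<alpha> (v0 - u) n"
    have m: "mean_error \<alpha> (v0 - u) (Suc n) \<bullet> x = m \<bullet> x - A m \<bullet> k"
      by (simp add: m_def inner_diff_left kalman_gain_inner[OF al, unfolded al_def] k_def al_def)
    have "(v (Suc n) \<omega> - u - mean_error \<alpha> (v0 - u) (Suc n)) \<bullet> x
        = (v n \<omega> - u - m) \<bullet> x + (v (Suc n) \<omega> - v n \<omega>) \<bullet> x + A m \<bullet> k"
      unfolding inner_diff_left m by simp
    also have "\<dots> = (v n \<omega> - u - m) \<bullet> x - A (v n \<omega> - u - m) \<bullet> k + \<eta> (Suc n) k \<omega>"
      using elim(1) by (simp add: y A.diff inner_diff_left)
    also have "(v n \<omega> - u - m) \<bullet> x - A (v n \<omega> - u - m) \<bullet> k = (v n \<omega> - u - m) \<bullet> adj_step al x"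
      by (simp add: adj_step_def inner_diff_right A_adjoint k_def)
    also have "\<dots> = (\<Sum>j=1..n. \<eta> j (test_vector \<alpha> n (adj_step al x) j) \<omega>)"
      using elim(2) by (simp add: m_def)
    also have "\<dots> = (\<Sum>j=1..n. \<eta> j (test_vector \<alpha> (Suc n) x j) \<omega>)"
      by (intro sum.cong) (auto simp: al_def)
    finally show ?case by (simp add: k_def al_def)
  qed
qed

lemma noise_second_moment:
  "integrable M (\<lambda>\<omega>. (\<Sum>j=1..n. \<eta> j (z j) \<omega>)\<^sup>2)"
  "expectation (\<lambda>\<omega>. (\<Sum>j=1..n. \<eta> j (z j) \<omega>)\<^sup>2) = \<gamma>\<^sup>2 * (\<Sum>j=1..n. (norm (z j))\<^sup>2)"
proof -
  have "indep_vars (\<lambda>_. \<Pi>\<^sub>M z\<in>UNIV. borel) (\<lambda>n \<omega> z. \<eta> n z \<omega>) {1..n}"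
    by (rule indep_vars_subset[OF indep]) auto
  \<comment> \<open>Independence of the whole processes passes to their evaluations at the
    deterministic vectors \<open>z j\<close>.\<close>
  then have ind: "indep_vars (\<lambda>_. borel) (\<lambda>j \<omega>. \<eta> j (z j) \<omega>) {1..n}"
    using indep_vars_compose2[where Y="\<lambda>j f. f (z j)" and N="\<lambda>_. borel"] by fastforce
  note mom = white_noise_moments[OF noise \<gamma>]
  show "integrable M (\<lambda>\<omega>. (\<Sum>j=1..n. \<eta> j (z j) \<omega>)\<^sup>2)"
    by (rule second_moment_indep_sum(1)[OF _ ind]) (auto intro: mom)
  have "expectation (\<lambda>\<omega>. (\<Sum>j=1..n. \<eta> j (z j) \<omega>)\<^sup>2) = (\<Sum>j=1..n. expectation (\<lambda>\<omega>. (\<eta> j (z j) \<omega>)\<^sup>2))"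
    by (rule second_moment_indep_sum(2)[OF _ ind]) (auto intro: mom)
  also have "\<dots> = (\<Sum>j=1..n. \<gamma>\<^sup>2 * (norm (z j))\<^sup>2)" by (intro sum.cong) (auto simp: mom)
  finally show "expectation (\<lambda>\<omega>. (\<Sum>j=1..n. \<eta> j (z j) \<omega>)\<^sup>2) = \<gamma>\<^sup>2 * (\<Sum>j=1..n. (norm (z j))\<^sup>2)"
    by (simp add: sum_distrib_left)
qed

lemma v_measurable: "v n \<in> borel_measurable M"
  using v by (simp add: variant_3DVAR_def)

text \<open>Parseval splits the squared norm into coordinates. Their second moments are bounded
  separately, and the bounds add up to a trace.\<close>

lemma variance_bound:
  assumes G: "orthonormal_basis G" "(\<lambda>e. T e \<bullet> e) summable_on G"
  shows "(\<integral>\<^sup>+\<omega>. ennreal ((norm (v n \<omega> - u - mean_error \<alpha> (v0 - u) n))\<^sup>2) \<partial>M)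
    \<le> ennreal (\<gamma>\<^sup>2 * (\<Sum>j=1..n. 1 / \<alpha> j) / 4 * infsum (\<lambda>e. T e \<bullet> e) G)"
proof -
  interpret G: onb G by (rule onb.intro[OF G(1)])
  define d where "d \<omega> = v n \<omega> - u - mean_error \<alpha> (v0 - u) n" for \<omega>
  define C where "C = \<gamma>\<^sup>2 * (\<Sum>j=1..n. 1 / \<alpha> j) / 4"
  have C: "0 \<le> C" unfolding C_def by (intro divide_nonneg_nonneg mult_nonneg_nonneg sum_nonneg less_imp_le[OF \<alpha>]) auto
  have d_meas: "(\<lambda>\<omega>. ennreal ((d \<omega> \<bullet> e)\<^sup>2)) \<in> borel_measurable M" for e
  proof -
    have "(\<lambda>x. (x - u - mean_error \<alpha> (v0 - u) n) \<bullet> e) \<in> borel_measurable borel"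
      by (intro borel_measurable_continuous_onI continuous_intros)
    from measurable_compose[OF v_measurable this]
    have "(\<lambda>\<omega>. d \<omega> \<bullet> e) \<in> borel_measurable M" by (simp add: d_def)
    then show ?thesis by measurable
  qed
  \<comment> \<open>A summable family has countable support, and here every term is nonzero.
    Countability is what the exchange of sum and expectation below asks for.\<close>
  have "countable G"
  proof -
    have "T e \<bullet> e \<noteq> 0" if "e \<in> G" for e
      using T_positive[of e] orthonormal_inner[OF G.orthonormal that that] by fastforce
    then have "{e \<in> G. T e \<bullet> e \<noteq> 0} = G" by blast
    then show ?thesis using summable_countable_real[OF G(2)] by simp
  qed
  have "(\<integral>\<^sup>+\<omega>. ennreal ((norm (d \<omega>))\<^sup>2) \<partial>M) = (\<integral>\<^sup>+\<omega>. \<integral>\<^sup>+e. ennreal ((d \<omega> \<bullet> e)\<^sup>2) \<partial>count_space G \<partial>M)"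
  proof (intro nn_integral_cong)
    fix \<omega>
    show "ennreal ((norm (d \<omega>))\<^sup>2) = (\<integral>\<^sup>+e. ennreal ((d \<omega> \<bullet> e)\<^sup>2) \<partial>count_space G)"
      using nn_integral_count_space_infsum[OF bessel(1)[OF G.orthonormal]] infsumI[OF G.parseval_norm]
      by simp
  qed
  also have "\<dots> = (\<integral>\<^sup>+e. \<integral>\<^sup>+\<omega>. ennreal ((d \<omega> \<bullet> e)\<^sup>2) \<partial>M \<partial>count_space G)"
    using \<open>countable G\<close> d_meas by (rule nn_integral_count_space_nn_integral)
  also have "\<dots> \<le> (\<integral>\<^sup>+e. ennreal (C * (T e \<bullet> e)) \<partial>count_space G)"
  proof (rule nn_integral_mono)
    fix e
    let ?z = "test_vector \<alpha> n e"
    have "(\<integral>\<^sup>+\<omega>. ennreal ((d \<omega> \<bullet> e)\<^sup>2) \<partial>M) = (\<integral>\<^sup>+\<omega>. ennreal ((\<Sum>j=1..n. \<eta> j (?z j) \<omega>)\<^sup>2) \<partial>M)"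
      using error_inner[of n e] by (intro nn_integral_cong_AE) (auto simp: d_def elim: eventually_mono)
    also have "\<dots> = ennreal (\<gamma>\<^sup>2 * (\<Sum>j=1..n. (norm (?z j))\<^sup>2))"
      unfolding noise_second_moment(2)[symmetric]
      by (rule nn_integral_eq_integral[OF noise_second_moment(1)]) simp
    also have "\<dots> \<le> ennreal (C * (T e \<bullet> e))"
    proof (rule ennreal_leI)
      have "(\<Sum>j=1..n. (norm (?z j))\<^sup>2) \<le> (\<Sum>j=1..n. 1 / \<alpha> j) / 4 * (T e \<bullet> e)"
        using \<alpha> by (rule test_vector_bound)
      then have "\<gamma>\<^sup>2 * (\<Sum>j=1..n. (norm (?z j))\<^sup>2) \<le> \<gamma>\<^sup>2 * ((\<Sum>j=1..n. 1 / \<alpha> j) / 4 * (T e \<bullet> e))"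
        by (rule mult_left_mono) simp
      then show "\<gamma>\<^sup>2 * (\<Sum>j=1..n. (norm (?z j))\<^sup>2) \<le> C * (T e \<bullet> e)" by (simp add: C_def mult.assoc)
    qed
    finally show "(\<integral>\<^sup>+\<omega>. ennreal ((d \<omega> \<bullet> e)\<^sup>2) \<partial>M) \<le> ennreal (C * (T e \<bullet> e))" .
  qed
  also have "\<dots> = ennreal (infsum (\<lambda>e. C * (T e \<bullet> e)) G)"
    using C psa_nonneg[OF psa] by (intro nn_integral_count_space_infsum summable_on_cmult_right G(2)) auto
  also have "infsum (\<lambda>e. C * (T e \<bullet> e)) G = C * infsum (\<lambda>e. T e \<bullet> e) G"
    by (rule infsum_cmult_right[OF G(2)])
  finally show ?thesis by (simp add: d_def C_def)
qed

text \<open>Bias and noise are separated by bounding the square of a sum by twice the sum of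
  squares. This doubles the bias constant 4 to 8, while the factor 1/4 of the variance leaves
  room.\<close>

lemma mean_square_error:
  assumes n: "1 \<le> n" and s: "0 \<le> s" "s \<le> a + 2" and w: "v0 - u = pw (s / 2) w"
    and G: "orthonormal_basis G" "(\<lambda>e. T e \<bullet> e) summable_on G"
  shows "integrable M (\<lambda>\<omega>. (norm (v n \<omega> - u))\<^sup>2) \<and>
    expectation (\<lambda>\<omega>. (norm (v n \<omega> - u))\<^sup>2)
      \<le> 8 * c ^ 4 * (norm w)\<^sup>2 * (\<Sum>j=1..n. 1 / \<alpha> j) powr (- s / (a + 1))
        + \<gamma>\<^sup>2 * infsum (\<lambda>e. T e \<bullet> e) G * (\<Sum>j=1..n. 1 / \<alpha> j)"
proof -
  let ?\<sigma> = "\<Sum>j=1..n. 1 / \<alpha> j"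
  define m where "m = mean_error \<alpha> (v0 - u) n"
  define b where "b = 4 * c ^ 4 * (norm w)\<^sup>2 * ?\<sigma> powr (- s / (a + 1))"
  define t where "t = infsum (\<lambda>e. T e \<bullet> e) G"
  define V where "V = \<gamma>\<^sup>2 * ?\<sigma> / 4 * t"
  have t: "0 \<le> t" unfolding t_def using psa_nonneg[OF psa] by (intro infsum_nonneg) auto
  have \<sigma>: "0 \<le> ?\<sigma>" using \<alpha> by (intro sum_nonneg) (auto simp: less_imp_le)
  have V: "0 \<le> V" using t \<sigma> by (simp add: V_def)
  have b: "0 \<le> b" by (simp add: b_def)
  have mb: "(norm m)\<^sup>2 \<le> b" unfolding m_def b_def by (rule mean_error_bound[OF n s w])
  have meas: "(\<lambda>\<omega>. norm (v n \<omega> - x)) \<in> borel_measurable M" for x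
  proof -
    have "(\<lambda>z. norm (z - x)) \<in> borel_measurable borel"
      by (intro borel_measurable_continuous_onI continuous_intros)
    from measurable_compose[OF v_measurable this] show ?thesis .
  qed
  have [measurable]: "(\<lambda>\<omega>. norm (v n \<omega> - u)) \<in> borel_measurable M"
    "(\<lambda>\<omega>. norm (v n \<omega> - u - m)) \<in> borel_measurable M"
    using meas[of u] meas[of "u + m"] by (simp_all add: diff_diff_eq)
  have "(norm (v n \<omega> - u))\<^sup>2 \<le> 2 * b + 2 * (norm (v n \<omega> - u - m))\<^sup>2" for \<omega>
  proof -
    have "norm (v n \<omega> - u) \<le> norm m + norm (v n \<omega> - u - m)"
      using norm_triangle_ineq[of m "v n \<omega> - u - m"] by simp
    then have "(norm (v n \<omega> - u))\<^sup>2 \<le> (norm m + norm (v n \<omega> - u - m))\<^sup>2" by (rule power_mono) simp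
    also have "\<dots> \<le> 2 * (norm m)\<^sup>2 + 2 * (norm (v n \<omega> - u - m))\<^sup>2"
      using sum_squares_bound[of "norm m" "norm (v n \<omega> - u - m)"] by (simp add: power2_sum)
    finally show ?thesis using mb by simp
  qed
  \<comment> \<open>Working with the nonnegative integral yields integrability and the bound on the
    expectation from one finite value.\<close>
  then have "(\<integral>\<^sup>+\<omega>. ennreal ((norm (v n \<omega> - u))\<^sup>2) \<partial>M)
      \<le> (\<integral>\<^sup>+\<omega>. ennreal (2 * b) + 2 * ennreal ((norm (v n \<omega> - u - m))\<^sup>2) \<partial>M)"
    using b by (intro nn_integral_mono) (simp add: ennreal_leI flip: ennreal_plus ennreal_numeral ennreal_mult)
  also have "\<dots> = ennreal (2 * b) + 2 * (\<integral>\<^sup>+\<omega>. ennreal ((norm (v n \<omega> - u - m))\<^sup>2) \<partial>M)"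
    by (simp add: nn_integral_add nn_integral_cmult emeasure_space_1)
  also have "\<dots> \<le> ennreal (2 * b) + 2 * ennreal V"
    using variance_bound[OF G, of n] unfolding m_def V_def t_def by (intro add_left_mono mult_left_mono) auto
  also have "\<dots> = ennreal (2 * b + 2 * V)"
    using b V by (simp flip: ennreal_plus ennreal_numeral ennreal_mult)
  finally have *: "(\<integral>\<^sup>+\<omega>. ennreal ((norm (v n \<omega> - u))\<^sup>2) \<partial>M) \<le> ennreal (2 * b + 2 * V)" .
  then have "integrable M (\<lambda>\<omega>. (norm (v n \<omega> - u))\<^sup>2)"
    by (intro integrableI_bounded) (auto simp: le_less_trans)
  moreover have "expectation (\<lambda>\<omega>. (norm (v n \<omega> - u))\<^sup>2) \<le> 2 * b + 2 * V"
    using * b V by (intro integral_real_bounded) auto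
  moreover have "2 * V \<le> \<gamma>\<^sup>2 * t * ?\<sigma>"
  proof -
    have "2 * V = \<gamma>\<^sup>2 * t * ?\<sigma> / 2" by (simp add: V_def)
    moreover have "0 \<le> \<gamma>\<^sup>2 * t * ?\<sigma>" using t \<sigma> by simp
    ultimately show ?thesis by simp
  qed
  ultimately show ?thesis by (simp add: b_def t_def)
qed

end

end

end

section \<open>From the standing assumption to the two rates\<close>

lemma compact_operator_bounded_linear:
  assumes "compact_operator A"
  shows "bounded_linear A"
proof -
  have lin: "linear A" using assms by (simp add: compact_operator_def)
  have "compact (closure (A ` cball 0 1))" using assms bounded_cball by (simp add: compact_operator_def)
  then have "bounded (A ` cball 0 1)" using compact_imp_bounded bounded_subset closure_subset by blast
  then obtain K where "\<forall>y\<in>A ` cball 0 1. norm y \<le> K" by (auto simp: bounded_iff)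
  then have K: "norm (A x) \<le> K" if "norm x \<le> 1" for x using that by simp
  have "norm (A x) \<le> norm x * K" for x
  proof (cases "x = 0")
    case False
    then have "norm (A ((1 / norm x) *\<^sub>R x)) \<le> K" by (intro K) simp
    then show ?thesis using False by (simp add: linear_cmul[OF lin] pos_divide_le_eq mult.commute)
  qed (simp add: linear_0[OF lin])
  then show ?thesis using lin by (intro bounded_linear_intro) (auto simp: linear_add linear_cmul)
qed

text \<open>The constant comes from \<open>c\<close> and the source element \<open>w\<close> alone,
  so it is uniform in the parameters \<open>\<alpha>\<close> as well, and both claimed rates can be
  read off from it.\<close>

theorem mean_square_error_bound:
  fixes A :: "'x::{real_inner,complete_space} \<Rightarrow> 'y::{real_inner,complete_space}"
  assumes cpt: "compact_operator A" and asm: "assumption_A A S0 u v0 a c s"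
  obtains C where "0 \<le> C" "0 < a" "0 \<le> s" "0 \<le> op_trace S0"
    "\<And>\<alpha> \<gamma> (M :: 'w measure) y v n. \<lbrakk>\<And>i. 1 \<le> i \<Longrightarrow> 0 < \<alpha> i; 0 < \<gamma>; prob_space M;
      data_model_1 M \<gamma> A u y; variant_3DVAR M A S0 \<alpha> v0 y v; 1 \<le> n\<rbrakk> \<Longrightarrow>
      integrable M (\<lambda>\<omega>. (norm (v n \<omega> - u))\<^sup>2) \<and>
      (\<integral>\<omega>. (norm (v n \<omega> - u))\<^sup>2 \<partial>M)
        \<le> C * (\<Sum>j=1..n. 1 / \<alpha> j) powr (- s / (a + 1)) + \<gamma>\<^sup>2 * op_trace S0 * (\<Sum>j=1..n. 1 / \<alpha> j)"
proof -
  have psa: "positive_selfadjoint S0" and inj: "inj S0" and a: "0 < a" and c: "1 \<le> c"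
    and s: "0 \<le> s" "s \<le> a + 2" and dom: "v0 - u \<in> op_power_domain S0 (- s / 2)" and tr: "trace_class S0"
    and A_norm: "\<And>x. inverse c * norm (op_power S0 (a / 2) x) \<le> norm (A x)"
      "\<And>x. norm (A x) \<le> c * norm (op_power S0 (a / 2) x)"
    using asm unfolding assumption_A_def by blast+
  obtain B where B: "orthonormal_basis B" "(\<lambda>e. S0 e \<bullet> e) summable_on B"
    using tr by (auto simp: trace_class_def)
  interpret B: onb B by (rule onb.intro[OF B(1)])
  obtain E where E: "orthonormal_basis E" "\<And>e. e \<in> E \<Longrightarrow> \<exists>l. S0 e = l *\<^sub>R e"
    using eigenbasis_exists[OF psa B.trace_class_compact[OF psa B(2)]] by blast
  interpret S: spectral E S0 by (intro spectral.intro onb.intro spectral_axioms.intro E psa)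
  interpret S: injective_spectral E S0
  proof
    fix e assume e: "e \<in> E"
    show "0 < S.ev e"
    proof (rule ccontr)
      assume "\<not> 0 < S.ev e"
      then have "S0 e = S0 0" using S.T_eigen[OF e] S.ev_nonneg[of e] by (simp add: S.T.zero)
      then have "e = 0" by (rule injD[OF inj])
      then show False using orthonormal_inner[OF S.orthonormal e e] by simp
    qed
  qed
  have A_bl: "bounded_linear A" by (rule compact_operator_bounded_linear[OF cpt])
  obtain A' where A': "\<And>x y. A x \<bullet> y = x \<bullet> A' y" "bounded_linear A'" using B.adjoint_exists[OF A_bl] by blast
  interpret S: hilbert_scale E S0 A A' a c
  proof (intro hilbert_scale.intro hilbert_scale_axioms.intro)
    show "injective_spectral E S0" by unfold_locales
    have eq: "op_power S0 (a / 2) x = S.pw (a / 2) x" for x using a by (simp add: S.op_power_eq_pw)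
    show "norm (S.pw (a / 2) x) \<le> c * norm (A x)" for x
      using A_norm(1)[of x] c by (simp add: eq field_simps)
    show "norm (A x) \<le> c * norm (S.pw (a / 2) x)" for x
      using A_norm(2)[of x] by (simp add: eq)
  qed (use A_bl A' a c in auto)
  obtain F where F: "orthonormal_basis F" "\<And>e. e \<in> F \<Longrightarrow> \<exists>l. S.H e = l *\<^sub>R e"
    using eigenbasis_exists[OF S.H_psa S.H_compact[OF B]] by blast
  interpret S: diagonalised_scale E S0 A A' a c F by unfold_locales (use F in auto)
  \<comment> \<open>The basis that \<open>op_trace\<close> chooses, so that the sum over
    \<open>G\<close> is the trace by definition.\<close>
  define G where "G = (SOME E :: 'x set. orthonormal_basis E)"
  have G: "orthonormal_basis G" unfolding G_def using B(1) by (rule someI)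
  then have G_tr: "(\<lambda>e. S0 e \<bullet> e) summable_on G"
    by (intro S.trace_summable[OF B]) (simp add: orthonormal_basis_iff)
  have trace: "infsum (\<lambda>e. S0 e \<bullet> e) G = op_trace S0" by (simp add: op_trace_def G_def)
  have "v0 - u \<in> op_power_domain S0 (- (s / 2))" using dom by simp
  then obtain w where w: "v0 - u = S.pw (s / 2) w" using S.source_representation s(1) by (metis divide_nonneg_pos zero_less_numeral)
  show ?thesis
  proof (rule that[of "8 * c ^ 4 * (norm w)\<^sup>2", OF _ a s(1)])
    show "0 \<le> op_trace S0"
      unfolding trace[symmetric] using psa_nonneg[OF psa] by (intro infsum_nonneg) auto
    fix \<alpha> :: "nat \<Rightarrow> real" and \<gamma> :: real and M :: "'w measure" and y v and n :: nat
    assume \<alpha>: "\<And>i. 1 \<le> i \<Longrightarrow> 0 < \<alpha> i" and \<gamma>: "0 < \<gamma>" and M: "prob_space M"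
      and y: "data_model_1 M \<gamma> A u y" and v: "variant_3DVAR M A S0 \<alpha> v0 y v" and n: "1 \<le> n"
    obtain \<eta> where \<eta>: "\<And>n. 1 \<le> n \<Longrightarrow> white_noise M \<gamma> (\<eta> n)"
      "prob_space.indep_vars M (\<lambda>_. \<Pi>\<^sub>M z\<in>UNIV. borel) (\<lambda>n \<omega> z. \<eta> n z \<omega>) {1..}"
      "\<And>n z \<omega>. 1 \<le> n \<Longrightarrow> y n z \<omega> = A u \<bullet> z + \<eta> n z \<omega>"
      using y unfolding data_model_1_def by blast
    show "integrable M (\<lambda>\<omega>. (norm (v n \<omega> - u))\<^sup>2) \<and>
      (\<integral>\<omega>. (norm (v n \<omega> - u))\<^sup>2 \<partial>M)
        \<le> 8 * c ^ 4 * (norm w)\<^sup>2 * (\<Sum>j=1..n. 1 / \<alpha> j) powr (- s / (a + 1))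
          + \<gamma>\<^sup>2 * op_trace S0 * (\<Sum>j=1..n. 1 / \<alpha> j)"
      using S.mean_square_error[OF \<alpha> M \<gamma> \<eta> v n s w G G_tr] unfolding trace by blast
  qed simp
qed

theorem theorem8:
  fixes A :: "'x::{real_inner,complete_space} \<Rightarrow> 'y::{real_inner,complete_space}"
    and S0 :: "'x \<Rightarrow> 'x"
    and u v0 :: 'x
    and a c s :: real
  assumes "compact_operator A"
    and "assumption_A A S0 u v0 a c s"
  shows
    "(\<forall>(\<alpha> :: nat \<Rightarrow> real) (\<sigma> :: nat \<Rightarrow> real) (c' :: real).
        (\<forall>n\<ge>1. 0 < \<alpha> n) \<longrightarrow>
        (\<forall>n. \<sigma> n = (\<Sum>j = 1..n. 1 / \<alpha> j)) \<longrightarrow>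
        (\<forall>n\<ge>2. 1 / \<alpha> n \<le> c' * \<sigma> (n - 1)) \<longrightarrow>
        (\<exists>C :: real. \<forall>(\<gamma> :: real) (M :: 'w measure) y v.
           0 < \<gamma> \<longrightarrow> prob_space M \<longrightarrow> data_model_1 M \<gamma> A u y \<longrightarrow>
           variant_3DVAR M A S0 \<alpha> v0 y v \<longrightarrow>
           (\<forall>n\<ge>1. integrable M (\<lambda>\<omega>. (norm (v n \<omega> - u))\<^sup>2) \<and>
              (\<integral>\<omega>. (norm (v n \<omega> - u))\<^sup>2 \<partial>M)
                \<le> C * (\<sigma> n powr (- s / (a + 1)) + \<gamma>\<^sup>2 * op_trace S0 * \<sigma> n))))
     \<and>
     (\<forall>(\<alpha>0 :: real) (q :: real).
        0 < \<alpha>0 \<longrightarrow> 0 < q \<longrightarrow> q < 1 \<longrightarrow>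
        (\<exists>C :: real. \<forall>(\<gamma> :: real) (M :: 'w measure) y v.
           0 < \<gamma> \<longrightarrow> prob_space M \<longrightarrow> data_model_1 M \<gamma> A u y \<longrightarrow>
           variant_3DVAR M A S0 (\<lambda>n. \<alpha>0 * q ^ (n - 1)) v0 y v \<longrightarrow>
           (\<forall>n\<ge>1. integrable M (\<lambda>\<omega>. (norm (v n \<omega> - u))\<^sup>2) \<and>
              (\<integral>\<omega>. (norm (v n \<omega> - u))\<^sup>2 \<partial>M)
                \<le> C * (q powr (s / (a + 1) * real n)
                       + \<gamma>\<^sup>2 * op_trace S0 * q powr (- real n)))))"
proof -
  obtain C where C: "0 \<le> C" "0 < a" "0 \<le> s" "0 \<le> op_trace S0"
    and bound: "\<And>\<alpha> \<gamma> (M :: 'w measure) y v n. \<lbrakk>\<And>i. 1 \<le> i \<Longrightarrow> 0 < \<alpha> i; 0 < \<gamma>; prob_space M;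
      data_model_1 M \<gamma> A u y; variant_3DVAR M A S0 \<alpha> v0 y v; 1 \<le> n\<rbrakk> \<Longrightarrow>
      integrable M (\<lambda>\<omega>. (norm (v n \<omega> - u))\<^sup>2) \<and>
      (\<integral>\<omega>. (norm (v n \<omega> - u))\<^sup>2 \<partial>M)
        \<le> C * (\<Sum>j=1..n. 1 / \<alpha> j) powr (- s / (a + 1)) + \<gamma>\<^sup>2 * op_trace S0 * (\<Sum>j=1..n. 1 / \<alpha> j)"
    using mean_square_error_bound[OF assms, where 'w='w] by blast
  show ?thesis
  proof (intro conjI allI impI)
    fix \<alpha> \<sigma> :: "nat \<Rightarrow> real"
    assume \<alpha>: "\<forall>n\<ge>1. 0 < \<alpha> n" and \<sigma>: "\<forall>n. \<sigma> n = (\<Sum>j = 1..n. 1 / \<alpha> j)"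
    \<comment> \<open>\<open>C + 1\<close> dominates both the bias coefficient \<open>C\<close> and
      the variance coefficient 1.\<close>
    have "C * r + t \<le> (C + 1) * (r + t)" if "0 \<le> r" "0 \<le> t" for r t
      using that C(1) by (simp add: algebra_simps)
    moreover have "0 \<le> \<gamma>\<^sup>2 * op_trace S0 * \<sigma> n" for \<gamma> n
      using \<alpha> \<sigma> C(4) by (auto intro!: mult_nonneg_nonneg sum_nonneg simp: less_imp_le)
    ultimately have le: "C * \<sigma> n powr (- s / (a + 1)) + \<gamma>\<^sup>2 * op_trace S0 * \<sigma> n
        \<le> (C + 1) * (\<sigma> n powr (- s / (a + 1)) + \<gamma>\<^sup>2 * op_trace S0 * \<sigma> n)" for \<gamma> n
      by simp
    show "\<exists>C. \<forall>\<gamma> (M :: 'w measure) y v.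
           0 < \<gamma> \<longrightarrow> prob_space M \<longrightarrow> data_model_1 M \<gamma> A u y \<longrightarrow>
           variant_3DVAR M A S0 \<alpha> v0 y v \<longrightarrow>
           (\<forall>n\<ge>1. integrable M (\<lambda>\<omega>. (norm (v n \<omega> - u))\<^sup>2) \<and>
              (\<integral>\<omega>. (norm (v n \<omega> - u))\<^sup>2 \<partial>M)
                \<le> C * (\<sigma> n powr (- s / (a + 1)) + \<gamma>\<^sup>2 * op_trace S0 * \<sigma> n))"
    proof (intro exI[of _ "C + 1"] allI impI)
      fix \<gamma> and M :: "'w measure" and y v and n :: nat
      assume "0 < \<gamma>" "prob_space M" "data_model_1 M \<gamma> A u y" "variant_3DVAR M A S0 \<alpha> v0 y v" "1 \<le> n"
      from bound[OF _ this] \<alpha> \<sigma> le[of n \<gamma>]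
      show "integrable M (\<lambda>\<omega>. (norm (v n \<omega> - u))\<^sup>2) \<and>
        (\<integral>\<omega>. (norm (v n \<omega> - u))\<^sup>2 \<partial>M) \<le> (C + 1) * (\<sigma> n powr (- s / (a + 1)) + \<gamma>\<^sup>2 * op_trace S0 * \<sigma> n)"
        by force
    qed
  next
    fix \<alpha>0 q :: real
    assume \<alpha>0: "0 < \<alpha>0" and q: "0 < q" "q < 1"
    define p where "p = s / (a + 1)"
    have p: "0 \<le> p" using C by (simp add: p_def)
    define \<sigma> where "\<sigma> n = (\<Sum>j=1..n. 1 / (\<alpha>0 * q ^ (j - 1)))" for n :: nat
    have upper: "\<sigma> n \<le> 1 / (\<alpha>0 * (1 - q)) * q powr (- real n)" for n
    proof (induction n)
      case 0
      then show ?case using \<alpha>0 q by (simp add: \<sigma>_def)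
    next
      case (Suc n)
      have "\<sigma> (Suc n) = \<sigma> n + 1 / (\<alpha>0 * q ^ n)" by (simp add: \<sigma>_def)
      also have "\<dots> \<le> 1 / (\<alpha>0 * (1 - q)) * (1 / q ^ n) + 1 / (\<alpha>0 * q ^ n)"
        using Suc q by (simp add: powr_minus powr_realpow inverse_eq_divide)
      also have "\<dots> \<le> 1 / (\<alpha>0 * (1 - q)) * (1 / q ^ Suc n)"
      proof -
        \<comment> \<open>In units of \<open>r\<close> the claim is
          \<open>q + q * (1 - q) \<le> 1\<close>, that is, \<open>(1 - q)^2\<close> is
          nonnegative.\<close>
        define r where "r = 1 / (\<alpha>0 * (1 - q) * q ^ Suc n)"
        have r: "0 < r" using \<alpha>0 q by (simp add: r_def)
        have "1 / (\<alpha>0 * (1 - q)) * (1 / q ^ n) = q * r" "1 / (\<alpha>0 * q ^ n) = q * (1 - q) * r"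
          "1 / (\<alpha>0 * (1 - q)) * (1 / q ^ Suc n) = r"
          using \<alpha>0 q by (simp_all add: r_def)
        moreover have "q * r + q * (1 - q) * r \<le> r"
        proof -
          have "0 \<le> (1 - q)\<^sup>2 * r" using r by simp
          then show ?thesis by (simp add: power2_eq_square algebra_simps)
        qed
        ultimately show ?thesis by (simp only:)
      qed
      finally show ?case using q by (simp add: powr_minus powr_realpow inverse_eq_divide del: of_nat_Suc)
    qed
    \<comment> \<open>The last summand alone has the order \<open>q powr (- real n)\<close>, and the
      exponent \<open>- p\<close> reverses the inequality. For \<open>1 \<le> n\<close> the
      subtraction in \<open>n - 1\<close> is not truncated.\<close>
    have lower: "\<sigma> n powr (- p) \<le> (\<alpha>0 / q) powr p * q powr (p * real n)" if n: "1 \<le> n" for n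
    proof -
      have "1 / (\<alpha>0 * q ^ (n - 1)) \<le> \<sigma> n"
        unfolding \<sigma>_def using n \<alpha>0 q by (intro member_le_sum) auto
      moreover have "1 / (\<alpha>0 * q ^ (n - 1)) = q / \<alpha>0 * q powr (- real n)"
        using n q by (cases n) (auto simp: powr_minus powr_realpow inverse_eq_divide simp del: of_nat_Suc)
      ultimately have "\<sigma> n powr (- p) \<le> (q / \<alpha>0 * q powr (- real n)) powr (- p)"
        using p \<alpha>0 q by (intro powr_mono2') auto
      also have "\<dots> = (\<alpha>0 / q) powr p * q powr (p * real n)"
        using \<alpha>0 q by (simp add: powr_mult powr_powr powr_minus powr_divide inverse_eq_divide mult.commute)
      finally show ?thesis .
    qed
    define k1 k2 where "k1 = C * (\<alpha>0 / q) powr p" and "k2 = 1 / (\<alpha>0 * (1 - q))"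
    have k: "0 \<le> k1" "0 \<le> k2" using C(1) \<alpha>0 q by (simp_all add: k1_def k2_def)
    \<comment> \<open>The cross terms \<open>k1 * Y\<close> and \<open>k2 * X\<close> are
      nonnegative, so the sum of the two constants serves both rates.\<close>
    define K where "K = k1 + k2"
    have le: "C * \<sigma> n powr (- s / (a + 1)) + \<gamma>\<^sup>2 * op_trace S0 * \<sigma> n
        \<le> K * (q powr (s / (a + 1) * real n) + \<gamma>\<^sup>2 * op_trace S0 * q powr (- real n))"
      if n: "1 \<le> n" for \<gamma> n
    proof -
      define X where "X = q powr (p * real n)"
      define Y where "Y = \<gamma>\<^sup>2 * op_trace S0 * q powr (- real n)"
      have XY: "0 \<le> X" "0 \<le> Y" using C(4) by (simp_all add: X_def Y_def)
      have "C * \<sigma> n powr (- p) \<le> k1 * X"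
        unfolding X_def k1_def mult.assoc by (rule mult_left_mono[OF lower[OF n] C(1)])
      moreover have "\<gamma>\<^sup>2 * op_trace S0 * \<sigma> n \<le> k2 * Y"
        using mult_left_mono[OF upper[of n, folded k2_def], of "\<gamma>\<^sup>2 * op_trace S0"] C(4)
        by (simp add: Y_def mult_ac)
      moreover have "0 \<le> k1 * Y" "0 \<le> k2 * X" using XY k by simp_all
      ultimately have "C * \<sigma> n powr (- p) + \<gamma>\<^sup>2 * op_trace S0 * \<sigma> n \<le> K * (X + Y)"
        unfolding K_def distrib_left distrib_right by linarith
      then show ?thesis by (simp add: X_def Y_def p_def)
    qed
    show "\<exists>C. \<forall>\<gamma> (M :: 'w measure) y v.
           0 < \<gamma> \<longrightarrow> prob_space M \<longrightarrow> data_model_1 M \<gamma> A u y \<longrightarrow>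
           variant_3DVAR M A S0 (\<lambda>n. \<alpha>0 * q ^ (n - 1)) v0 y v \<longrightarrow>
           (\<forall>n\<ge>1. integrable M (\<lambda>\<omega>. (norm (v n \<omega> - u))\<^sup>2) \<and>
              (\<integral>\<omega>. (norm (v n \<omega> - u))\<^sup>2 \<partial>M)
                \<le> C * (q powr (s / (a + 1) * real n) + \<gamma>\<^sup>2 * op_trace S0 * q powr (- real n)))"
    proof (intro exI[of _ K] allI impI)
      fix \<gamma> and M :: "'w measure" and y v and n :: nat
      assume *: "0 < \<gamma>" "prob_space M" "data_model_1 M \<gamma> A u y"
        "variant_3DVAR M A S0 (\<lambda>n. \<alpha>0 * q ^ (n - 1)) v0 y v" "1 \<le> n"
      have "0 < \<alpha>0 * q ^ (i - 1)" for i using \<alpha>0 q by simp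
      from bound[OF this *] le[OF *(5), of \<gamma>]
      show "integrable M (\<lambda>\<omega>. (norm (v n \<omega> - u))\<^sup>2) \<and>
        (\<integral>\<omega>. (norm (v n \<omega> - u))\<^sup>2 \<partial>M)
          \<le> K * (q powr (s / (a + 1) * real n) + \<gamma>\<^sup>2 * op_trace S0 * q powr (- real n))"
        unfolding \<sigma>_def by (auto intro: order_trans)
    qed
  qed
qed

end
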